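(* Let $1\le p_-\le p_0\le p_+<\infty$. Assume that $T$ is an operator acting from $\bigcup_{w\in A_{p_0/p_-}\cap RH_{(p_+/p_0)'}}L_{p_0,w}(\mathbb R^n)$ into the space of measurable functions that satisfies $$\|Tf|L_{p_0,w}(\mathbb R^n)\|\le c_1\|f|L_{p_0,w}(\mathbb R^n)\|$$ for all $f\in L_{p_0,w}(\mathbb R^n)$ and $w\in A_{p_0/p_-}\cap RH_{(p_+/p_0)'}$, with a bound $c_1$ independent of $f$ and depending on $w$ only through its $A_{p_0}$-constant. Then for every $p_-<p<p_+$ (and also $p=p_-$ if $p_0=p_-$) and $w\in A_{p/p_-}\cap RH_\sigma$ with $\sigma\ge(p_+/p)'$, and for every $-n/p\le r\le -n\sigma'/p_+$, we have $$\|Tf|L^r_p(w,\mathbb R^n)\|\le c_2\|f|L^r_p(w,\mathbb R^n)\|$$ for all $f\in L^r_p(w,\mathbb R^n)$ (with $T$ defined on this space by restriction). Furthermore, if $-n/p\le r\le -n/(p\sigma)-n/p_+$, we have $$\|Tf|L^r_p(\lambda,w,\mathbb R^n)\|\le c_3\|f|L^r_p(\lambda,w,\mathbb R^n)\|$$ for all $f\in L^r_p(\lambda,w,\mathbb R^n)$ (with $T$ defined on this space by restriction). The constants $c_2$, $c_3$ do not depend on $f$.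
   Context: "$T$ defined by restriction" means that the Morrey space is contained in the domain of $T$, i.e. in the union of the spaces $L_{p_0,u}(\mathbb R^n)$, $u\in A_{p_0/p_-}\cap RH_{(p_+/p_0)'}$. Cubes in $\mathbb R^n$ have sides parallel to the axes. A weight is a nonnegative locally integrable function; $w(E)=\int_E w$, $|E|$ is Lebesgue measure, $p'$ is the conjugate exponent, $1'=\infty$. For $0<p<\infty$, $\|f|L_{p,w}(E)\|=(\int_E|f|^pw)^{1/p}$. Muckenhoupt classes: for $1<p<\infty$ and $w>0$ a.e. locally integrable, $w\in A_p$ iff $[w]_{A_p}=\sup_Q\frac{w(Q)}{|Q|}\big(\frac{w^{1-p'}(Q)}{|Q|}\big)^{p-1}<\infty$; $w\in A_1$ iff there is $c$ with $w(Q)/|Q|\le c\,w(x)$ for a.e. $x\in Q$ and every cube $Q$ ($[w]_{A_1}$ is the least such $c$). Reverse Hölder class: for $1<\sigma<\infty$, $w\in RH_\sigma$ iff there is $c$ with $\big(|Q|^{-1}\int_Q w^\sigma\big)^{1/\sigma}\le c\,|Q|^{-1}\int_Q w$ for all cubes $Q$. (For the endpoint exponent $\infty$, arising when $p_0=p_+$, the standard convention is $w\in RH_\infty$ iff $\operatorname{ess\,sup}_Q w\le c\,|Q|^{-1}\int_Q w$ for all cubes $Q$.) Morrey spaces: for $0<p<\infty$, $-n/p\le r<0$ and a weight $w$, the spaces $L^r_p(w,\mathbb R^n)$ and $L^r_p(\lambda,w,\mathbb R^n)$ consist of the (classes of) measurable complex functions $f$ on $\mathbb R^n$ for which, respectively,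 the following quasinorms are finite (suprema over all cubes; here $\lambda$ is just a label for the second type of space): $$\|f|L^r_p(w,\mathbb R^n)\|=\sup_Q w(Q)^{-(1/p+r/n)}\|f|L_{p,w}(Q)\|,\qquad \|f|L^r_p(\lambda,w,\mathbb R^n)\|=\sup_Q |Q|^{-(1/p+r/n)}\|f|L_{p,w}(Q)\|.$$ *)

theory Defs
  imports "HOL-Analysis.Analysis" "HOL-Probability.Essential_Supremum"
begin

text \<open>
  All spaces of functions on \<open>\<real>\<^sup>n\<close> are taken with respect to \<^term>\<open>lebesgue\<close>; norms and means are
  \<^typ>\<open>ennreal\<close>-valued, so that infinite values are meaningful.
\<close>

text \<open>Only used for \<open>a > 0\<close>, whence \<open>\<infinity>\<^sup>a = \<infinity>\<close>.\<close>

definition enn_powr :: "ennreal \<Rightarrow> real \<Rightarrow> ennreal" where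
  "enn_powr x a = (if x = top then top else ennreal (enn2real x powr a))"

definition conj_exp :: "ereal \<Rightarrow> ereal" where
  "conj_exp p = (if p = 1 then \<infinity> else if p = \<infinity> then 1 else p / (p - 1))"

definition cubes :: "(real ^ 'n) set set" where
  "cubes = {cbox a (\<chi> i. a $ i + s) | a s. 0 < s}"

definition weight :: "(real ^ 'n \<Rightarrow> real) \<Rightarrow> bool" where
  "weight w \<longleftrightarrow> (\<forall>x. 0 \<le> w x) \<and> (\<forall>K. compact K \<longrightarrow> set_integrable lebesgue K w)"

definition mean :: "(real ^ 'n) set \<Rightarrow> (real ^ 'n \<Rightarrow> real) \<Rightarrow> ennreal" where
  "mean Q g = (\<integral>\<^sup>+x\<in>Q. ennreal (g x) \<partial>lebesgue) / emeasure lebesgue Q"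

text \<open>
  The constant \<open>[w]\<close> of the class \<open>A\<^sub>p\<close>, for \<open>1 \<le> p < \<infinity>\<close>; here \<open>1 - p' = 1 - p / (p - 1)\<close>.
  For \<open>p = 1\<close> it is the infimum of the admissible constants, and \<open>\<infinity>\<close> if there is no finite one.
\<close>

definition muckenhoupt_const :: "real \<Rightarrow> (real ^ 'n \<Rightarrow> real) \<Rightarrow> ennreal" where
  "muckenhoupt_const p w =
     (if p = 1 then Inf {c. \<forall>Q\<in>cubes. AE x in lebesgue. x \<in> Q \<longrightarrow> mean Q w \<le> c * ennreal (w x)}
      else (SUP Q\<in>cubes. mean Q w * enn_powr (mean Q (\<lambda>x. w x powr (1 - p / (p - 1)))) (p - 1)))"

text \<open>
  Positivity almost everywhere is required for \<open>p = 1\<close> as well; it only excludes the zero weight.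
\<close>

definition muckenhoupt :: "real \<Rightarrow> (real ^ 'n \<Rightarrow> real) set" where
  "muckenhoupt p = {w. weight w \<and> (AE x in lebesgue. 0 < w x) \<and> muckenhoupt_const p w < top}"

definition reverse_Holder :: "ereal \<Rightarrow> (real ^ 'n \<Rightarrow> real) set" where
  "reverse_Holder \<sigma> = {w. weight w \<and> (\<exists>c::real. \<forall>Q\<in>cubes.
     (if \<sigma> = \<infinity> then esssup (lebesgue_on Q) (\<lambda>x. ennreal (w x))
      else enn_powr (mean Q (\<lambda>x. w x powr real_of_ereal \<sigma>)) (1 / real_of_ereal \<sigma>))
     \<le> ennreal c * mean Q w)}"

definition Lp_norm :: "real \<Rightarrow> (real ^ 'n \<Rightarrow> real) \<Rightarrow> (real ^ 'n) set \<Rightarrow> (real ^ 'n \<Rightarrow> complex) \<Rightarrow> ennreal"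
  where "Lp_norm p w E f = enn_powr (\<integral>\<^sup>+x\<in>E. ennreal (norm (f x) powr p * w x) \<partial>lebesgue) (1 / p)"

definition Lp_space :: "real \<Rightarrow> (real ^ 'n \<Rightarrow> real) \<Rightarrow> (real ^ 'n \<Rightarrow> complex) set" where
  "Lp_space p w = {f \<in> borel_measurable lebesgue. Lp_norm p w UNIV f < top}"

text \<open>The two Morrey quasinorms, normalised by \<open>w(Q)\<close> and by \<open>|Q|\<close> respectively.\<close>

definition morrey_norm ::
    "real \<Rightarrow> real \<Rightarrow> (real ^ 'n \<Rightarrow> real) \<Rightarrow> (real ^ 'n \<Rightarrow> complex) \<Rightarrow> ennreal" where
  "morrey_norm p r w f = (SUP Q\<in>cubes.
     ennreal ((LINT x:Q|lebesgue. w x) powr (- (1 / p + r / real CARD('n)))) * Lp_norm p w Q f)"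

definition morrey_space ::
    "real \<Rightarrow> real \<Rightarrow> (real ^ 'n \<Rightarrow> real) \<Rightarrow> (real ^ 'n \<Rightarrow> complex) set" where
  "morrey_space p r w = {f \<in> borel_measurable lebesgue. morrey_norm p r w f < top}"

definition morrey_lambda_norm ::
    "real \<Rightarrow> real \<Rightarrow> (real ^ 'n \<Rightarrow> real) \<Rightarrow> (real ^ 'n \<Rightarrow> complex) \<Rightarrow> ennreal" where
  "morrey_lambda_norm p r w f = (SUP Q\<in>cubes.
     ennreal (measure lebesgue Q powr (- (1 / p + r / real CARD('n)))) * Lp_norm p w Q f)"

definition morrey_lambda_space ::
    "real \<Rightarrow> real \<Rightarrow> (real ^ 'n \<Rightarrow> real) \<Rightarrow> (real ^ 'n \<Rightarrow> complex) set" where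
  "morrey_lambda_space p r w = {f \<in> borel_measurable lebesgue. morrey_lambda_norm p r w f < top}"

text \<open>The weights in \<open>A\<^bsub>p/p\<^sub>-\<^esub> \<inter> RH\<^bsub>(p\<^sub>+/p)'\<^esub>\<close>, and the union of the spaces \<open>L\<^bsub>p,w\<^esub>\<close> over them.\<close>

definition limited_weights :: "real \<Rightarrow> real \<Rightarrow> real \<Rightarrow> (real ^ 'n \<Rightarrow> real) set" where
  "limited_weights pm pp p = muckenhoupt (p / pm) \<inter> reverse_Holder (conj_exp (ereal (pp / p)))"

definition limited_domain :: "real \<Rightarrow> real \<Rightarrow> real \<Rightarrow> (real ^ 'n \<Rightarrow> complex) set" where
  "limited_domain pm pp p = (\<Union>w\<in>limited_weights pm pp p. Lp_space p w)"

text \<open>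
  An operator acting on almost-everywhere classes of functions in \<open>D\<close>, with measurable values,
  is represented by a map on functions compatible with equality almost everywhere.
\<close>

definition operator_on ::
    "(real ^ 'n \<Rightarrow> complex) set \<Rightarrow> ((real ^ 'n \<Rightarrow> complex) \<Rightarrow> (real ^ 'n \<Rightarrow> complex)) \<Rightarrow> bool" where
  "operator_on D T \<longleftrightarrow>
     (\<forall>f\<in>D. T f \<in> borel_measurable lebesgue) \<and>
     (\<forall>f\<in>D. \<forall>g\<in>D. (AE x in lebesgue. f x = g x) \<longrightarrow> (AE x in lebesgue. T f x = T g x))"

end

theory Submission
  imports Defs
begin

text \<open>
  Fix a weight \<open>w\<close> and a cube \<open>Q\<close>. The weight
  \<open>v = (\<nu>(Q) / \<nu>(2\<^sup>iQ))\<^sup>\<gamma> w\<close> on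
  \<open>2\<^sup>iQ - 2\<^bsup>i-1\<^esup>Q\<close>, with \<open>\<nu> = w\<close> or Lebesgue measure, is at least \<open>w\<close> on
  \<open>Q\<close>. The bound on \<open>r\<close> leaves room for an exponent \<open>\<gamma>\<close> slightly larger than
  \<open>1 + pr/n\<close>, so that \<open>\<integral> |f|\<^sup>p v\<close> is bounded by a geometric series of Morrey terms, and
  for which \<open>v\<close> is still in the classes for \<open>p\<close>, uniformly in \<open>Q\<close>. It remains to
  extrapolate the hypothesis from \<open>p\<^sub>0\<close> to the space \<open>L\<^bsub>p,v\<^esub>\<close>. With
  \<open>s = (p\<^sub>+/p)'\<close>, a Rubio de Francia iteration on \<open>v\<^sup>s\<close> produces a majorant
  \<open>F\<close> of a prescribed function and a Jones factorisation
  \<open>v = u\<^sub>1\<^bsup>1-p/p\<^sub>+\<^esup> u\<^sub>2\<^bsup>1-p/p\<^sub>-\<^esup>\<close> at the same time, and the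
  hypothesis is applied to \<open>u\<^sub>1\<^bsup>1-p\<^sub>0/p\<^sub>+\<^esup> u\<^sub>2\<^bsup>1-p\<^sub>0/p\<^sub>-\<^esup>\<close>.
\<close>

text \<open>\<open>T\<close> is neither linear nor local, so \<open>f\<close> cannot be cut up
  according to a cube: \<open>T f\<close> on Q depends on all of \<open>f\<close>. The weight v lets
  one weighted space contain all of \<open>f\<close> while it keeps \<open>w\<close> on Q. Its decay
  must beat the growth allowed by the Morrey condition, yet be slow enough for the weight class.
  These demands meet exactly at the endpoint of \<open>r\<close>, where the missing room comes from
  reverse doubling of \<open>w powr \<sigma>\<close>. The power s merges the two class conditions on
  v into one Muckenhoupt condition on \<open>v powr s\<close>. In the extrapolation a power G of F
  dominates |f|^p v if p <= p0 and |T f|^p v if p > p0. The same G enters the weight for p0, so that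
  Young's inequality compares the spaces for p and p0. In the second case the prescribed function
  involves \<open>T f\<close> itself; truncation makes its integral finite, and half of that
  integral is absorbed. This takes the place of duality. Each application of the hypothesis also
  places \<open>f\<close> in a space L_(p0,u) with admissible u, which is the assertion about the
  domain.\<close>

abbreviation vol :: "(real ^ 'n) set \<Rightarrow> real" where
  "vol \<equiv> measure lebesgue"

abbreviation lmeas :: "(real ^ 'n \<Rightarrow> 'b::topological_space) set" where
  "lmeas \<equiv> borel_measurable lebesgue"

abbreviation lint :: "(real ^ 'n \<Rightarrow> real) \<Rightarrow> ennreal" where
  "lint h \<equiv> \<integral>\<^sup>+x. ennreal (h x) \<partial>lebesgue"

abbreviation pint_on :: "(real ^ 'n) set \<Rightarrow> real \<Rightarrow> (real ^ 'n \<Rightarrow> real) \<Rightarrow> (real ^ 'n \<Rightarrow> complex) \<Rightarrow> ennreal" where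
  "pint_on Q p w f \<equiv> \<integral>\<^sup>+x\<in>Q. ennreal (norm (f x) powr p * w x) \<partial>lebesgue"

abbreviation pint :: "real \<Rightarrow> (real ^ 'n \<Rightarrow> real) \<Rightarrow> (real ^ 'n \<Rightarrow> complex) \<Rightarrow> ennreal" where
  "pint p w f \<equiv> \<integral>\<^sup>+x. ennreal (norm (f x) powr p * w x) \<partial>lebesgue"

section \<open>Powers of extended nonnegative reals\<close>

lemma enn_powr_ennreal [simp]: "0 \<le> x \<Longrightarrow> enn_powr (ennreal x) a = ennreal (x powr a)"
  by (simp add: enn_powr_def)

lemma enn_powr_0 [simp]: "enn_powr 0 a = 0"
  by (simp add: enn_powr_def)

lemma enn_powr_top [simp]: "enn_powr top a = top"
  by (simp add: enn_powr_def)

lemma enn_powr_1 [simp]: "enn_powr x 1 = x"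
  by (cases x) (auto simp: powr_one')

lemma enn_powr_eq_top [simp]: "enn_powr x a = top \<longleftrightarrow> x = top"
  by (simp add: enn_powr_def)

lemma enn_powr_less_top [simp]: "enn_powr x a < top \<longleftrightarrow> x < top"
  by (simp add: less_top[symmetric])

lemma enn_powr_eq_0 [simp]: "enn_powr x a = 0 \<longleftrightarrow> x = 0"
  by (cases x) auto

lemma enn_powr_mono: "0 \<le> a \<Longrightarrow> x \<le> y \<Longrightarrow> enn_powr x a \<le> enn_powr y a"
  by (cases x; cases y) (auto simp: powr_mono2 intro!: ennreal_leI simp: top_unique)

text \<open>Valid for every \<open>a\<close>: all powers fix 0 and \<open>top\<close>, and
  \<open>0 * top = 0\<close>, so the degenerate cases agree on both sides.\<close>

lemma enn_powr_mult: "enn_powr (x * y) a = enn_powr x a * enn_powr y a"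
proof (cases "x = top \<or> y = top")
  case True
  then show ?thesis
    by (auto simp: ennreal_top_mult ennreal_mult_top)
next
  case False
  then obtain a b where "x = ennreal a" "y = ennreal b" "0 \<le> a" "0 \<le> b"
    by (metis ennreal_cases)
  then show ?thesis
    by (simp add: powr_mult ennreal_mult[symmetric])
qed

lemma enn_powr_powr: "enn_powr (enn_powr x a) b = enn_powr x (a * b)"
  by (cases x) (auto simp: powr_powr)

lemma enn_powr_add: "0 < a \<Longrightarrow> 0 < b \<Longrightarrow> enn_powr x (a + b) = enn_powr x a * enn_powr x b"
  by (cases x) (auto simp: powr_add ennreal_mult ennreal_top_mult)

lemma enn_powr_inverse: "a \<noteq> 0 \<Longrightarrow> enn_powr (enn_powr x a) (1 / a) = x"
  "a \<noteq> 0 \<Longrightarrow> enn_powr (enn_powr x (1 / a)) a = x"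
  by (simp_all add: enn_powr_powr)

lemma enn_powr_le_iff:
  assumes "0 < a" shows "enn_powr x a \<le> enn_powr y a \<longleftrightarrow> x \<le> y"
proof
  assume *: "enn_powr x a \<le> enn_powr y a"
  have "x = enn_powr (enn_powr x a) (1 / a)"
    using assms by (simp only: enn_powr_inverse)
  also have "\<dots> \<le> enn_powr (enn_powr y a) (1 / a)"
    using assms * by (intro enn_powr_mono[OF _ *]) auto
  also have "\<dots> = y"
    using assms by (simp only: enn_powr_inverse)
  finally show "x \<le> y" .
next
  assume "x \<le> y" then show "enn_powr x a \<le> enn_powr y a"
    using assms by (intro enn_powr_mono) auto
qed

lemma enn_powr_SUP:
  assumes "0 < a" shows "enn_powr (SUP i\<in>I. f i) a = (SUP i\<in>I. enn_powr (f i) a)"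
proof (rule antisym)
  let ?y = "SUP i\<in>I. enn_powr (f i) a"
  have "f i \<le> enn_powr ?y (1 / a)" if "i \<in> I" for i
  proof -
    have "f i = enn_powr (enn_powr (f i) a) (1 / a)"
      using assms by (simp add: enn_powr_inverse)
    also have "\<dots> \<le> enn_powr ?y (1 / a)"
      using assms that by (intro enn_powr_mono SUP_upper) auto
    finally show ?thesis .
  qed
  then have "(SUP i\<in>I. f i) \<le> enn_powr ?y (1 / a)"
    by (rule SUP_least)
  then have "enn_powr (SUP i\<in>I. f i) a \<le> enn_powr (enn_powr ?y (1 / a)) a"
    using assms by (intro enn_powr_mono) auto
  then show "enn_powr (SUP i\<in>I. f i) a \<le> ?y"
    using assms by (simp add: enn_powr_inverse)
qed (use assms in \<open>auto intro!: SUP_least enn_powr_mono SUP_upper\<close>)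

lemma enn_powr_max: "0 < a \<Longrightarrow> enn_powr (max x y) a = max (enn_powr x a) (enn_powr y a)"
  by (simp add: max_def enn_powr_le_iff)

lemma borel_measurable_enn_powr [measurable (raw)]:
  assumes [measurable]: "f \<in> borel_measurable M"
  shows "(\<lambda>x. enn_powr (f x) a) \<in> borel_measurable M"
  unfolding enn_powr_def by measurable

section \<open>Cubes\<close>

text \<open>Keeps the simplifier from replacing \<open>emeasure lebesgue\<close> by the measure of a
  main part with respect to \<open>lborel\<close>.\<close>

declare emeasure_completion [simp del]

text \<open>The closed ball of the maximum norm. Centre and half side length turn dilations and
  inclusions into arithmetic in \<open>t\<close>.\<close>

definition cb :: "real ^ 'n \<Rightarrow> real \<Rightarrow> (real ^ 'n) set" where
  "cb c t = {x. \<forall>i. \<bar>x $ i - c $ i\<bar> \<le> t}"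

lemma cb_eq_cbox: "cb c t = cbox (c - vec t) (c + vec t)"
  by (auto simp: cb_def mem_box_cart abs_le_iff algebra_simps)

lemma cb_sets [measurable, simp]: "cb c t \<in> sets lebesgue"
  unfolding cb_eq_cbox by simp

lemma cb_compact: "compact (cb c t)"
  unfolding cb_eq_cbox by (rule compact_cbox)

lemma cubes_eq: "cubes = {cb c t | c t. 0 < t}"
proof (intro equalityI subsetI)
  fix Q :: "(real ^ 'n) set" assume "Q \<in> cubes"
  then obtain a s where s: "0 < s" and Q: "Q = cbox a (\<chi> i. a $ i + s)"
    by (auto simp: cubes_def)
  have "Q = cb (a + vec (s / 2)) (s / 2)"
    unfolding Q cb_eq_cbox by (rule arg_cong2[where f = cbox]) (auto simp: vec_eq_iff)
  with s show "Q \<in> {cb c t | c t. 0 < t}" by (auto intro!: exI[where x = "s / 2"])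
next
  fix Q :: "(real ^ 'n) set" assume "Q \<in> {cb c t | c t. 0 < t}"
  then obtain c t where t: "0 < t" and Q: "Q = cb c t" by auto
  have "Q = cbox (c - vec t) (\<chi> i. (c - vec t) $ i + 2 * t)"
    unfolding Q cb_eq_cbox by (rule arg_cong2[where f = cbox]) (auto simp: vec_eq_iff)
  with t show "Q \<in> cubes" unfolding cubes_def
    by (intro CollectI exI[where x = "c - vec t"] exI[where x = "2 * t"]) auto
qed

lemma cb_in_cubes [simp]: "0 < t \<Longrightarrow> cb c t \<in> cubes"
  by (auto simp: cubes_eq)

lemma emeasure_cb:
  fixes c :: "real ^ 'n"
  assumes "0 \<le> t" shows "emeasure lebesgue (cb c t) = ennreal ((2 * t) ^ CARD('n))"
proof -
  have *: "\<And>i::'n. (c - vec t) $ i \<le> (c + vec t) $ i" using assms by simp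
  have "\<And>b::real^'n. b \<in> Basis \<Longrightarrow> (c - vec t) \<bullet> b \<le> (c + vec t) \<bullet> b"
    using * by (auto simp: Basis_vec_def inner_axis)
  then have "emeasure lborel (cbox (c - vec t) (c + vec t)) = (\<Prod>b\<in>(Basis::(real^'n) set). ((c + vec t) - (c - vec t)) \<bullet> b)"
    by (simp add: emeasure_lborel_cbox)
  also have "(\<Prod>b\<in>(Basis::(real^'n) set). ((c + vec t) - (c - vec t)) \<bullet> b) = (\<Prod>b\<in>(Basis::(real^'n) set). 2 * t)"
    by (intro prod.cong refl) (auto simp: Basis_vec_def inner_axis)
  finally show ?thesis unfolding cb_eq_cbox by (simp add: emeasure_completion)
qed

lemma measure_cb:
  fixes c :: "real ^ 'n"
  shows "0 \<le> t \<Longrightarrow> vol (cb c t) = (2 * t) ^ CARD('n)"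
  by (simp add: measure_def emeasure_cb del: emeasure_completion)

lemma cube_cases:
  assumes "Q \<in> cubes" obtains c t where "0 < t" "Q = cb c t"
  using assms by (auto simp: cubes_eq)

lemma cubes_sets [simp, measurable_dest]: "Q \<in> cubes \<Longrightarrow> Q \<in> sets lebesgue"
  by (auto simp: cubes_eq)

lemma cubes_measure_pos [simp]: "Q \<in> cubes \<Longrightarrow> 0 < vol Q"
  by (auto simp: cubes_eq measure_cb)

lemma emeasure_cubes: "Q \<in> cubes \<Longrightarrow> emeasure lebesgue Q = ennreal (vol Q)"
  by (auto simp: cubes_eq measure_cb emeasure_cb)

lemma cb_mono: "s \<le> t \<Longrightarrow> cb c s \<subseteq> cb c t"
  by (auto simp: cb_def intro: order_trans)

lemma cb_subset_cb:
  assumes "\<And>i. \<bar>c $ i - d $ i\<bar> \<le> r" "s + r \<le> t" shows "cb c s \<subseteq> cb d t"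
proof
  fix x assume x: "x \<in> cb c s"
  have "\<bar>x $ i - d $ i\<bar> \<le> t" for i
    using x[unfolded cb_def mem_Collect_eq, THEN spec[of _ i]] assms(1)[of i] assms(2) by linarith
  then show "x \<in> cb d t" by (simp add: cb_def)
qed

lemma cb_meet_subset:
  assumes "x \<in> cb c s" "x \<in> cb d t" shows "cb c s \<subseteq> cb d (t + 2 * s)"
proof (rule cb_subset_cb[where r = "t + s"])
  show "\<bar>c $ i - d $ i\<bar> \<le> t + s" for i
    using assms[unfolded cb_def mem_Collect_eq, THEN spec[of _ i]] by linarith
qed simp

lemma subset_cb:
  assumes "bounded S" obtains t where "0 < t" "S \<subseteq> cb c t"
proof -
  obtain B where B: "\<And>x. x \<in> S \<Longrightarrow> norm (x - c) \<le> B"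
  proof -
    from assms have "bounded ((\<lambda>x. x - c) ` S)"
      by (rule bounded_translation_minus)
    then show thesis using that by (auto simp: bounded_iff)
  qed
  have "S \<subseteq> cb c (max 1 B)"
  proof
    fix x assume "x \<in> S"
    then have "\<bar>(x - c) $ i\<bar> \<le> B" for i
      using B[of x] component_le_norm_cart[of "x - c" i] by linarith
    then have "\<bar>x $ i - c $ i\<bar> \<le> max 1 B" for i by (simp add: le_max_iff_disj)
    then show "x \<in> cb c (max 1 B)" by (simp add: cb_def)
  qed
  then show thesis by (rule that[rotated]) auto
qed

text \<open>Centres from a countable dense set, half sides rational. A shift of the centre by at
  most \<open>t / 2\<close> is absorbed by a half side above \<open>3 * t / 2\<close>, and a half
  side below \<open>2 * t\<close> costs the factor \<open>2 ^ CARD('n)\<close> in volume.\<close>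

lemma countable_cube_family:
  obtains \<C> :: "(real ^ 'n) set set" where "countable \<C>" "\<C> \<subseteq> cubes"
    "\<And>Q. Q \<in> cubes \<Longrightarrow> \<exists>R\<in>\<C>. Q \<subseteq> R \<and> vol R \<le> 2 ^ CARD('n) * vol Q"
proof -
  obtain D :: "(real ^ 'n) set" where D: "countable D" "\<And>X. open X \<Longrightarrow> X \<noteq> {} \<Longrightarrow> \<exists>d\<in>D. d \<in> X"
    by (rule countable_dense_setE) auto
  define \<C> where "\<C> = (\<lambda>(c, t). cb c t) ` (D \<times> {t\<in>\<rat>. 0 < t})"
  have "countable \<C>" unfolding \<C>_def using D(1) countable_rat
    by (intro countable_image countable_SIGMA) (auto intro: countable_subset[of _ "\<rat>"])
  moreover have "\<C> \<subseteq> cubes" unfolding \<C>_def by auto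
  moreover have "\<exists>R\<in>\<C>. Q \<subseteq> R \<and> vol R \<le> 2 ^ CARD('n) * vol Q"
    if Q: "Q \<in> cubes" for Q :: "(real ^ 'n) set"
  proof -
    obtain c t where t: "0 < t" and Qc: "Q = cb c t" using Q by (rule cube_cases)
    obtain d where d: "d \<in> D" "d \<in> ball c (t / 2)"
      using D(2)[of "ball c (t / 2)"] t by auto
    obtain q where q: "q \<in> \<rat>" "3 * t / 2 < q" "q < 2 * t"
      using Rats_dense_in_real[of "3 * t / 2" "2 * t"] t by auto
    have "\<bar>c $ i - d $ i\<bar> \<le> t / 2" for i
      using d(2) component_le_norm_cart[of "c - d" i] by (simp add: dist_norm)
    then have "Q \<subseteq> cb d q" unfolding Qc using q by (intro cb_subset_cb[where r = "t / 2"]) auto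
    moreover have "vol (cb d q) \<le> 2 ^ CARD('n) * vol Q"
    proof -
      have "(2 * q) ^ CARD('n) \<le> (2 * (2 * t)) ^ CARD('n)"
        using q t by (intro power_mono) auto
      also have "\<dots> = 2 ^ CARD('n) * (2 * t) ^ CARD('n)" by (rule power_mult_distrib)
      finally show ?thesis using q t by (simp add: Qc measure_cb)
    qed
    moreover have "cb d q \<in> \<C>" unfolding \<C>_def using d q t by force
    ultimately show ?thesis by blast
  qed
  ultimately show thesis by (rule that)
qed

text \<open>Suprema over this countable family are measurable and comparable to those over all cubes.\<close>

definition bcubes :: "(real ^ 'n) set set" where
  "bcubes = (SOME \<C>. countable \<C> \<and> \<C> \<subseteq> cubes \<and> (\<forall>Q\<in>cubes. \<exists>R\<in>\<C>. Q \<subseteq> R \<and>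
     vol R \<le> 2 ^ CARD('n) * vol Q))"

lemma bcubes:
  shows countable_bcubes: "countable (bcubes :: (real ^ 'n) set set)"
    and bcubes_cubes: "(bcubes :: (real ^ 'n) set set) \<subseteq> cubes"
    and bcubes_cover: "\<And>Q :: (real ^ 'n) set. Q \<in> cubes \<Longrightarrow>
      \<exists>R\<in>bcubes. Q \<subseteq> R \<and> vol R \<le> 2 ^ CARD('n) * vol Q"
proof -
  have "\<exists>\<C> :: (real ^ 'n) set set. countable \<C> \<and> \<C> \<subseteq> cubes \<and> (\<forall>Q\<in>cubes. \<exists>R\<in>\<C>. Q \<subseteq> R \<and>
     vol R \<le> 2 ^ CARD('n) * vol Q)"
    by (rule countable_cube_family) blast
  from someI_ex[OF this] show "countable (bcubes :: (real ^ 'n) set set)"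
    "(bcubes :: (real ^ 'n) set set) \<subseteq> cubes" "\<And>Q :: (real ^ 'n) set. Q \<in> cubes \<Longrightarrow>
      \<exists>R\<in>bcubes. Q \<subseteq> R \<and> vol R \<le> 2 ^ CARD('n) * vol Q"
    unfolding bcubes_def[symmetric] by auto
qed

text \<open>Greedy selection: a cube of maximal size is kept, and every cube meeting it lies in its
  threefold dilate because its half side is no larger. The induction continues with the cubes
  disjoint from it.\<close>

lemma Vitali_finite_cubes:
  fixes I :: "((real ^ 'n) \<times> real) set"
  assumes "finite I" "\<And>c t. (c, t) \<in> I \<Longrightarrow> 0 < t"
  obtains J where "J \<subseteq> I" "disjoint_family_on (\<lambda>(c, t). cb c t) J"
    "(\<Union>(c, t)\<in>I. cb c t) \<subseteq> (\<Union>(c, t)\<in>J. cb c (3 * t))"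
proof -
  have "\<exists>J\<subseteq>I. disjoint_family_on (\<lambda>(c, t). cb c t) J \<and>
    (\<Union>(c, t)\<in>I. cb c t) \<subseteq> (\<Union>(c, t)\<in>J. cb c (3 * t))"
    using assms
  proof (induction "card I" arbitrary: I rule: less_induct)
    case less
    show ?case
    proof (cases "I = {}")
      case True then show ?thesis by (auto simp: disjoint_family_on_def)
    next
      case False
      obtain m where m: "m \<in> I" "\<And>x. x \<in> I \<Longrightarrow> snd x \<le> snd m"
      proof -
        have "Max (snd ` I) \<in> snd ` I" using less.prems False by (intro Max_in) auto
        then obtain m where "m \<in> I" "snd m = Max (snd ` I)" by auto
        then show thesis using less.prems by (intro that[of m]) auto
      qed
      obtain c t where ct: "m = (c, t)" by (cases m)
      define I' where "I' = {(d, s)\<in>I. cb d s \<inter> cb c t = {}}"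
      have "0 < t" using less.prems(2) m ct by auto
      then have "c \<in> cb c t" by (auto simp: cb_def)
      then have "m \<notin> I'" unfolding I'_def ct by auto
      have "I' \<subseteq> I" by (auto simp: I'_def)
      then have "I' \<subset> I" using m \<open>m \<notin> I'\<close> by blast
      then have "card I' < card I" using less.prems(1) by (intro psubset_card_mono)
      then obtain J where J: "J \<subseteq> I'" "disjoint_family_on (\<lambda>(c, t). cb c t) J"
        "(\<Union>(c, t)\<in>I'. cb c t) \<subseteq> (\<Union>(c, t)\<in>J. cb c (3 * t))"
        using less.hyps[OF \<open>card I' < card I\<close> finite_subset[OF \<open>I' \<subseteq> I\<close> less.prems(1)]] less.prems(2) \<open>I' \<subseteq> I\<close>
        by blast
      have "m \<notin> J" using J(1) \<open>m \<notin> I'\<close> by blast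
      have "disjoint_family_on (\<lambda>(c, t). cb c t) (insert m J)"
        unfolding disjoint_family_on_insert[OF \<open>m \<notin> J\<close>]
        using J(1,2) by (auto simp: I'_def ct)
      moreover have "cb d s \<subseteq> cb c (3 * t)" if ds: "(d, s) \<in> I - I'" for d s
      proof -
        obtain x where "x \<in> cb d s" "x \<in> cb c t" using ds by (auto simp: I'_def)
        then have "cb d s \<subseteq> cb c (t + 2 * s)" by (rule cb_meet_subset)
        also have "\<dots> \<subseteq> cb c (3 * t)" using m(2)[of "(d, s)"] ds ct by (intro cb_mono) auto
        finally show ?thesis .
      qed
      then have *: "cb d s \<subseteq> (\<Union>(c, t)\<in>insert m J. cb c (3 * t))" if "(d, s) \<in> I" for d s
        using J(3) that unfolding ct by (cases "(d, s) \<in> I'") auto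
      have "(\<Union>(c, t)\<in>I. cb c t) \<subseteq> (\<Union>(c, t)\<in>insert m J. cb c (3 * t))"
        by (rule UN_least) (use * in auto)
      moreover have "insert m J \<subseteq> I" using J(1) m by (auto simp: I'_def)
      ultimately show ?thesis by blast
    qed
  qed
  then show thesis using that by blast
qed

section \<open>The layer-cake formula and an interpolation inequality\<close>

text \<open>A power is the integral of its derivative. For \<open>y = top\<close> the truncations at
  \<open>real n powr (1 / s)\<close> have integral \<open>n\<close>, so the integral
  diverges.\<close>

lemma nn_integral_powr_layer:
  assumes "0 < s"
  shows "(\<integral>\<^sup>+l. ennreal (s * l powr (s - 1)) * indicator {l. 0 < l \<and> ennreal l < y} l \<partial>lborel) = enn_powr y s"
proof -
  have fin: "(\<integral>\<^sup>+l. ennreal (s * l powr (s - 1)) * indicator {0<..<a} l \<partial>lborel) = ennreal (a powr s)"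
    if "0 \<le> a" for a
  proof -
    have "((\<lambda>x. s * x powr (s - 1)) has_integral s * (a powr (s - 1 + 1) / (s - 1 + 1))) {0..a}"
      using assms that by (intro has_integral_mult_right has_integral_powr_from_0) auto
    then have "(\<integral>\<^sup>+l. ennreal (s * l powr (s - 1)) * indicator {0..a} l \<partial>lborel) = ennreal (a powr s)"
      using assms by (intro nn_integral_has_integral_lebesgue') auto
    moreover have "AE l in lborel. indicator {0..a} l = (indicator {0<..<a} l :: ennreal)"
      using AE_lborel_singleton[of 0] AE_lborel_singleton[of a]
      by eventually_elim (auto simp: indicator_def)
    ultimately show ?thesis
      by (subst nn_integral_cong_AE[where v = "\<lambda>l. ennreal (s * l powr (s - 1)) * indicator {0..a} l"]) auto
  qed
  show ?thesis
  proof (cases y)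
    case (real a)
    then have "{l. 0 < l \<and> ennreal l < y} = {0<..<a}"
      by (auto simp: ennreal_less_iff)
    with fin[of a] real show ?thesis by simp
  next
    case top
    have "ennreal (real n) \<le> (\<integral>\<^sup>+l. ennreal (s * l powr (s - 1)) * indicator {l. 0 < l \<and> ennreal l < y} l \<partial>lborel)" for n
    proof -
      have "ennreal (real n) = ennreal ((real n powr (1 / s)) powr s)"
        using assms by (simp add: powr_powr)
      also have "\<dots> = (\<integral>\<^sup>+l. ennreal (s * l powr (s - 1)) * indicator {0<..<real n powr (1 / s)} l \<partial>lborel)"
        by (rule fin[symmetric]) simp
      also have "\<dots> \<le> (\<integral>\<^sup>+l. ennreal (s * l powr (s - 1)) * indicator {l. 0 < l \<and> ennreal l < y} l \<partial>lborel)"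
        by (intro nn_integral_mono) (auto simp: indicator_def top)
      finally show ?thesis .
    qed
    then have "top \<le> (\<integral>\<^sup>+l. ennreal (s * l powr (s - 1)) * indicator {l. 0 < l \<and> ennreal l < y} l \<partial>lborel)"
      unfolding ennreal_SUP_of_nat_eq_top[symmetric]
      by (intro SUP_least) (metis ennreal_of_nat_eq_real_of_nat)
    then show ?thesis by (simp add: top top_unique)
  qed
qed

text \<open>Marcinkiewicz interpolation between weak type (1,1) and the trivial bound at infinity,
  with the truncation at height \<open>l / 2\<close> built into \<open>weak\<close>. Inserting
  \<open>weak\<close> into the layer-cake formula for \<open>F\<close> and exchanging the integrals
  leaves a layer-cake formula for \<open>2 * f\<close> with exponent \<open>t - 1\<close>.\<close>

lemma nn_integral_powr_le_of_weak_type: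
  assumes "sigma_finite_measure M"
    and F[measurable]: "F \<in> borel_measurable M" and f[measurable]: "f \<in> borel_measurable M"
    and t: "1 < t" and D: "0 \<le> D"
    and weak: "\<And>l::real. 0 < l \<Longrightarrow> emeasure M {x\<in>space M. ennreal l < F x}
       \<le> ennreal (D / l) * (\<integral>\<^sup>+x. f x * indicator {x. ennreal l < 2 * f x} x \<partial>M)"
  shows "(\<integral>\<^sup>+x. enn_powr (F x) t \<partial>M) \<le> ennreal (t * D / (t - 1) * 2 powr (t - 1)) * (\<integral>\<^sup>+x. enn_powr (f x) t \<partial>M)"
proof -
  interpret pair_sigma_finite M lborel
    using assms(1) sigma_finite_lborel by (rule pair_sigma_finite.intro)
  let ?h = "\<lambda>l::real. ennreal (t * l powr (t - 1))"
  have "(\<integral>\<^sup>+x. enn_powr (F x) t \<partial>M)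
      = (\<integral>\<^sup>+x. \<integral>\<^sup>+l. ?h l * indicator {l. 0 < l \<and> ennreal l < F x} l \<partial>lborel \<partial>M)"
    using t by (intro nn_integral_cong nn_integral_powr_layer[symmetric]) auto
  also have "\<dots> = (\<integral>\<^sup>+l. \<integral>\<^sup>+x. ?h l * indicator {l. 0 < l \<and> ennreal l < F x} l \<partial>M \<partial>lborel)"
    by (rule Fubini'[symmetric]) (simp add: indicator_def[abs_def], measurable)
  also have "\<dots> \<le> (\<integral>\<^sup>+l. \<integral>\<^sup>+x. ennreal (t * D / (t - 1)) * (f x * (ennreal ((t - 1) * l powr (t - 1 - 1)) * indicator {l. 0 < l \<and> ennreal l < 2 * f x} l)) \<partial>M \<partial>lborel)"
  proof (rule nn_integral_mono)
    fix l :: real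
    show "(\<integral>\<^sup>+x. ?h l * indicator {l. 0 < l \<and> ennreal l < F x} l \<partial>M) \<le>
       (\<integral>\<^sup>+x. ennreal (t * D / (t - 1)) * (f x * (ennreal ((t - 1) * l powr (t - 1 - 1)) * indicator {l. 0 < l \<and> ennreal l < 2 * f x} l)) \<partial>M)"
    proof (cases "0 < l")
      case False then show ?thesis by (simp add: indicator_def)
    next
      case True
      have "(\<integral>\<^sup>+x. ?h l * indicator {l. 0 < l \<and> ennreal l < F x} l \<partial>M) =
         (\<integral>\<^sup>+x. ?h l * indicator {x\<in>space M. ennreal l < F x} x \<partial>M)"
        using True by (intro nn_integral_cong) (auto simp: indicator_def)
      also have "\<dots> = ?h l * emeasure M {x\<in>space M. ennreal l < F x}"
        by (rule nn_integral_cmult_indicator) measurable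
      also have "\<dots> \<le> ?h l * (ennreal (D / l) * (\<integral>\<^sup>+x. f x * indicator {x. ennreal l < 2 * f x} x \<partial>M))"
        by (intro mult_left_mono weak True) auto
      \<comment> \<open>The factor \<open>D / l\<close> lowers the power of \<open>l\<close> by one;
        \<open>(t - 1) * l powr (t - 1 - 1)\<close> is the density in the layer-cake formula with
        exponent \<open>t - 1 > 0\<close>.\<close>
      also have "\<dots> = ennreal (t * D / (t - 1)) * ennreal ((t - 1) * l powr (t - 1 - 1)) * (\<integral>\<^sup>+x. f x * indicator {x. ennreal l < 2 * f x} x \<partial>M)"
      proof -
        have "?h l * ennreal (D / l) = ennreal (t * l powr (t - 1) * (D / l))"
          using t D True by (intro ennreal_mult[symmetric]) auto
        also have "t * l powr (t - 1) * (D / l) = t * D / (t - 1) * ((t - 1) * l powr (t - 1 - 1))"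
        proof -
          have "l powr (t - 1) = l powr (t - 1 - 1) * l"
            using True by (simp add: powr_diff power2_eq_square)
          then show ?thesis using t True by simp
        qed
        also have "ennreal \<dots> = ennreal (t * D / (t - 1)) * ennreal ((t - 1) * l powr (t - 1 - 1))"
          using t D True by (intro ennreal_mult) auto
        finally show ?thesis by (simp add: mult.assoc[symmetric])
      qed
      also have "\<dots> = (\<integral>\<^sup>+x. ennreal (t * D / (t - 1)) * ennreal ((t - 1) * l powr (t - 1 - 1)) * (f x * indicator {x. ennreal l < 2 * f x} x) \<partial>M)"
        by (rule nn_integral_cmult[symmetric]) (simp add: indicator_def[abs_def])
      also have "\<dots> = (\<integral>\<^sup>+x. ennreal (t * D / (t - 1)) * (f x * (ennreal ((t - 1) * l powr (t - 1 - 1)) * indicator {l. 0 < l \<and> ennreal l < 2 * f x} l)) \<partial>M)"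
        using True by (intro nn_integral_cong) (auto simp: indicator_def mult_ac)
      finally show ?thesis .
    qed
  qed
  also have "\<dots> = (\<integral>\<^sup>+x. \<integral>\<^sup>+l. ennreal (t * D / (t - 1)) * (f x * (ennreal ((t - 1) * l powr (t - 1 - 1)) * indicator {l. 0 < l \<and> ennreal l < 2 * f x} l)) \<partial>lborel \<partial>M)"
    by (rule Fubini') (simp add: indicator_def[abs_def], measurable)
  also have "\<dots> = (\<integral>\<^sup>+x. ennreal (t * D / (t - 1) * 2 powr (t - 1)) * enn_powr (f x) t \<partial>M)"
  proof (intro nn_integral_cong)
    fix x
    have "(\<integral>\<^sup>+l. ennreal (t * D / (t - 1)) * (f x * (ennreal ((t - 1) * l powr (t - 1 - 1)) * indicator {l. 0 < l \<and> ennreal l < 2 * f x} l)) \<partial>lborel)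
       = ennreal (t * D / (t - 1)) * (f x * enn_powr (2 * f x) (t - 1))"
      using t by (subst nn_integral_cmult, measurable, subst nn_integral_cmult, measurable, subst nn_integral_powr_layer) auto
    also have "enn_powr (2 * f x) (t - 1) = ennreal (2 powr (t - 1)) * enn_powr (f x) (t - 1)"
      using enn_powr_ennreal[of 2 "t - 1"] by (simp add: enn_powr_mult)
    also have "ennreal (t * D / (t - 1)) * (f x * (ennreal (2 powr (t - 1)) * enn_powr (f x) (t - 1)))
       = ennreal (t * D / (t - 1)) * ennreal (2 powr (t - 1)) * (enn_powr (f x) 1 * enn_powr (f x) (t - 1))"
      by (simp add: mult_ac)
    also have "enn_powr (f x) 1 * enn_powr (f x) (t - 1) = enn_powr (f x) t"
      using enn_powr_add[of 1 "t - 1" "f x"] t by simp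
    also have "ennreal (t * D / (t - 1)) * ennreal (2 powr (t - 1)) = ennreal (t * D / (t - 1) * 2 powr (t - 1))"
      using t D by (intro ennreal_mult[symmetric]) auto
    finally show "(\<integral>\<^sup>+l. ennreal (t * D / (t - 1)) * (f x * (ennreal ((t - 1) * l powr (t - 1 - 1)) * indicator {l. 0 < l \<and> ennreal l < 2 * f x} l)) \<partial>lborel)
      = ennreal (t * D / (t - 1) * 2 powr (t - 1)) * enn_powr (f x) t" .
  qed
  also have "\<dots> = ennreal (t * D / (t - 1) * 2 powr (t - 1)) * (\<integral>\<^sup>+x. enn_powr (f x) t \<partial>M)"
    by (rule nn_integral_cmult) measurable
  finally show ?thesis .
qed

section \<open>The maximal operator of a doubling weight\<close>

definition wint :: "(real ^ 'n \<Rightarrow> real) \<Rightarrow> (real ^ 'n) set \<Rightarrow> ennreal" where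
  "wint u Q = (\<integral>\<^sup>+x\<in>Q. ennreal (u x) \<partial>lebesgue)"

text \<open>Tripling matches the dilates in the covering lemma. Positivity is asked at every point,
  so that quotients by the weight cancel pointwise.\<close>

definition doubling :: "real \<Rightarrow> (real ^ 'n \<Rightarrow> real) \<Rightarrow> bool" where
  "doubling D u \<longleftrightarrow> u \<in> lmeas \<and> (\<forall>x. 0 < u x) \<and>
     (\<forall>c t. 0 < t \<longrightarrow> wint u (cb c t) < top \<and> wint u (cb c (3 * t)) \<le> ennreal D * wint u (cb c t))"

text \<open>The uncentred maximal operator for the measure with density \<open>u\<close>. The
  countable family makes it measurable at once, and values in \<open>ennreal\<close> allow iteration
  without finiteness checks.\<close>

definition maxop :: "(real ^ 'n \<Rightarrow> real) \<Rightarrow> (real ^ 'n \<Rightarrow> ennreal) \<Rightarrow> real ^ 'n \<Rightarrow> ennreal" where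
  "maxop u g x = (SUP Q\<in>bcubes. (\<integral>\<^sup>+y\<in>Q. g y * ennreal (u y) \<partial>lebesgue) / wint u Q * indicator Q x)"

lemma wint_pos:
  assumes u[measurable]: "u \<in> lmeas" and pos: "\<And>x. 0 < u x" and Q: "Q \<in> cubes"
  shows "0 < wint u Q"
proof (rule ccontr)
  have [measurable]: "Q \<in> sets lebesgue" using Q by simp
  assume "\<not> 0 < wint u Q"
  then have "wint u Q = 0" by (simp add: zero_less_iff_neq_zero)
  then have "AE x in lebesgue. ennreal (u x) * indicator Q x = 0"
    unfolding wint_def by (subst (asm) nn_integral_0_iff_AE) auto
  then have "AE x in lebesgue. x \<notin> Q"
    by eventually_elim (use pos in \<open>auto simp: indicator_def split: if_splits simp: ennreal_eq_0_iff not_le[symmetric]\<close>)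
  then have "emeasure lebesgue Q = 0"
    by (subst (asm) AE_iff_measurable[where N = Q]) auto
  then show False using cubes_measure_pos[OF Q] by (simp add: measure_def)
qed

lemma sigma_finite_lebesgue: "sigma_finite_measure (lebesgue :: (real ^ 'n) measure)"
proof
  have "emeasure lebesgue (cb (0 :: real ^ 'n) (real k)) \<noteq> \<infinity>" for k
    by (simp add: emeasure_cb)
  moreover have "x \<in> (\<Union>k. cb (0 :: real ^ 'n) (real k))" for x
  proof -
    obtain t where "x \<in> cb 0 t" using subset_cb[of "{x}" 0] by auto
    moreover obtain k where "t \<le> real k" using real_arch_simple by blast
    ultimately show ?thesis using cb_mono[of t "real k" 0] by auto
  qed
  ultimately show "\<exists>A :: (real ^ 'n) set set. countable A \<and> A \<subseteq> sets lebesgue \<and> \<Union> A = space lebesgue \<and> (\<forall>a\<in>A. emeasure lebesgue a \<noteq> \<infinity>)"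
    by (intro exI[where x = "range (\<lambda>k. cb (0 :: real ^ 'n) (real k))"]) auto
qed

lemma borel_measurable_maxop [measurable (raw)]:
  assumes [measurable]: "u \<in> lmeas" "g \<in> lmeas"
  shows "maxop u g \<in> lmeas"
  unfolding maxop_def[abs_def]
proof (rule borel_measurable_SUP[OF countable_bcubes])
  fix Q :: "(real ^ 'a) set" assume "Q \<in> bcubes"
  then have [measurable]: "Q \<in> sets lebesgue" using bcubes_cubes by auto
  show "(\<lambda>x. (\<integral>\<^sup>+ y\<in>Q. g y * ennreal (u y)\<partial>lebesgue) / wint u Q * indicator Q x) \<in> lmeas"
    by measurable
qed

lemma maxop_upper:
  assumes "Q \<in> bcubes" "x \<in> Q"
  shows "(\<integral>\<^sup>+y\<in>Q. g y * ennreal (u y) \<partial>lebesgue) / wint u Q \<le> maxop u g x"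
  unfolding maxop_def by (rule SUP_upper2[OF assms(1)]) (use assms in auto)

text \<open>The level set is the union of the countable family \<open>\<S>\<close> of cubes with
  average above \<open>l\<close>. For a finite subfamily the covering lemma selects disjoint cubes;
  tripling costs \<open>D\<close>, and their \<open>\<nu>\<close>-masses add up. Continuity of the
  measure along an exhaustion gives the whole union.\<close>

lemma maxop_weak_type:
  fixes u :: "real ^ 'n \<Rightarrow> real"
  assumes dbl: "doubling D u" and g[measurable]: "g \<in> lmeas"
    and lam: "0 < l" and D: "0 \<le> D"
  shows "emeasure (density lebesgue u) {x. ennreal l < maxop u g x} \<le> ennreal (D / l) * (\<integral>\<^sup>+x. g x * ennreal (u x) \<partial>lebesgue)"
    (is "?L \<le> ?R")
proof -
  have u[measurable]: "u \<in> lmeas" and pos: "\<And>x. 0 < u x"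
    and fin: "\<And>c t. 0 < t \<Longrightarrow> wint u (cb c t) < top"
    and dbl3: "\<And>c t. 0 < t \<Longrightarrow> wint u (cb c (3 * t)) \<le> ennreal D * wint u (cb c t)"
    using dbl by (auto simp: doubling_def)
  define \<mu> where "\<mu> = density lebesgue (\<lambda>x. ennreal (u x))"
  define \<nu> where "\<nu> = density lebesgue (\<lambda>x. g x * ennreal (u x))"
  have \<mu>: "emeasure \<mu> A = wint u A" if "A \<in> sets lebesgue" for A
    unfolding \<mu>_def wint_def using that by (intro emeasure_density) auto
  have \<nu>: "emeasure \<nu> A = (\<integral>\<^sup>+x\<in>A. g x * ennreal (u x) \<partial>lebesgue)" if "A \<in> sets lebesgue" for A
    unfolding \<nu>_def using that by (intro emeasure_density) auto
  have [simp]: "sets \<mu> = sets lebesgue" "sets \<nu> = sets lebesgue" "space \<nu> = UNIV"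
    by (simp_all add: \<mu>_def \<nu>_def)
  have \<nu>_UNIV: "emeasure \<nu> A \<le> (\<integral>\<^sup>+x. g x * ennreal (u x) \<partial>lebesgue)" if "A \<in> sets lebesgue" for A
    unfolding \<nu>[OF that] by (intro nn_integral_mono) (auto simp: indicator_def)
  define \<S> where "\<S> = {Q\<in>bcubes. ennreal l < (\<integral>\<^sup>+y\<in>Q. g y * ennreal (u y) \<partial>lebesgue) / wint u Q}"
  have \<S>_bound: "wint u Q \<le> ennreal (1 / l) * emeasure \<nu> Q" if "Q \<in> \<S>" for Q
  proof -
    have Q: "Q \<in> cubes" using that bcubes_cubes by (auto simp: \<S>_def)
    then obtain c t where ct: "0 < t" "Q = cb c t" by (rule cube_cases)
    obtain m where m: "wint u Q = ennreal m" "0 < m"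
      using fin[of t c] ct wint_pos[OF u pos Q] by (cases "wint u Q") auto
    have "ennreal l * ennreal m \<le> emeasure \<nu> Q / ennreal m * ennreal m"
      using that Q by (intro mult_right_mono) (auto simp: \<S>_def m \<nu> less_imp_le)
    also have "\<dots> = emeasure \<nu> Q" using m by (simp add: ennreal_divide_times ennreal_times_divide[symmetric] divide_ennreal)
    finally have "ennreal (1 / l) * (ennreal l * ennreal m) \<le> ennreal (1 / l) * emeasure \<nu> Q"
      by (rule mult_left_mono) simp
    also have "ennreal (1 / l) * (ennreal l * ennreal m) = ennreal m"
      using lam m by (simp add: ennreal_mult[symmetric] mult.assoc[symmetric])
    finally show ?thesis using m by simp
  qed
  have finite_bound: "emeasure \<mu> (\<Union>\<F>) \<le> ?R" if \<F>: "finite \<F>" "\<F> \<subseteq> \<S>" for \<F>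
  proof -
    have "\<exists>c t. 0 < t \<and> Q = cb c t" if "Q \<in> \<F>" for Q
    proof -
      have "Q \<in> cubes" using that \<F> bcubes_cubes by (auto simp: \<S>_def)
      then show ?thesis by (auto simp: cubes_eq)
    qed
    then obtain c t where ct: "\<And>Q. Q \<in> \<F> \<Longrightarrow> 0 < t Q \<and> Q = cb (c Q) (t Q)" by metis
    define I where "I = (\<lambda>Q. (c Q, t Q)) ` \<F>"
    obtain J where J: "J \<subseteq> I" "disjoint_family_on (\<lambda>(c, t). cb c t) J"
        "(\<Union>(c, t)\<in>I. cb c t) \<subseteq> (\<Union>(c, t)\<in>J. cb c (3 * t))"
      by (rule Vitali_finite_cubes[of I]) (use ct \<F> in \<open>auto simp: I_def\<close>)
    have "finite J" using J(1) \<F>(1) by (auto simp: I_def intro: finite_subset)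
    have JS: "0 < s \<and> cb d s \<in> \<S>" if ds: "(d, s) \<in> J" for d s
    proof -
      obtain Q where "Q \<in> \<F>" "d = c Q" "s = t Q" using subsetD[OF J(1) ds] by (auto simp: I_def)
      then show ?thesis using ct[of Q] \<F>(2) by auto
    qed
    have "\<Union>\<F> \<subseteq> (\<Union>(c, t)\<in>I. cb c t)" using ct by (force simp: I_def)
    then have "emeasure \<mu> (\<Union>\<F>) \<le> emeasure \<mu> (\<Union>x\<in>J. cb (fst x) (3 * snd x))"
      using J(3) \<open>finite J\<close> by (intro emeasure_mono) (auto simp: split_beta)
    also have "\<dots> \<le> (\<Sum>x\<in>J. emeasure \<mu> (cb (fst x) (3 * snd x)))"
      using \<open>finite J\<close> by (intro emeasure_subadditive_finite) auto
    also have "\<dots> \<le> (\<Sum>x\<in>J. ennreal (D / l) * emeasure \<nu> (cb (fst x) (snd x)))"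
    proof (rule sum_mono)
      fix x assume "x \<in> J"
      then have x: "0 < snd x" "cb (fst x) (snd x) \<in> \<S>" using JS[of "fst x" "snd x"] by auto
      have "emeasure \<mu> (cb (fst x) (3 * snd x)) \<le> ennreal D * wint u (cb (fst x) (snd x))"
        using dbl3 x by (simp add: \<mu>)
      also have "\<dots> \<le> ennreal D * (ennreal (1 / l) * emeasure \<nu> (cb (fst x) (snd x)))"
        by (intro mult_left_mono \<S>_bound x) simp
      also have "\<dots> = ennreal (D / l) * emeasure \<nu> (cb (fst x) (snd x))"
        using lam D by (simp add: mult.assoc[symmetric] ennreal_mult[symmetric])
      finally show "emeasure \<mu> (cb (fst x) (3 * snd x)) \<le> ennreal (D / l) * emeasure \<nu> (cb (fst x) (snd x))" .
    qed
    also have "\<dots> = ennreal (D / l) * (\<Sum>x\<in>J. emeasure \<nu> (cb (fst x) (snd x)))"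
      by (rule sum_distrib_left[symmetric])
    also have "(\<Sum>x\<in>J. emeasure \<nu> (cb (fst x) (snd x))) = emeasure \<nu> (\<Union>x\<in>J. cb (fst x) (snd x))"
      using J(2) \<open>finite J\<close> by (intro sum_emeasure) (auto simp: case_prod_unfold)
    also have "ennreal (D / l) * emeasure \<nu> (\<Union>x\<in>J. cb (fst x) (snd x)) \<le> ?R"
      using \<open>finite J\<close> by (intro mult_left_mono \<nu>_UNIV sets.finite_UN) auto
    finally show ?thesis .
  qed
  have "countable \<S>" unfolding \<S>_def using countable_bcubes by (rule countable_subset[rotated]) auto
  have level: "{x. ennreal l < maxop u g x} = \<Union>\<S>"
    unfolding maxop_def less_SUP_iff \<S>_def using bcubes_cubes
    by (force simp: indicator_def split: if_splits)
  have "emeasure \<mu> (\<Union>\<S>) \<le> ?R"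
  proof (cases "\<S> = {}")
    case False
    let ?A = "\<lambda>k. \<Union>(from_nat_into \<S> ` {..<k})"
    have \<S>_sets: "Q \<in> sets lebesgue" if "Q \<in> \<S>" for Q
      using that bcubes_cubes by (auto simp: \<S>_def)
    have "\<Union>\<S> = (\<Union>k. ?A k)"
    proof (intro equalityI subsetI)
      fix x assume "x \<in> \<Union>\<S>"
      then obtain k where "x \<in> from_nat_into \<S> k"
        by (metis UnionE \<open>countable \<S>\<close> from_nat_into_surj)
      then have "x \<in> ?A (Suc k)" by auto
      then show "x \<in> (\<Union>k. ?A k)" by blast
    qed (use from_nat_into[OF False] in blast)
    also have "emeasure \<mu> (\<Union>k. ?A k) = (SUP k. emeasure \<mu> (?A k))"
      using False \<S>_sets from_nat_into[OF False]
      by (intro SUP_emeasure_incseq[symmetric]) (auto simp: incseq_def intro!: sets.finite_UN)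
    also have "\<dots> \<le> ?R"
      using from_nat_into[OF False] by (intro SUP_least finite_bound) auto
    finally show ?thesis .
  qed simp
  then show ?thesis unfolding level \<mu>_def .
qed

text \<open>The interpolation constant at \<open>2 * D\<close>; the extra 2 comes from using the
  weak-type bound at level \<open>l / 2\<close>.\<close>

definition maxop_const :: "real \<Rightarrow> real \<Rightarrow> real" where
  "maxop_const t D = t * (2 * D) / (t - 1) * 2 powr (t - 1)"

text \<open>The part of \<open>g\<close> not exceeding \<open>l / 2\<close> raises each average by
  at most \<open>l / 2\<close>. Hence the maximal function of \<open>g\<close> exceeds
  \<open>l\<close> only where that of the upper part \<open>h\<close> exceeds \<open>l / 2\<close>,
  and the weak-type bound for \<open>h\<close> is the hypothesis of the interpolation lemma.\<close>

theorem maxop_strong_type: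
  fixes u :: "real ^ 'n \<Rightarrow> real"
  assumes dbl: "doubling D u" and g[measurable]: "g \<in> lmeas"
    and t: "1 < t" and D: "0 \<le> D"
  shows "(\<integral>\<^sup>+x. enn_powr (maxop u g x) t * ennreal (u x) \<partial>lebesgue)
    \<le> ennreal (maxop_const t D) * (\<integral>\<^sup>+x. enn_powr (g x) t * ennreal (u x) \<partial>lebesgue)"
proof -
  have u[measurable]: "u \<in> lmeas" and pos: "\<And>x. 0 < u x"
    using dbl by (auto simp: doubling_def)
  let ?M = "density lebesgue (\<lambda>x. ennreal (u x))"
  interpret sigma_finite_measure "lebesgue :: (real ^ 'n) measure" by (rule sigma_finite_lebesgue)
  have "sigma_finite_measure ?M" by (subst sigma_finite_iff_density_finite) auto
  moreover have "emeasure ?M {x\<in>space ?M. ennreal l < maxop u g x}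
       \<le> ennreal (2 * D / l) * (\<integral>\<^sup>+x. g x * indicator {x. ennreal l < 2 * g x} x \<partial>?M)" if lam: "0 < l" for l
  proof -
    define h where "h = (\<lambda>x. g x * indicator {x. ennreal l < 2 * g x} x)"
    have h[measurable]: "h \<in> lmeas"
      unfolding h_def by (simp add: indicator_def[abs_def])
    have gh: "g x \<le> h x + ennreal (l / 2)" for x
    proof (cases "ennreal l < 2 * g x")
      case False
      then have "2 * g x \<le> ennreal l" by (simp add: not_less)
      then have "g x \<le> ennreal (l / 2)"
        using lam by (cases "g x") (auto simp: ennreal_mult[symmetric] ennreal_numeral[symmetric] ennreal_le_iff  simp del: ennreal_numeral simp: ennreal_mult_top top_unique)
      then show ?thesis by (simp add: add_increasing)
    qed (auto simp: h_def)
    have "maxop u g x \<le> maxop u h x + ennreal (l / 2)" for x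
      unfolding maxop_def[of u g]
    proof (rule SUP_least)
      fix Q :: "(real ^ 'n) set" assume Q: "Q \<in> bcubes"
      then have Qc: "Q \<in> cubes" using bcubes_cubes by auto
      then have [measurable]: "Q \<in> sets lebesgue" by simp
      show "(\<integral>\<^sup>+y\<in>Q. g y * ennreal (u y) \<partial>lebesgue) / wint u Q * indicator Q x \<le> maxop u h x + ennreal (l / 2)"
      proof (cases "x \<in> Q")
        case True
        from Qc obtain c s where "0 < s" "Q = cb c s" by (rule cube_cases)
        then have "wint u Q < top" using dbl by (simp add: doubling_def)
        then obtain m where m: "wint u Q = ennreal m" "0 < m"
          using wint_pos[OF u pos Qc] by (cases "wint u Q") auto
        have "(\<integral>\<^sup>+y\<in>Q. g y * ennreal (u y) \<partial>lebesgue) \<le> (\<integral>\<^sup>+y. h y * ennreal (u y) * indicator Q y + ennreal (l / 2) * (ennreal (u y) * indicator Q y) \<partial>lebesgue)"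
          by (intro nn_integral_mono) (use gh in \<open>auto simp: indicator_def distrib_right[symmetric] intro!: mult_right_mono\<close>)
        also have "\<dots> = (\<integral>\<^sup>+y\<in>Q. h y * ennreal (u y) \<partial>lebesgue) + ennreal (l / 2) * wint u Q"
          unfolding wint_def by (subst nn_integral_add) (auto simp: nn_integral_cmult)
        finally have "(\<integral>\<^sup>+y\<in>Q. g y * ennreal (u y) \<partial>lebesgue) / wint u Q \<le> ((\<integral>\<^sup>+y\<in>Q. h y * ennreal (u y) \<partial>lebesgue) + ennreal (l / 2) * wint u Q) / wint u Q"
          by (rule divide_right_mono_ennreal)
        also have "\<dots> = (\<integral>\<^sup>+y\<in>Q. h y * ennreal (u y) \<partial>lebesgue) / wint u Q + ennreal (l / 2)"
          using m lam by (simp add: add_divide_distrib_ennreal ennreal_mult[symmetric] divide_ennreal)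
        also have "\<dots> \<le> maxop u h x + ennreal (l / 2)"
          by (intro add_right_mono maxop_upper Q True)
        finally show ?thesis using True by simp
      qed simp
    qed
    note * = this
    have "{x\<in>space ?M. ennreal l < maxop u g x} \<subseteq> {x. ennreal (l / 2) < maxop u h x}"
    proof (safe, rule ccontr)
      fix x assume a: "ennreal l < maxop u g x" "\<not> ennreal (l / 2) < maxop u h x"
      have "maxop u g x \<le> ennreal (l / 2) + ennreal (l / 2)"
        using a(2) *[of x] by (metis add_right_mono leI order_trans)
      also have "\<dots> = ennreal l" using lam by (simp add: ennreal_plus[symmetric] del: ennreal_plus)
      finally show False using a(1) by simp
    qed
    then have "emeasure ?M {x\<in>space ?M. ennreal l < maxop u g x} \<le> emeasure ?M {x. ennreal (l / 2) < maxop u h x}"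
      by (rule emeasure_mono) (use measurable_sets[OF borel_measurable_maxop[OF u h], of "{ennreal (l / 2)<..}"] in \<open>auto simp: vimage_def\<close>)
    also have "\<dots> \<le> ennreal (D / (l / 2)) * (\<integral>\<^sup>+x. h x * ennreal (u x) \<partial>lebesgue)"
      using lam D by (intro maxop_weak_type dbl) auto
    also have "(\<integral>\<^sup>+x. h x * ennreal (u x) \<partial>lebesgue) = (\<integral>\<^sup>+x. h x \<partial>?M)"
      by (subst nn_integral_density) (auto simp: mult.commute)
    finally show ?thesis by (simp add: h_def mult.commute)
  qed
  ultimately have "(\<integral>\<^sup>+x. enn_powr (maxop u g x) t \<partial>?M) \<le> ennreal (t * (2 * D) / (t - 1) * 2 powr (t - 1)) * (\<integral>\<^sup>+x. enn_powr (g x) t \<partial>?M)"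
    using t D by (intro nn_integral_powr_le_of_weak_type) auto
  then show ?thesis
    by (simp add: nn_integral_density maxop_const_def mult.commute)
qed

section \<open>Averages over cubes\<close>

lemma wint_mono_AE:
  assumes "AE x in lebesgue. x \<in> Q \<longrightarrow> u x \<le> v x"
  shows "wint u Q \<le> wint v Q"
  unfolding wint_def using assms
  by (intro nn_integral_mono_AE, eventually_elim) (auto simp: indicator_def intro: ennreal_leI)

lemma wint_mono: "(\<And>x. x \<in> Q \<Longrightarrow> u x \<le> v x) \<Longrightarrow> wint u Q \<le> wint v Q"
  by (rule wint_mono_AE) auto

lemma wint_mono_set: "Q \<subseteq> R \<Longrightarrow> wint u Q \<le> wint u R"
  unfolding wint_def by (intro nn_integral_mono) (auto simp: indicator_def)

lemma wint_cong_AE: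
  assumes "AE x in lebesgue. x \<in> Q \<longrightarrow> u x = v x"
  shows "wint u Q = wint v Q"
  using assms by (intro antisym wint_mono_AE) (auto elim: eventually_mono)

lemma wint_cmult:
  assumes [measurable]: "u \<in> lmeas" "Q \<in> sets lebesgue" and "0 \<le> c"
  shows "wint (\<lambda>x. c * u x) Q = ennreal c * wint u Q"
  unfolding wint_def using assms(3)
  by (subst nn_integral_cmult[symmetric]) (auto simp: ennreal_mult' mult.assoc)

lemma wint_add:
  assumes [measurable]: "u \<in> lmeas" "v \<in> lmeas" "Q \<in> sets lebesgue"
    and "\<And>x. 0 \<le> u x" "\<And>x. 0 \<le> v x"
  shows "wint (\<lambda>x. u x + v x) Q = wint u Q + wint v Q"
  unfolding wint_def using assms(4,5)
  by (subst nn_integral_add[symmetric]) (auto simp: distrib_right)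

lemma wint_const: "Q \<in> cubes \<Longrightarrow> 0 \<le> c \<Longrightarrow> wint (\<lambda>_. c) Q = ennreal (c * vol Q)"
  unfolding wint_def by (simp add: nn_integral_cmult_indicator emeasure_cubes ennreal_mult')

lemma cube_AE_witness:
  assumes "Q \<in> cubes" "AE x in lebesgue. x \<in> Q \<longrightarrow> P x"
  obtains x where "x \<in> Q" "P x"
proof (rule ccontr)
  assume "\<not> thesis"
  then have *: "\<And>x. x \<in> Q \<Longrightarrow> \<not> P x" using that by blast
  have [measurable]: "Q \<in> sets lebesgue" using assms(1) by simp
  from assms(2) have "AE x in lebesgue. x \<notin> Q"
    by eventually_elim (use * in auto)
  then have "emeasure lebesgue Q = 0"
    by (subst (asm) AE_iff_measurable[where N = Q]) auto
  then show False using cubes_measure_pos[OF assms(1)] by (simp add: measure_def)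
qed

lemma wint_ge_of_AE_le:
  assumes "Q \<in> cubes" "0 \<le> c" "AE x in lebesgue. x \<in> Q \<longrightarrow> c \<le> u x"
  shows "ennreal (c * vol Q) \<le> wint u Q"
  using wint_mono_AE[OF assms(3)] assms(1,2) by (simp add: wint_const)

text \<open>Jensen's inequality for a concave power, by integrating the tangent line at
  \<open>m\<close>, which is the weighted inequality of arithmetic and geometric means. An upper
  bound \<open>m\<close> of the average is enough because the tangent line increases.\<close>

lemma wint_powr_le:
  assumes u[measurable]: "u \<in> lmeas" and pos: "\<And>x. 0 < u x"
    and Q: "Q \<in> cubes" and m: "0 < m" "wint u Q \<le> ennreal (m * vol Q)"
    and a: "0 \<le> a" "a \<le> 1"
  shows "wint (\<lambda>x. u x powr a) Q \<le> ennreal (m powr a * vol Q)"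
proof -
  have [measurable]: "Q \<in> sets lebesgue" using Q by simp
  have "u x powr a \<le> (a * m powr (a - 1)) * u x + (1 - a) * m powr a" for x
  proof -
    have "(u x / m) powr a * 1 powr (1 - a) \<le> a * (u x / m) + (1 - a) * 1"
      using a m pos[of x] by (intro Youngs_inequality_0) auto
    then have "m powr a * (u x / m) powr a \<le> m powr a * (a * (u x / m) + (1 - a))"
      using m by (intro mult_left_mono) auto
    also have "m powr a * (u x / m) powr a = u x powr a"
      using m pos[of x] by (simp add: powr_divide)
    also have "m powr a * (a * (u x / m) + (1 - a)) = (a * m powr (a - 1)) * u x + (1 - a) * m powr a"
      using m by (simp add: powr_diff field_simps)
    finally show ?thesis .
  qed
  then have "wint (\<lambda>x. u x powr a) Q \<le> wint (\<lambda>x. (a * m powr (a - 1)) * u x + (1 - a) * m powr a) Q"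
    by (rule wint_mono)
  also have "\<dots> = ennreal (a * m powr (a - 1)) * wint u Q + ennreal ((1 - a) * m powr a * vol Q)"
  proof -
    have "wint (\<lambda>x. (a * m powr (a - 1)) * u x) Q = ennreal (a * m powr (a - 1)) * wint u Q"
      using a by (intro wint_cmult) auto
    moreover have "wint (\<lambda>x. (1 - a) * m powr a) Q = ennreal ((1 - a) * m powr a * vol Q)"
      using a Q by (intro wint_const) auto
    ultimately show ?thesis using a less_imp_le[OF pos] by (subst wint_add) auto
  qed
  also have "\<dots> \<le> ennreal (a * m powr (a - 1)) * ennreal (m * vol Q) + ennreal ((1 - a) * m powr a * vol Q)"
    using m by (intro add_mono mult_left_mono) auto
  also have "\<dots> = ennreal (m powr a * vol Q)"
  proof -
    define X where "X = m powr a * vol Q"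
    have X: "0 \<le> X" by (simp add: X_def)
    have "ennreal (a * m powr (a - 1)) * ennreal (m * vol Q) = ennreal (a * X)"
      using a m by (simp add: ennreal_mult[symmetric] powr_diff X_def)
    moreover have "ennreal (a * X) + ennreal ((1 - a) * X) = ennreal (a * X + (1 - a) * X)"
      using a X by (intro ennreal_plus[symmetric]) auto
    moreover have "a * X + (1 - a) * X = X" by (simp add: algebra_simps)
    ultimately show ?thesis by (simp add: X_def mult.assoc)
  qed
  finally show ?thesis .
qed

text \<open>Jensen's inequality for the convex power \<open>- b\<close>. The slope of the tangent
  line at \<open>m\<close> is negative, so its linear term is put on the other side, bounded by
  means of \<open>m\<close>, and cancelled as a finite quantity.\<close>

lemma wint_powr_ge:
  assumes u[measurable]: "u \<in> lmeas" and pos: "\<And>x. 0 < u x"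
    and Q: "Q \<in> cubes" and m: "0 < m" "wint u Q \<le> ennreal (m * vol Q)"
    and b: "0 \<le> b"
  shows "ennreal (m powr - b * vol Q) \<le> wint (\<lambda>x. u x powr - b) Q"
proof -
  have [measurable]: "Q \<in> sets lebesgue" using Q by simp
  have "(1 + b) * m powr - b \<le> u x powr - b + (b * m powr (- b - 1)) * u x" for x
  proof -
    define y where "y = u x / m"
    have y: "0 < y" using m pos[of x] by (simp add: y_def)
    have "(y powr - b) powr (1 / (1 + b)) * y powr (b / (1 + b)) \<le> 1 / (1 + b) * y powr - b + b / (1 + b) * y"
      using b y by (intro Youngs_inequality_0) (auto simp: field_simps)
    also have "(y powr - b) powr (1 / (1 + b)) * y powr (b / (1 + b)) = 1"
      using y b by (simp add: powr_powr powr_add[symmetric])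
    also have "1 / (1 + b) * y powr - b + b / (1 + b) * y = (y powr - b + b * y) / (1 + b)"
      by (simp add: add_divide_distrib)
    finally have "1 + b \<le> y powr - b + b * y"
      using b by (simp add: pos_le_divide_eq)
    then have "m powr - b * (1 + b) \<le> m powr - b * (y powr - b + b * y)"
      using m by (intro mult_left_mono) auto
    also have "\<dots> = u x powr - b + (b * m powr (- b - 1)) * u x"
      using m pos[of x] by (simp add: y_def powr_divide powr_diff field_simps)
    finally show ?thesis by (simp add: mult.commute)
  qed
  then have "wint (\<lambda>x. (1 + b) * m powr - b) Q \<le> wint (\<lambda>x. u x powr - b + (b * m powr (- b - 1)) * u x) Q"
    by (rule wint_mono)
  also have "\<dots> = wint (\<lambda>x. u x powr - b) Q + ennreal (b * m powr (- b - 1)) * wint u Q"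
    using b m pos Q less_imp_le[OF pos] by (subst wint_add) (auto simp: wint_cmult)
  also have "\<dots> \<le> wint (\<lambda>x. u x powr - b) Q + ennreal (b * m powr (- b - 1)) * ennreal (m * vol Q)"
    using m by (intro add_mono mult_left_mono) auto
  also have "ennreal (b * m powr (- b - 1)) * ennreal (m * vol Q) = ennreal (b * m powr - b * vol Q)"
    using b m by (simp add: ennreal_mult[symmetric] powr_diff)
  finally have "ennreal (m powr - b * vol Q) + ennreal (b * m powr - b * vol Q)
      \<le> wint (\<lambda>x. u x powr - b) Q + ennreal (b * m powr - b * vol Q)"
    using b m Q by (simp add: wint_const ennreal_plus[symmetric] algebra_simps del: ennreal_plus)
  then show ?thesis by (simp add: add.commute ennreal_add_left_cancel_le)
qed

section \<open>Quantitative Muckenhoupt conditions\<close>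

text \<open>The A_p condition with constant at most \<open>K\<close>. The averages \<open>a\<close>
  of \<open>w\<close> and \<open>b\<close> of the dual weight \<open>w powr (1 - p')\<close> are
  exposed as positive reals, so that the arithmetic with them takes place in the reals.\<close>

definition ap :: "real \<Rightarrow> real \<Rightarrow> (real ^ 'n \<Rightarrow> real) \<Rightarrow> bool" where
  "ap p K w \<longleftrightarrow> w \<in> lmeas \<and> (\<forall>x. 0 < w x) \<and>
     (\<forall>Q\<in>cubes. \<exists>a b. 0 < a \<and> 0 < b \<and> wint w Q = ennreal (a * vol Q) \<and>
        wint (\<lambda>x. w x powr (- 1 / (p - 1))) Q = ennreal (b * vol Q) \<and> a * b powr (p - 1) \<le> K)"

definition a1 :: "real \<Rightarrow> (real ^ 'n \<Rightarrow> real) \<Rightarrow> bool" where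
  "a1 C u \<longleftrightarrow> u \<in> lmeas \<and> (\<forall>x. 0 < u x) \<and>
     (\<forall>Q\<in>cubes. \<exists>m. 0 < m \<and> wint u Q = ennreal (m * vol Q) \<and>
        (AE x in lebesgue. x \<in> Q \<longrightarrow> m \<le> C * u x))"

text \<open>Jensen's inequality for the power \<open>- 1 / (p - 1)\<close>. This lower bound is what
  lets the A_p upper bound compare different cubes.\<close>

lemma ap_avg_ge_1:
  assumes w: "w \<in> lmeas" "\<And>x. 0 < w x" and p: "1 < p" and Q: "Q \<in> cubes"
    and a: "0 < a" "wint w Q = ennreal (a * vol Q)"
    and b: "0 < b" "wint (\<lambda>x. w x powr (- 1 / (p - 1))) Q = ennreal (b * vol Q)"
  shows "1 \<le> a * b powr (p - 1)"
proof -
  have "ennreal (a powr - (1 / (p - 1)) * vol Q) \<le> wint (\<lambda>x. w x powr - (1 / (p - 1))) Q"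
    using w Q a p by (intro wint_powr_ge) auto
  then have "a powr - (1 / (p - 1)) * vol Q \<le> b * vol Q"
    using b by (simp add: ennreal_le_iff)
  then have "a powr - (1 / (p - 1)) \<le> b"
    using Q by simp
  then have "(a powr - (1 / (p - 1))) powr (p - 1) \<le> b powr (p - 1)"
    using p by (intro powr_mono2) auto
  moreover have "- (1 / (p - 1)) * (p - 1) = - 1"
    using p by simp
  ultimately have "1 / a \<le> b powr (p - 1)"
    using a by (simp only: powr_powr) (simp add: powr_minus_divide)
  then show ?thesis using a by (simp add: field_simps)
qed

text \<open>The same two averages with exchanged roles, since
  \<open>p' - 1 = 1 / (p - 1)\<close>.\<close>

lemma ap_dual:
  assumes "ap p K w" "1 < p"
  shows "ap (p / (p - 1)) (K powr (1 / (p - 1))) (\<lambda>x. w x powr (- 1 / (p - 1)))"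
proof -
  have w[measurable]: "w \<in> lmeas" and pos: "\<And>x. 0 < w x"
    using assms(1) by (auto simp: ap_def)
  have e: "- 1 / (1 / (p - 1)) = - (p - 1)" "p / (p - 1) - 1 = 1 / (p - 1)"
    using assms(2) by (simp_all add: divide_eq_eq diff_divide_eq_iff divide_diff_eq_iff)
  show ?thesis
    unfolding ap_def e
  proof (intro conjI allI ballI)
    fix Q :: "(real ^ 'a) set" assume "Q \<in> cubes"
    then obtain a b where ab: "0 < a" "0 < b" "wint w Q = ennreal (a * vol Q)"
        "wint (\<lambda>x. w x powr (- 1 / (p - 1))) Q = ennreal (b * vol Q)" "a * b powr (p - 1) \<le> K"
      using assms(1) unfolding ap_def by blast
    have "b * a powr (1 / (p - 1)) = (a * b powr (p - 1)) powr (1 / (p - 1))"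
      using ab(1,2) assms(2) by (simp add: powr_mult powr_powr)
    also have "\<dots> \<le> K powr (1 / (p - 1))"
      using ab assms(2) by (intro powr_mono2) auto
    finally have "b * a powr (1 / (p - 1)) \<le> K powr (1 / (p - 1))" .
    moreover have "wint (\<lambda>x. (w x powr (- 1 / (p - 1))) powr - (p - 1)) Q = wint w Q"
    proof (intro wint_cong_AE AE_I2 impI)
      fix x
      have "- 1 / (p - 1) * - (p - 1) = 1" using assms(2) by (simp add: divide_eq_eq)
      then show "(w x powr (- 1 / (p - 1))) powr - (p - 1) = w x"
        using pos[of x] by (simp only: powr_powr) simp
    qed
    ultimately show "\<exists>a b. 0 < a \<and> 0 < b \<and> wint (\<lambda>x. w x powr (- 1 / (p - 1))) Q = ennreal (a * vol Q) \<and>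
       wint (\<lambda>x. (w x powr (- 1 / (p - 1))) powr - (p - 1)) Q = ennreal (b * vol Q) \<and>
       a * b powr (1 / (p - 1)) \<le> K powr (1 / (p - 1))"
      using ab by (intro exI[where x = b] exI[where x = a]) auto
  qed (use pos in \<open>auto simp: less_imp_neq[symmetric]\<close>)
qed

text \<open>The dual weight has at least as much mass on \<open>R\<close> as on \<open>Q\<close>.
  The A_p bound on \<open>R\<close> turns this into an upper bound for the average of
  \<open>w\<close> over \<open>R\<close>, and \<open>1 \<le> a * b powr (p - 1)\<close> on
  \<open>Q\<close> converts the dual average back into \<open>a\<close>.\<close>

lemma ap_subset_cubes:
  assumes "ap p K w" "1 < p" "Q \<in> cubes" "R \<in> cubes" "Q \<subseteq> R"
  shows "wint w R \<le> ennreal (K * (vol R / vol Q) powr p) * wint w Q"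
proof -
  have w: "w \<in> lmeas" and pos: "\<And>x. 0 < w x"
    using assms(1) by (auto simp: ap_def)
  obtain a b where ab: "0 < a" "0 < b" "wint w Q = ennreal (a * vol Q)"
      "wint (\<lambda>x. w x powr (- 1 / (p - 1))) Q = ennreal (b * vol Q)" "a * b powr (p - 1) \<le> K"
    using assms(1,3) unfolding ap_def by blast
  obtain c d where cd: "0 < c" "0 < d" "wint w R = ennreal (c * vol R)"
      "wint (\<lambda>x. w x powr (- 1 / (p - 1))) R = ennreal (d * vol R)" "c * d powr (p - 1) \<le> K"
    using assms(1,4) unfolding ap_def by blast
  have mQ: "0 < vol Q" and mR: "0 < vol R" using assms by auto
  have "0 < a * b powr (p - 1)" using ab by simp
  then have K: "0 < K" using ab by linarith
  define \<theta> where "\<theta> = vol R / vol Q"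
  have \<theta>: "0 < \<theta>" using mQ mR by (simp add: \<theta>_def)
  have "b * vol Q \<le> d * vol R"
    using wint_mono_set[OF assms(5), of "\<lambda>x. w x powr (- 1 / (p - 1))"] ab cd mQ mR
    by (simp add: ennreal_le_iff)
  then have "b \<le> d * \<theta>" using mQ by (simp add: \<theta>_def field_simps)
  have "c \<le> K * d powr - (p - 1)"
    using cd(1,2,5) by (simp only: powr_minus_divide) (simp add: pos_le_divide_eq)
  also have "\<dots> = K * \<theta> powr (p - 1) * (d * \<theta>) powr - (p - 1)"
  proof -
    have "\<theta> powr (p - 1) * \<theta> powr - (p - 1) = 1"
      using \<theta> by (simp add: powr_add[symmetric])
    moreover have "(d * \<theta>) powr - (p - 1) = d powr - (p - 1) * \<theta> powr - (p - 1)"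
      by (rule powr_mult)
    moreover have "K * \<theta> powr (p - 1) * (d powr - (p - 1) * \<theta> powr - (p - 1))
        = K * d powr - (p - 1) * (\<theta> powr (p - 1) * \<theta> powr - (p - 1))"
      by (simp only: mult_ac)
    ultimately show ?thesis by simp
  qed
  also have "\<dots> \<le> K * \<theta> powr (p - 1) * b powr - (p - 1)"
  proof (intro mult_left_mono powr_mono2')
    show "0 \<le> K * \<theta> powr (p - 1)" using K by simp
  qed (use \<open>b \<le> d * \<theta>\<close> ab assms(2) in auto)
  also have "\<dots> \<le> K * \<theta> powr (p - 1) * a"
  proof (intro mult_left_mono)
    have "1 \<le> a * b powr (p - 1)"
      by (rule ap_avg_ge_1[OF w pos assms(2,3)]) (use ab in auto)
    then show "b powr - (p - 1) \<le> a" using ab by (simp only: powr_minus) (simp add: field_simps)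
    show "0 \<le> K * \<theta> powr (p - 1)" using K by simp
  qed
  finally have "c * vol R \<le> K * \<theta> powr (p - 1) * a * vol R"
    using mR by simp
  also have "\<dots> = K * \<theta> powr p * (a * vol Q)"
    using mQ mR \<theta> by (simp add: powr_diff \<theta>_def field_simps)
  finally have "ennreal (c * vol R) \<le> ennreal (K * \<theta> powr p * (a * vol Q))"
    by (rule ennreal_leI)
  also have "\<dots> = ennreal (K * \<theta> powr p) * ennreal (a * vol Q)"
    using ab by (intro ennreal_mult'') auto
  finally show ?thesis by (simp add: ab cd \<theta>_def)
qed

lemma ap_doubling:
  fixes w :: "real ^ 'n \<Rightarrow> real"
  assumes "ap p K w" "1 < p"
  shows "doubling (K * (3 ^ CARD('n)) powr p) w"
  unfolding doubling_def
proof (intro conjI allI impI)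
  fix c :: "real ^ 'n" and t :: real assume t: "0 < t"
  have "wint w (cb c (3 * t)) \<le> ennreal (K * (vol (cb c (3 * t)) / vol (cb c t)) powr p) * wint w (cb c t)"
    using t by (intro ap_subset_cubes assms cb_mono) auto
  also have "vol (cb c (3 * t)) / vol (cb c t) = 3 ^ CARD('n)"
    using t by (simp add: measure_cb power_divide[symmetric])
  finally show "wint w (cb c (3 * t)) \<le> ennreal (K * (3 ^ CARD('n)) powr p) * wint w (cb c t)" .
  have "cb c t \<in> cubes" using t by simp
  then obtain a where "wint w (cb c t) = ennreal (a * vol (cb c t))"
    using assms(1) unfolding ap_def by blast
  then show "wint w (cb c t) < top" by simp
qed (use assms in \<open>auto simp: ap_def\<close>)

lemma ap_const_pos:
  assumes "ap p K (w :: real ^ 'n \<Rightarrow> real)" shows "0 < K"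
proof -
  have "cb (0 :: real ^ 'n) 1 \<in> cubes" by simp
  then obtain a b where "0 < a" "0 < b" "a * b powr (p - 1) \<le> K"
    using assms unfolding ap_def by blast
  then have "0 < a * b powr (p - 1)" by simp
  then show ?thesis using \<open>a * b powr (p - 1) \<le> K\<close> by simp
qed

section \<open>Muckenhoupt's theorem for the maximal operator\<close>

abbreviation Mop :: "(real ^ 'n \<Rightarrow> ennreal) \<Rightarrow> real ^ 'n \<Rightarrow> ennreal" where
  "Mop \<equiv> maxop (\<lambda>_. 1)"

text \<open>Lerner's pointwise bound; it yields Muckenhoupt's theorem from the maximal theorems of the doubling
  weights \<open>w\<close> and \<open>\<rho> = w\<^bsup>1-p'\<^esup>\<close>, without the openness of the Muckenhoupt condition.\<close>

lemma Mop_powr_le: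
  fixes w :: "real ^ 'n \<Rightarrow> real"
  assumes "ap p K w" "1 < p" and g[measurable]: "g \<in> lmeas"
  defines "\<rho> \<equiv> \<lambda>x. w x powr (- 1 / (p - 1))"
  shows "enn_powr (Mop g x) (p - 1) \<le> ennreal K *
    maxop w (\<lambda>x. enn_powr (maxop \<rho> (\<lambda>x. g x * ennreal (1 / \<rho> x)) x) (p - 1) * ennreal (1 / w x)) x"
    (is "_ \<le> ennreal K * maxop w ?h x")
proof -
  have w[measurable]: "w \<in> lmeas" and pos: "\<And>x. 0 < w x"
    using assms(1) by (auto simp: ap_def)
  have \<rho>[measurable]: "\<rho> \<in> lmeas" and \<rho>pos: "\<And>x. 0 < \<rho> x"
    unfolding \<rho>_def using pos by (auto simp: less_imp_neq[symmetric])
  have "enn_powr (Mop g x) (p - 1) = (SUP Q\<in>bcubes. enn_powr ((\<integral>\<^sup>+y\<in>Q. g y * ennreal 1 \<partial>lebesgue) / wint (\<lambda>_. 1) Q * indicator Q x) (p - 1))"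
    unfolding maxop_def using assms(2) by (intro enn_powr_SUP) auto
  also have "\<dots> \<le> ennreal K * maxop w ?h x"
  proof (rule SUP_least)
    fix Q :: "(real ^ 'n) set" assume Q: "Q \<in> bcubes"
    then have Qc: "Q \<in> cubes" using bcubes_cubes by auto
    then have [measurable]: "Q \<in> sets lebesgue" by simp
    have mQ: "0 < vol Q" using Qc by simp
    obtain a b where ab: "0 < a" "0 < b" "wint w Q = ennreal (a * vol Q)"
      "wint \<rho> Q = ennreal (b * vol Q)" "a * b powr (p - 1) \<le> K"
      using assms(1) Qc unfolding ap_def \<rho>_def by blast
    show "enn_powr ((\<integral>\<^sup>+y\<in>Q. g y * ennreal 1 \<partial>lebesgue) / wint (\<lambda>_. 1) Q * indicator Q x) (p - 1) \<le> ennreal K * maxop w ?h x"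
    proof (cases "x \<in> Q")
      case True
      \<comment> \<open>\<open>A\<close> is the \<open>\<rho>\<close>-average of
        \<open>g / \<rho>\<close>, so the plain average of \<open>g\<close> is \<open>A * b\<close>,
        and \<open>b powr (p - 1) \<le> K / a\<close>. As \<open>A\<close> lies below the inner
        maximal function on all of \<open>Q\<close>, \<open>A powr (p - 1) * vol Q\<close> is at
        most its integral, and dividing by the mass of \<open>w\<close> gives a
        \<open>w\<close>-average of \<open>?h\<close>.\<close>
      define A where "A = (\<integral>\<^sup>+y\<in>Q. g y \<partial>lebesgue) / wint \<rho> Q"
      have "(\<integral>\<^sup>+y\<in>Q. g y * ennreal (1 / \<rho> y) * ennreal (\<rho> y) \<partial>lebesgue) = (\<integral>\<^sup>+y\<in>Q. g y \<partial>lebesgue)"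
        using \<rho>pos by (intro nn_integral_cong) (auto simp: mult.assoc ennreal_mult[symmetric] less_imp_le less_imp_neq[symmetric])
      then have A: "A \<le> maxop \<rho> (\<lambda>x. g x * ennreal (1 / \<rho> x)) y" if "y \<in> Q" for y
        using maxop_upper[OF Q that, of "\<lambda>x. g x * ennreal (1 / \<rho> x)" \<rho>] by (simp add: A_def)
      have "(\<integral>\<^sup>+y\<in>Q. g y * ennreal 1 \<partial>lebesgue) / wint (\<lambda>_. 1) Q = A * ennreal b"
      proof -
        have 1: "ennreal (b * vol Q) = ennreal b * ennreal (vol Q)"
          using ab by (intro ennreal_mult) auto
        have "(\<integral>\<^sup>+y\<in>Q. g y \<partial>lebesgue) = A * wint \<rho> Q"
          using ab mQ by (simp add: A_def ennreal_divide_times divide_ennreal ennreal_times_divide[symmetric])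
        also have "\<dots> = A * ennreal b * ennreal (vol Q)"
          using ab by (simp add: 1 mult.assoc)
        finally show ?thesis
          using Qc less_imp_neq[OF mQ, symmetric] by (simp add: wint_const ennreal_mult_divide_eq)
      qed
      then have "enn_powr ((\<integral>\<^sup>+y\<in>Q. g y * ennreal 1 \<partial>lebesgue) / wint (\<lambda>_. 1) Q * indicator Q x) (p - 1) = enn_powr A (p - 1) * ennreal (b powr (p - 1))"
        using True ab by (simp add: enn_powr_mult)
      also have "\<dots> \<le> enn_powr A (p - 1) * ennreal (K / a)"
        using ab by (intro mult_left_mono ennreal_leI) (auto simp: field_simps)
      also have "\<dots> = ennreal K * (enn_powr A (p - 1) * ennreal (vol Q) / wint w Q)"
      proof -
        have "ennreal (K / a) = ennreal K * (ennreal (vol Q) / wint w Q)"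
          using ab mQ ap_const_pos[OF assms(1)] by (simp add: divide_ennreal ennreal_mult[symmetric])
        then show ?thesis by (simp add: ennreal_times_divide mult_ac)
      qed
      also have "\<dots> \<le> ennreal K * ((\<integral>\<^sup>+y\<in>Q. ?h y * ennreal (w y) \<partial>lebesgue) / wint w Q)"
      proof (intro mult_left_mono divide_right_mono_ennreal)
        have "enn_powr A (p - 1) * ennreal (vol Q) = (\<integral>\<^sup>+y\<in>Q. enn_powr A (p - 1) \<partial>lebesgue)"
          using Qc by (simp add: nn_integral_cmult_indicator emeasure_cubes)
        also have "\<dots> \<le> (\<integral>\<^sup>+y\<in>Q. ?h y * ennreal (w y) \<partial>lebesgue)"
        proof (rule nn_integral_mono)
          fix y show "enn_powr A (p - 1) * indicator Q y \<le> ?h y * ennreal (w y) * indicator Q y"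
          proof (cases "y \<in> Q")
            case True
            have "?h y * ennreal (w y) = enn_powr (maxop \<rho> (\<lambda>x. g x * ennreal (1 / \<rho> x)) y) (p - 1)"
              using pos[of y] by (simp add: mult.assoc ennreal_mult[symmetric])
            then show ?thesis using A[OF True] assms(2) True by (simp add: enn_powr_mono)
          qed simp
        qed
        finally show "enn_powr A (p - 1) * ennreal (vol Q) \<le> (\<integral>\<^sup>+y\<in>Q. ?h y * ennreal (w y) \<partial>lebesgue)" .
      qed simp
      also have "\<dots> \<le> ennreal K * maxop w ?h x"
        by (intro mult_left_mono maxop_upper Q True) simp
      finally show ?thesis .
    qed simp
  qed
  finally show ?thesis .
qed

text \<open>The pointwise bound is raised to the power \<open>q = p'\<close>, where
  \<open>(p - 1) * q = p\<close>. The maximal theorem for \<open>w\<close> with exponent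
  \<open>q\<close> and the one for \<open>\<rho>\<close> with exponent \<open>p\<close> then apply.
  Both constants see the weight only through \<open>K\<close>, hence the order of the
  quantifiers.\<close>

theorem Mop_bounded:
  assumes p: "1 < p"
  shows "\<exists>C>0. \<forall>w g. ap p K (w :: real ^ 'n \<Rightarrow> real) \<longrightarrow> g \<in> lmeas \<longrightarrow>
     (\<integral>\<^sup>+x. enn_powr (Mop g x) p * ennreal (w x) \<partial>lebesgue) \<le> ennreal C * (\<integral>\<^sup>+x. enn_powr (g x) p * ennreal (w x) \<partial>lebesgue)"
proof -
  define q where "q = p / (p - 1)"
  have q: "1 < q" using p by (simp add: q_def field_simps)
  define C1 where "C1 = maxop_const q (K * (3 ^ CARD('n)) powr p)"
  define C2 where "C2 = maxop_const p (K powr (1 / (p - 1)) * (3 ^ CARD('n)) powr q)"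
  define C where "C = max 1 (K powr q * C1 * C2)"
  have "(\<integral>\<^sup>+x. enn_powr (Mop g x) p * ennreal (w x) \<partial>lebesgue) \<le> ennreal C * (\<integral>\<^sup>+x. enn_powr (g x) p * ennreal (w x) \<partial>lebesgue)"
    if ap: "ap p K w" and g[measurable]: "g \<in> lmeas" for w :: "real ^ 'n \<Rightarrow> real" and g
  proof -
    have w[measurable]: "w \<in> lmeas" and pos: "\<And>x. 0 < w x"
      using ap by (auto simp: ap_def)
    define \<rho> where "\<rho> = (\<lambda>x. w x powr (- 1 / (p - 1)))"
    have \<rho>[measurable]: "\<rho> \<in> lmeas" and \<rho>pos: "\<And>x. 0 < \<rho> x"
      unfolding \<rho>_def using pos by (auto simp: less_imp_neq[symmetric])
    have K: "0 < K" using ap by (rule ap_const_pos)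
    have C12: "0 \<le> C1" "0 \<le> C2" using K p q by (auto simp: C1_def C2_def maxop_const_def)
    define N where "N = maxop \<rho> (\<lambda>x. g x * ennreal (1 / \<rho> x))"
    have N[measurable]: "N \<in> lmeas" unfolding N_def by measurable
    define h where "h = (\<lambda>x. enn_powr (N x) (p - 1) * ennreal (1 / w x))"
    have h[measurable]: "h \<in> lmeas" unfolding h_def by measurable
    have pq: "(p - 1) * q = p" using p by (simp add: q_def)
    have "(\<integral>\<^sup>+x. enn_powr (Mop g x) p * ennreal (w x) \<partial>lebesgue) \<le> (\<integral>\<^sup>+x. ennreal (K powr q) * (enn_powr (maxop w h x) q * ennreal (w x)) \<partial>lebesgue)"
    proof (rule nn_integral_mono)
      fix x
      have "enn_powr (Mop g x) p = enn_powr (enn_powr (Mop g x) (p - 1)) q"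
        by (simp add: enn_powr_powr pq)
      also have "\<dots> \<le> enn_powr (ennreal K * maxop w h x) q"
        using Mop_powr_le[OF ap p g, of x] q by (intro enn_powr_mono) (auto simp: h_def N_def \<rho>_def)
      also have "\<dots> = ennreal (K powr q) * enn_powr (maxop w h x) q"
        using K by (simp add: enn_powr_mult)
      finally show "enn_powr (Mop g x) p * ennreal (w x) \<le> ennreal (K powr q) * (enn_powr (maxop w h x) q * ennreal (w x))"
        by (simp add: mult.assoc[symmetric] mult_right_mono)
    qed
    also have "\<dots> = ennreal (K powr q) * (\<integral>\<^sup>+x. enn_powr (maxop w h x) q * ennreal (w x) \<partial>lebesgue)"
      by (rule nn_integral_cmult) measurable
    also have "\<dots> \<le> ennreal (K powr q) * (ennreal C1 * (\<integral>\<^sup>+x. enn_powr (h x) q * ennreal (w x) \<partial>lebesgue))"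
      unfolding C1_def using K by (intro mult_left_mono maxop_strong_type ap_doubling[OF ap p] q) auto
    also have "(\<integral>\<^sup>+x. enn_powr (h x) q * ennreal (w x) \<partial>lebesgue) = (\<integral>\<^sup>+x. enn_powr (N x) p * ennreal (\<rho> x) \<partial>lebesgue)"
    proof (rule nn_integral_cong)
      fix x
      have "(1 / w x) powr q * w x = w x powr (1 - q)"
        using pos[of x] by (simp add: powr_divide powr_diff)
      also have "1 - q = - 1 / (p - 1)" using p by (simp add: q_def field_simps)
      finally have "ennreal ((1 / w x) powr q) * ennreal (w x) = ennreal (\<rho> x)"
        using pos[of x] by (simp add: ennreal_mult[symmetric] \<rho>_def)
      moreover have "enn_powr (h x) q = enn_powr (N x) p * ennreal ((1 / w x) powr q)"
        using pos[of x] by (simp add: h_def enn_powr_mult enn_powr_powr pq)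
      ultimately show "enn_powr (h x) q * ennreal (w x) = enn_powr (N x) p * ennreal (\<rho> x)"
        by (simp add: mult.assoc)
    qed
    also have "\<dots> \<le> ennreal C2 * (\<integral>\<^sup>+x. enn_powr (g x * ennreal (1 / \<rho> x)) p * ennreal (\<rho> x) \<partial>lebesgue)"
      unfolding C2_def N_def
    proof (intro maxop_strong_type p)
      show "doubling (K powr (1 / (p - 1)) * (3 ^ CARD('n)) powr q) \<rho>"
        unfolding \<rho>_def using ap_doubling[OF ap_dual[OF ap p]] q by (simp add: q_def)
    qed (auto simp: K)
    also have "(\<integral>\<^sup>+x. enn_powr (g x * ennreal (1 / \<rho> x)) p * ennreal (\<rho> x) \<partial>lebesgue) = (\<integral>\<^sup>+x. enn_powr (g x) p * ennreal (w x) \<partial>lebesgue)"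
    proof (rule nn_integral_cong)
      fix x
      have "(1 / \<rho> x) powr p * \<rho> x = \<rho> x powr (1 - p)"
        using \<rho>pos[of x] by (simp add: powr_divide powr_diff)
      also have "\<dots> = w x"
      proof -
        have "- 1 / (p - 1) * (1 - p) = 1" using p by (simp add: divide_simps)
        then show ?thesis using pos[of x] by (simp only: \<rho>_def powr_powr) simp
      qed
      finally have "ennreal ((1 / \<rho> x) powr p) * ennreal (\<rho> x) = ennreal (w x)"
        using \<rho>pos[of x] by (simp add: ennreal_mult[symmetric])
      moreover have "enn_powr (g x * ennreal (1 / \<rho> x)) p = enn_powr (g x) p * ennreal ((1 / \<rho> x) powr p)"
        using \<rho>pos[of x] by (simp add: enn_powr_mult less_imp_le)
      ultimately show "enn_powr (g x * ennreal (1 / \<rho> x)) p * ennreal (\<rho> x) = enn_powr (g x) p * ennreal (w x)"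
        by (simp add: mult.assoc)
    qed
    finally have "(\<integral>\<^sup>+x. enn_powr (Mop g x) p * ennreal (w x) \<partial>lebesgue) \<le> ennreal (K powr q) * (ennreal C1 * (ennreal C2 * (\<integral>\<^sup>+x. enn_powr (g x) p * ennreal (w x) \<partial>lebesgue)))"
      by (simp add: mult_left_mono)
    also have "\<dots> = ennreal (K powr q * C1 * C2) * (\<integral>\<^sup>+x. enn_powr (g x) p * ennreal (w x) \<partial>lebesgue)"
      using C12 by (simp add: ennreal_mult mult.assoc)
    also have "\<dots> \<le> ennreal C * (\<integral>\<^sup>+x. enn_powr (g x) p * ennreal (w x) \<partial>lebesgue)"
      by (intro mult_right_mono ennreal_leI) (auto simp: C_def)
    finally show ?thesis .
  qed
  moreover have "0 < C" by (simp add: C_def)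
  ultimately show ?thesis by blast
qed

section \<open>Factorisation by a Rubio de Francia iteration\<close>

lemma maxop_mono:
  assumes "\<And>x. g x \<le> h x" shows "maxop u g x \<le> maxop u h x"
  unfolding maxop_def using assms
  by (intro SUP_mono') (auto intro!: mult_right_mono divide_right_mono_ennreal nn_integral_mono)

text \<open>Monotone convergence and an exchange of suprema; this carries the inequalities of the
  iteration over to its limit.\<close>

lemma maxop_SUP:
  assumes [measurable]: "u \<in> lmeas" "\<And>k. g k \<in> lmeas"
    and inc: "incseq g"
  shows "maxop u (\<lambda>x. SUP k::nat. g k x) x = (SUP k. maxop u (g k) x)"
proof -
  have "(\<integral>\<^sup>+y\<in>Q. (SUP k. g k y) * ennreal (u y) \<partial>lebesgue) / wint u Q * indicator Q x
     = (SUP k. (\<integral>\<^sup>+y\<in>Q. g k y * ennreal (u y) \<partial>lebesgue) / wint u Q * indicator Q x)" if "Q \<in> bcubes" for Q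
  proof -
    have [measurable]: "Q \<in> sets lebesgue" using that bcubes_cubes by auto
    have "(\<integral>\<^sup>+y\<in>Q. (SUP k. g k y) * ennreal (u y) \<partial>lebesgue) = (\<integral>\<^sup>+y. (SUP k. g k y * ennreal (u y) * indicator Q y) \<partial>lebesgue)"
      by (simp add: SUP_mult_right_ennreal)
    also have "\<dots> = (SUP k. \<integral>\<^sup>+y\<in>Q. g k y * ennreal (u y) \<partial>lebesgue)"
      using inc by (intro nn_integral_monotone_convergence_SUP)
        (auto simp: incseq_def le_fun_def intro!: mult_right_mono)
    finally show ?thesis
      by (simp add: divide_ennreal_def SUP_mult_right_ennreal)
  qed
  then have "maxop u (\<lambda>x. SUP k::nat. g k x) x = (SUP Q\<in>bcubes. SUP k. (\<integral>\<^sup>+y\<in>Q. g k y * ennreal (u y) \<partial>lebesgue) / wint u Q * indicator Q x)"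
    unfolding maxop_def by simp
  also have "\<dots> = (SUP k. maxop u (g k) x)"
    unfolding maxop_def by (rule SUP_commute)
  finally show ?thesis .
qed

lemma maxop_cong_AE:
  assumes "AE x in lebesgue. g x = h x" shows "maxop u g = maxop u h"
proof -
  have "(\<integral>\<^sup>+y\<in>Q. g y * ennreal (u y) \<partial>lebesgue) = (\<integral>\<^sup>+y\<in>Q. h y * ennreal (u y) \<partial>lebesgue)" for Q
    using assms by (intro nn_integral_cong_AE) (auto elim: eventually_mono)
  then show ?thesis by (simp add: maxop_def fun_eq_iff)
qed

text \<open>\<open>Mop\<close> sees only the countable family, so a cube is enclosed in some
  \<open>R\<close> of that family, whence the factor \<open>2 ^ CARD('n)\<close>. Local
  integrability comes for free: the bound at a single point of \<open>R\<close> makes the integral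
  over \<open>R\<close> finite.\<close>

lemma a1_of_Mop:
  fixes u :: "real ^ 'n \<Rightarrow> real"
  assumes u[measurable]: "u \<in> lmeas" and pos: "\<And>x. 0 < u x" and c: "0 \<le> c"
    and M: "AE x in lebesgue. Mop (\<lambda>y. ennreal (u y)) x \<le> ennreal (c * u x)"
  shows "a1 (2 ^ CARD('n) * c) u"
  unfolding a1_def
proof (intro conjI allI ballI)
  fix Q :: "(real ^ 'n) set" assume Q: "Q \<in> cubes"
  then have mQ: "0 < vol Q" by simp
  obtain R where R: "R \<in> bcubes" "Q \<subseteq> R" "vol R \<le> 2 ^ CARD('n) * vol Q"
    using bcubes_cover[OF Q] by auto
  have Rc: "R \<in> cubes" using R bcubes_cubes by auto
  then have mR: "0 < vol R" by simp
  have avg: "wint u R / ennreal (vol R) \<le> Mop (\<lambda>y. ennreal (u y)) x" if "x \<in> R" for x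
    using maxop_upper[OF R(1) that, of "\<lambda>y. ennreal (u y)" "\<lambda>_. 1"] Rc by (simp add: wint_const[of R 1, simplified] wint_def emeasure_cubes)
  have "wint u R \<le> ennreal (c * u x * vol R)" if "x \<in> R" "Mop (\<lambda>y. ennreal (u y)) x \<le> ennreal (c * u x)" for x
  proof -
    have "wint u R = wint u R / ennreal (vol R) * ennreal (vol R)"
      using mR by (simp add: ennreal_divide_times mult_divide_eq_ennreal divide_ennreal)
    also have "\<dots> \<le> ennreal (c * u x) * ennreal (vol R)"
      using avg[OF that(1)] that(2) by (intro mult_right_mono) auto
    finally show ?thesis using c pos[of x] by (simp add: ennreal_mult'')
  qed
  then have *: "AE x in lebesgue. x \<in> R \<longrightarrow> wint u R \<le> ennreal (c * u x * vol R)"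
    using M by (auto elim: eventually_mono)
  obtain x where "wint u R \<le> ennreal (c * u x * vol R)"
    using cube_AE_witness[OF Rc *] by auto
  then have "wint u R < top" using ennreal_less_top le_less_trans by blast
  then have "wint u Q < top" using wint_mono_set[OF R(2)] le_less_trans by blast
  then obtain b where b: "wint u Q = ennreal b" "0 < b"
    using wint_pos[OF u pos Q] by (cases "wint u Q") auto
  define m where "m = b / vol Q"
  have "m \<le> 2 ^ CARD('n) * c * u x" if "wint u R \<le> ennreal (c * u x * vol R)" for x
  proof -
    have "ennreal b \<le> ennreal (c * u x * vol R)"
      using wint_mono_set[OF R(2), of u] that b by simp
    then have "b \<le> c * u x * vol R"
      using c pos[of x] by (subst (asm) ennreal_le_iff) auto
    also have "\<dots> \<le> c * u x * (2 ^ CARD('n) * vol Q)"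
      using R(3) c pos[of x] by (intro mult_left_mono) auto
    finally show ?thesis using mQ by (simp add: m_def pos_divide_le_eq mult_ac)
  qed
  then have "AE x in lebesgue. x \<in> Q \<longrightarrow> m \<le> 2 ^ CARD('n) * c * u x"
    using * R(2) by (auto elim!: eventually_mono)
  then show "\<exists>m>0. wint u Q = ennreal (m * vol Q) \<and> (AE x in lebesgue. x \<in> Q \<longrightarrow> m \<le> 2 ^ CARD('n) * c * u x)"
    using b mQ by (intro exI[where x = m]) (auto simp: m_def)
qed (use pos in auto)

lemma a1_mono: "a1 C u \<Longrightarrow> C \<le> D \<Longrightarrow> a1 D u"
  unfolding a1_def
proof (intro conjI ballI; (elim conjE, assumption)?)
  fix Q :: "(real ^ 'a) set"
  assume *: "u \<in> lmeas \<and> (\<forall>x. 0 < u x) \<and>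
    (\<forall>Q\<in>cubes. \<exists>m>0. wint u Q = ennreal (m * vol Q) \<and> (AE x in lebesgue. x \<in> Q \<longrightarrow> m \<le> C * u x))"
    and CD: "C \<le> D" and Q: "Q \<in> cubes"
  then obtain m where m: "m > 0" "wint u Q = ennreal (m * vol Q)"
    "AE x in lebesgue. x \<in> Q \<longrightarrow> m \<le> C * u x" by blast
  have "C * u x \<le> D * u x" for x using CD * by (intro mult_right_mono) (auto intro: less_imp_le)
  then have "AE x in lebesgue. x \<in> Q \<longrightarrow> m \<le> D * u x"
    using m(3) by (auto elim!: eventually_mono intro: order_trans)
  then show "\<exists>m>0. wint u Q = ennreal (m * vol Q) \<and> (AE x in lebesgue. x \<in> Q \<longrightarrow> m \<le> D * u x)"
    using m by blast
qed

text \<open>Both factors come from one majorant \<open>F\<close>, so that \<open>u\<^sub>1 u\<^sub>2 = F\<^sup>t\<close> besides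
  \<open>u\<^sub>1 u\<^sub>2\<^bsup>1-t\<^esup> = \<omega>\<close>; since \<open>F\<close> is the limit of an increasing iteration, the two operators need only
  be monotone.\<close>

theorem ap_factorization:
  assumes t: "1 < t"
  shows "\<exists>A>0. \<forall>(\<omega> :: real ^ 'n \<Rightarrow> real) F0. ap t K \<omega> \<longrightarrow> F0 \<in> lmeas \<longrightarrow> (\<forall>x. 0 < F0 x) \<longrightarrow>
    (\<integral>\<^sup>+x. ennreal (F0 x powr t) \<partial>lebesgue) < top \<longrightarrow>
    (\<exists>F. F \<in> lmeas \<and> (\<forall>x. F0 x \<le> F x) \<and>
      (\<integral>\<^sup>+x. ennreal (F x powr t) \<partial>lebesgue) \<le> 2 * (\<integral>\<^sup>+x. ennreal (F0 x powr t) \<partial>lebesgue) \<and>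
      a1 A (\<lambda>x. F x powr (t - 1) * \<omega> x powr (1 / t)) \<and> a1 A (\<lambda>x. F x * \<omega> x powr (- 1 / t)))"
proof -
  define q where "q = t / (t - 1)"
  have q: "1 < q" using t by (simp add: q_def field_simps)
  have tq: "(t - 1) * q = t" "1 / (t - 1) * t = q" using t by (simp_all add: q_def)
  obtain C1 where C1: "0 < C1" "\<And>w g. ap t K (w :: real ^ 'n \<Rightarrow> real) \<Longrightarrow> g \<in> lmeas \<Longrightarrow>
     (\<integral>\<^sup>+x. enn_powr (Mop g x) t * ennreal (w x) \<partial>lebesgue) \<le> ennreal C1 * (\<integral>\<^sup>+x. enn_powr (g x) t * ennreal (w x) \<partial>lebesgue)"
    using Mop_bounded[OF t, of K, where 'n = 'n] by blast
  obtain C2 where C2: "0 < C2" "\<And>w g. ap q (K powr (1 / (t - 1))) (w :: real ^ 'n \<Rightarrow> real) \<Longrightarrow> g \<in> lmeas \<Longrightarrow>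
     (\<integral>\<^sup>+x. enn_powr (Mop g x) q * ennreal (w x) \<partial>lebesgue) \<le> ennreal C2 * (\<integral>\<^sup>+x. enn_powr (g x) q * ennreal (w x) \<partial>lebesgue)"
    using Mop_bounded[OF q, of "K powr (1 / (t - 1))", where 'n = 'n] by blast
  \<comment> \<open>With this \<open>c\<close> a step adds at most
    \<open>(C1 + C2) * (2 * I0) / c powr t = I0\<close> to the initial \<open>I0\<close>, so the
    bound \<open>2 * I0\<close> reproduces itself.\<close>
  define c where "c = (2 * (C1 + C2)) powr (1 / t)"
  have c: "0 < c" "c powr t = 2 * (C1 + C2)" using C1 C2 t by (auto simp: c_def powr_powr)
  define A where "A = 2 ^ CARD('n) * max c (c powr (t - 1))"
  have "\<exists>F. F \<in> lmeas \<and> (\<forall>x. F0 x \<le> F x) \<and>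
      (\<integral>\<^sup>+x. ennreal (F x powr t) \<partial>lebesgue) \<le> 2 * (\<integral>\<^sup>+x. ennreal (F0 x powr t) \<partial>lebesgue) \<and>
      a1 A (\<lambda>x. F x powr (t - 1) * \<omega> x powr (1 / t)) \<and> a1 A (\<lambda>x. F x * \<omega> x powr (- 1 / t))"
    if ap: "ap t K \<omega>" and F0[measurable]: "F0 \<in> lmeas" and F0pos: "\<And>x. 0 < F0 x"
      and fin: "(\<integral>\<^sup>+x. ennreal (F0 x powr t) \<partial>lebesgue) < top" for \<omega> :: "real ^ 'n \<Rightarrow> real" and F0
  proof -
    have w[measurable]: "\<omega> \<in> lmeas" and pos: "\<And>x. 0 < \<omega> x"
      using ap by (auto simp: ap_def)
    \<comment> \<open>Conjugates of the maximal operator that are bounded on unweighted L_t: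
      \<open>P2\<close> by Muckenhoupt's theorem for \<open>\<omega>\<close>, \<open>P1\<close> by
      that for the dual weight with exponent \<open>q\<close>. If \<open>P1\<close> and
      \<open>P2\<close> map \<open>F\<close> below \<open>c * F\<close>, then
      \<open>F powr (t - 1) * \<omega> powr (1 / t)\<close> and
      \<open>F * \<omega> powr (- 1 / t)\<close> are A_1 weights.\<close>
    define P1 where "P1 g x = enn_powr (ennreal (\<omega> x powr (- 1 / t)) * Mop (\<lambda>y. enn_powr (g y) (t - 1) * ennreal (\<omega> y powr (1 / t))) x) (1 / (t - 1))" for g x
    define P2 where "P2 g x = ennreal (\<omega> x powr (1 / t)) * Mop (\<lambda>y. g y * ennreal (\<omega> y powr (- 1 / t))) x" for g x
    have P1m[measurable]: "P1 g \<in> lmeas" and P2m[measurable]: "P2 g \<in> lmeas"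
      if [measurable]: "g \<in> lmeas" for g
      unfolding P1_def P2_def by measurable
    have P1mono: "P1 g x \<le> P1 h x" if "\<And>x. g x \<le> h x" for g h x
      unfolding P1_def using that t by (intro enn_powr_mono mult_left_mono maxop_mono mult_right_mono) auto
    have P2mono: "P2 g x \<le> P2 h x" if "\<And>x. g x \<le> h x" for g h x
      unfolding P2_def using that by (intro mult_left_mono maxop_mono mult_right_mono) auto
    have P1int: "(\<integral>\<^sup>+x. enn_powr (P1 g x) t \<partial>lebesgue) \<le> ennreal C2 * (\<integral>\<^sup>+x. enn_powr (g x) t \<partial>lebesgue)"
      if [measurable]: "g \<in> lmeas" for g
    proof -
      have "enn_powr (P1 g x) t = enn_powr (Mop (\<lambda>y. enn_powr (g y) (t - 1) * ennreal (\<omega> y powr (1 / t))) x) q * ennreal (\<omega> x powr (- 1 / (t - 1)))" for x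
      proof -
        have "- 1 / t * q = - 1 / (t - 1)" using t by (simp add: q_def)
        then show ?thesis using pos[of x]
          unfolding P1_def enn_powr_powr tq(2) enn_powr_mult by (simp add: powr_powr mult.commute)
      qed
      then have "(\<integral>\<^sup>+x. enn_powr (P1 g x) t \<partial>lebesgue) = (\<integral>\<^sup>+x. enn_powr (Mop (\<lambda>y. enn_powr (g y) (t - 1) * ennreal (\<omega> y powr (1 / t))) x) q * ennreal (\<omega> x powr (- 1 / (t - 1))) \<partial>lebesgue)"
        by simp
      also have "\<dots> \<le> ennreal C2 * (\<integral>\<^sup>+x. enn_powr (enn_powr (g x) (t - 1) * ennreal (\<omega> x powr (1 / t))) q * ennreal (\<omega> x powr (- 1 / (t - 1))) \<partial>lebesgue)"
        using ap_dual[OF ap t] by (intro C2(2)) (auto simp: q_def)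
      also have "(\<lambda>x. enn_powr (enn_powr (g x) (t - 1) * ennreal (\<omega> x powr (1 / t))) q * ennreal (\<omega> x powr (- 1 / (t - 1)))) = (\<lambda>x. enn_powr (g x) t)"
      proof
        fix x
        have "1 / t * q + - 1 / (t - 1) = 0" using t by (simp add: q_def)
        then have "ennreal (\<omega> x powr (1 / t * q)) * ennreal (\<omega> x powr (- 1 / (t - 1))) = 1"
          using pos[of x] by (simp add: ennreal_mult[symmetric] powr_add[symmetric])
        then show "enn_powr (enn_powr (g x) (t - 1) * ennreal (\<omega> x powr (1 / t))) q * ennreal (\<omega> x powr (- 1 / (t - 1))) = enn_powr (g x) t"
          using pos[of x] by (simp add: enn_powr_mult enn_powr_powr tq powr_powr mult.assoc)
      qed
      finally show ?thesis .
    qed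
    have P2int: "(\<integral>\<^sup>+x. enn_powr (P2 g x) t \<partial>lebesgue) \<le> ennreal C1 * (\<integral>\<^sup>+x. enn_powr (g x) t \<partial>lebesgue)"
      if [measurable]: "g \<in> lmeas" for g
    proof -
      have "(\<integral>\<^sup>+x. enn_powr (P2 g x) t \<partial>lebesgue) = (\<integral>\<^sup>+x. enn_powr (Mop (\<lambda>y. g y * ennreal (\<omega> y powr (- 1 / t))) x) t * ennreal (\<omega> x) \<partial>lebesgue)"
        using t less_imp_le[OF pos] unfolding P2_def by (intro nn_integral_cong) (simp add: enn_powr_mult powr_powr mult.commute)
      also have "\<dots> \<le> ennreal C1 * (\<integral>\<^sup>+x. enn_powr (g x * ennreal (\<omega> x powr (- 1 / t))) t * ennreal (\<omega> x) \<partial>lebesgue)"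
        by (intro C1(2) ap) measurable
      also have "(\<lambda>x. enn_powr (g x * ennreal (\<omega> x powr (- 1 / t))) t * ennreal (\<omega> x)) = (\<lambda>x. enn_powr (g x) t)"
      proof
        fix x
        have "ennreal ((\<omega> x powr (- 1 / t)) powr t) * ennreal (\<omega> x) = 1"
        proof -
          have "(\<omega> x powr (- 1 / t)) powr t = 1 / \<omega> x"
            using pos[of x] t by (subst powr_powr) (simp add: powr_minus_divide)
          then show ?thesis using pos[of x] by (simp add: ennreal_mult[symmetric])
        qed
        then show "enn_powr (g x * ennreal (\<omega> x powr (- 1 / t))) t * ennreal (\<omega> x) = enn_powr (g x) t"
          by (simp add: enn_powr_mult mult.assoc)
      qed
      finally show ?thesis .
    qed
    define step where "step g x = max (ennreal (F0 x)) (ennreal (1 / c) * max (P1 g x) (P2 g x))" for g x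
    define G where "G k = (step ^^ k) (\<lambda>x. ennreal (F0 x))" for k
    have G0: "G 0 = (\<lambda>x. ennreal (F0 x))" and GSuc: "\<And>k. G (Suc k) = step (G k)"
      by (simp_all add: G_def)
    have Gm[measurable]: "G k \<in> lmeas" for k
    proof (induction k)
      case (Suc k)
      then have [measurable]: "G k \<in> lmeas" .
      show ?case unfolding GSuc step_def[abs_def] by measurable
    qed (simp add: G0)
    have Ginc1: "G k x \<le> G (Suc k) x" for k x
    proof (induction k arbitrary: x)
      case 0 then show ?case by (simp add: G0 GSuc step_def)
    next
      case (Suc k)
      then show ?case unfolding GSuc[of "Suc k"] unfolding GSuc[of k] step_def
        by (intro max.mono mult_left_mono P1mono P2mono order_refl) (auto simp: GSuc step_def)
    qed
    then have Ginc: "incseq G" by (intro incseq_SucI le_funI)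
    define I0 where "I0 = (\<integral>\<^sup>+x. ennreal (F0 x powr t) \<partial>lebesgue)"
    have Gint: "(\<integral>\<^sup>+x. enn_powr (G k x) t \<partial>lebesgue) \<le> 2 * I0" for k
    proof (induction k)
      case 0
      have "(\<integral>\<^sup>+x. enn_powr (G 0 x) t \<partial>lebesgue) = I0" using F0pos by (simp add: G0 I0_def less_imp_le)
      then show ?case by (simp add: mult_2)
    next
      case (Suc k)
      have "(\<integral>\<^sup>+x. enn_powr (G (Suc k) x) t \<partial>lebesgue) \<le> (\<integral>\<^sup>+x. ennreal (F0 x powr t) + ennreal ((1 / c) powr t) * (enn_powr (P1 (G k) x) t + enn_powr (P2 (G k) x) t) \<partial>lebesgue)"
      proof (rule nn_integral_mono)
        fix x
        have "enn_powr (G (Suc k) x) t = max (ennreal (F0 x powr t)) (ennreal ((1 / c) powr t) * max (enn_powr (P1 (G k) x) t) (enn_powr (P2 (G k) x) t))"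
          using t c F0pos[of x] by (simp add: GSuc step_def enn_powr_max enn_powr_mult)
        also have "\<dots> \<le> ennreal (F0 x powr t) + ennreal ((1 / c) powr t) * (enn_powr (P1 (G k) x) t + enn_powr (P2 (G k) x) t)"
          by (intro max.boundedI add_increasing add_increasing2 mult_left_mono) auto
        finally show "enn_powr (G (Suc k) x) t \<le> ennreal (F0 x powr t) + ennreal ((1 / c) powr t) * (enn_powr (P1 (G k) x) t + enn_powr (P2 (G k) x) t)" .
      qed
      also have "\<dots> = I0 + ennreal ((1 / c) powr t) * ((\<integral>\<^sup>+x. enn_powr (P1 (G k) x) t \<partial>lebesgue) + (\<integral>\<^sup>+x. enn_powr (P2 (G k) x) t \<partial>lebesgue))"
        by (simp add: nn_integral_add nn_integral_cmult I0_def)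
      also have "\<dots> \<le> I0 + ennreal ((1 / c) powr t) * (ennreal C2 * (2 * I0) + ennreal C1 * (2 * I0))"
        by (intro add_left_mono mult_left_mono add_mono order_trans[OF P1int[OF Gm]] order_trans[OF P2int[OF Gm]] Suc) auto
      also have "ennreal C2 * (2 * I0) + ennreal C1 * (2 * I0) = ennreal (2 * (C1 + C2)) * I0"
        using C1(1) C2(1) by (simp add: ennreal_mult distrib_right distrib_left mult_ac)
      also have "ennreal ((1 / c) powr t) * (ennreal (2 * (C1 + C2)) * I0) = I0"
      proof -
        have "(1 / c) powr t * (2 * (C1 + C2)) = 1"
          using C1(1) C2(1) c(1) by (simp add: powr_divide c(2) del: distrib_left_numeral)
        then have "ennreal ((1 / c) powr t) * ennreal (2 * (C1 + C2)) = 1"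
          using C1(1) C2(1) by (subst ennreal_mult[symmetric]) auto
        then show ?thesis by (simp only: mult.assoc[symmetric]) simp
      qed
      finally show ?case by (simp add: mult_2)
    qed
    define Gs where "Gs x = (SUP k. G k x)" for x
    have Gsm[measurable]: "Gs \<in> lmeas" unfolding Gs_def[abs_def] by measurable
    have Gsint: "(\<integral>\<^sup>+x. enn_powr (Gs x) t \<partial>lebesgue) \<le> 2 * I0"
    proof -
      have "(\<integral>\<^sup>+x. enn_powr (Gs x) t \<partial>lebesgue) = (\<integral>\<^sup>+x. (SUP k. enn_powr (G k x) t) \<partial>lebesgue)"
        unfolding Gs_def using t by (simp add: enn_powr_SUP)
      also have "\<dots> = (SUP k. \<integral>\<^sup>+x. enn_powr (G k x) t \<partial>lebesgue)"
        using Ginc t by (intro nn_integral_monotone_convergence_SUP) (auto simp: incseq_def le_fun_def intro!: enn_powr_mono)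
      also have "\<dots> \<le> 2 * I0" by (intro SUP_least Gint)
      finally show ?thesis .
    qed
    have "(\<integral>\<^sup>+x. enn_powr (Gs x) t \<partial>lebesgue) \<noteq> \<infinity>"
      using Gsint fin by (auto simp: I0_def top_unique ennreal_mult_eq_top_iff)
    then have "AE x in lebesgue. enn_powr (Gs x) t \<noteq> \<infinity>"
      by (intro nn_integral_noteq_infinite) auto
    then have Gsfin: "AE x in lebesgue. Gs x \<noteq> top" by simp
    have GF0: "ennreal (F0 x) \<le> Gs x" for x
      unfolding Gs_def by (rule SUP_upper2[of 0]) (auto simp: G0)
    \<comment> \<open>\<open>enn2real\<close> sends \<open>top\<close> to 0; the maximum preserves
      \<open>F0 \<le> F\<close> and positivity on the null set where \<open>Gs\<close> is
      infinite.\<close>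
    define F where "F x = max (F0 x) (enn2real (Gs x))" for x
    have Fm[measurable]: "F \<in> lmeas" unfolding F_def by measurable
    have Fpos: "0 < F x" for x using F0pos[of x] by (simp add: F_def less_max_iff_disj)
    have FG: "AE x in lebesgue. ennreal (F x) = Gs x"
      using Gsfin
    proof eventually_elim
      case (elim x)
      then obtain r where "Gs x = ennreal r" "0 \<le> r" by (cases "Gs x") auto
      then show ?case using GF0[of x] F0pos[of x] by (simp add: F_def max_def ennreal_le_iff)
    qed
    have "(\<integral>\<^sup>+x. ennreal (F x powr t) \<partial>lebesgue) = (\<integral>\<^sup>+x. enn_powr (Gs x) t \<partial>lebesgue)"
      using FG Fpos by (intro nn_integral_cong_AE) (auto elim!: eventually_mono simp: less_imp_le enn_powr_ennreal[symmetric] simp del: enn_powr_ennreal)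
    then have Fint: "(\<integral>\<^sup>+x. ennreal (F x powr t) \<partial>lebesgue) \<le> 2 * I0" using Gsint by simp
    have Pstep: "P1 (G k) x \<le> ennreal c * Gs x" "P2 (G k) x \<le> ennreal c * Gs x" for k x
    proof -
      have "ennreal (1 / c) * max (P1 (G k) x) (P2 (G k) x) \<le> G (Suc k) x"
        by (simp add: GSuc step_def)
      also have "\<dots> \<le> Gs x" unfolding Gs_def by (rule SUP_upper) simp
      finally have "ennreal c * (ennreal (1 / c) * max (P1 (G k) x) (P2 (G k) x)) \<le> ennreal c * Gs x"
        by (rule mult_left_mono) simp
      then have "max (P1 (G k) x) (P2 (G k) x) \<le> ennreal c * Gs x"
        using c by (simp add: mult.assoc[symmetric] ennreal_mult[symmetric] del: max.bounded_iff)
      then show "P1 (G k) x \<le> ennreal c * Gs x" "P2 (G k) x \<le> ennreal c * Gs x" by auto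
    qed
    have u2: "a1 (2 ^ CARD('n) * c) (\<lambda>x. F x * \<omega> x powr (- 1 / t))"
    proof (rule a1_of_Mop)
      have eq: "Mop (\<lambda>y. ennreal (F y * \<omega> y powr (- 1 / t))) = Mop (\<lambda>y. Gs y * ennreal (\<omega> y powr (- 1 / t)))"
        using FG Fpos by (intro maxop_cong_AE) (auto elim!: eventually_mono simp: ennreal_mult less_imp_le)
      have "Mop (\<lambda>y. Gs y * ennreal (\<omega> y powr (- 1 / t))) x \<le> ennreal c * Gs x * ennreal (\<omega> x powr (- 1 / t))" for x
      proof -
        have "Mop (\<lambda>y. Gs y * ennreal (\<omega> y powr (- 1 / t))) x = (SUP k. Mop (\<lambda>y. G k y * ennreal (\<omega> y powr (- 1 / t))) x)"
          unfolding Gs_def SUP_mult_right_ennreal[symmetric] using Ginc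
          by (subst maxop_SUP[symmetric]) (auto simp: incseq_def le_fun_def SUP_mult_right_ennreal intro!: mult_right_mono)
        also have "\<dots> \<le> ennreal c * Gs x * ennreal (\<omega> x powr (- 1 / t))"
        proof (rule SUP_least)
          fix k
          have "Mop (\<lambda>y. G k y * ennreal (\<omega> y powr (- 1 / t))) x = P2 (G k) x * ennreal (\<omega> x powr (- 1 / t))"
            using pos[of x] by (simp add: P2_def mult_ac powr_minus ennreal_mult[symmetric])
             (simp add: mult.assoc[symmetric] ennreal_mult[symmetric])
          also have "\<dots> \<le> ennreal c * Gs x * ennreal (\<omega> x powr (- 1 / t))"
            by (intro mult_right_mono Pstep) simp
          finally show "Mop (\<lambda>y. G k y * ennreal (\<omega> y powr (- 1 / t))) x \<le> ennreal c * Gs x * ennreal (\<omega> x powr (- 1 / t))" .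
        qed
        finally show ?thesis .
      qed
      then show "AE x in lebesgue. Mop (\<lambda>y. ennreal (F y * \<omega> y powr (- 1 / t))) x \<le> ennreal (c * (F x * \<omega> x powr (- 1 / t)))"
        unfolding eq using FG Fpos c by (auto elim!: eventually_mono simp: ennreal_mult less_imp_le mult.assoc)
    qed (use Fpos pos c in \<open>auto simp: less_imp_neq[symmetric]\<close>)
    have u1: "a1 (2 ^ CARD('n) * c powr (t - 1)) (\<lambda>x. F x powr (t - 1) * \<omega> x powr (1 / t))"
    proof (rule a1_of_Mop)
      have eq: "Mop (\<lambda>y. ennreal (F y powr (t - 1) * \<omega> y powr (1 / t))) = Mop (\<lambda>y. enn_powr (Gs y) (t - 1) * ennreal (\<omega> y powr (1 / t)))"
        using FG Fpos by (intro maxop_cong_AE) (auto elim!: eventually_mono simp: ennreal_mult less_imp_le enn_powr_ennreal[symmetric] simp del: enn_powr_ennreal)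
      have bound: "Mop (\<lambda>y. enn_powr (Gs y) (t - 1) * ennreal (\<omega> y powr (1 / t))) x \<le> enn_powr (ennreal c * Gs x) (t - 1) * ennreal (\<omega> x powr (1 / t))" for x
      proof -
        have "Mop (\<lambda>y. enn_powr (Gs y) (t - 1) * ennreal (\<omega> y powr (1 / t))) x = Mop (\<lambda>y. SUP k. enn_powr (G k y) (t - 1) * ennreal (\<omega> y powr (1 / t))) x"
          unfolding Gs_def using t by (simp add: SUP_mult_right_ennreal enn_powr_SUP)
        also have "\<dots> = (SUP k. Mop (\<lambda>y. enn_powr (G k y) (t - 1) * ennreal (\<omega> y powr (1 / t))) x)"
          using Ginc t
          by (intro maxop_SUP) (auto simp: incseq_def le_fun_def intro!: mult_right_mono enn_powr_mono)
        also have "\<dots> \<le> enn_powr (ennreal c * Gs x) (t - 1) * ennreal (\<omega> x powr (1 / t))"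
        proof (rule SUP_least)
          fix k
          let ?m = "Mop (\<lambda>y. enn_powr (G k y) (t - 1) * ennreal (\<omega> y powr (1 / t))) x"
          have "enn_powr (P1 (G k) x) (t - 1) = ennreal (\<omega> x powr (- 1 / t)) * ?m"
            using t by (simp add: P1_def enn_powr_powr)
          then have "enn_powr (P1 (G k) x) (t - 1) * ennreal (\<omega> x powr (1 / t)) = ?m * (ennreal (\<omega> x powr (- 1 / t)) * ennreal (\<omega> x powr (1 / t)))"
            by (simp add: mult_ac)
          also have "\<dots> = ?m"
            using pos[of x] by (simp add: ennreal_mult[symmetric] powr_minus)
          finally have "?m = enn_powr (P1 (G k) x) (t - 1) * ennreal (\<omega> x powr (1 / t))" by simp
          also have "\<dots> \<le> enn_powr (ennreal c * Gs x) (t - 1) * ennreal (\<omega> x powr (1 / t))"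
            using t by (intro mult_right_mono enn_powr_mono Pstep) auto
          finally show "?m \<le> enn_powr (ennreal c * Gs x) (t - 1) * ennreal (\<omega> x powr (1 / t))" .
        qed
        finally show ?thesis .
      qed
      have "AE x in lebesgue. enn_powr (ennreal c * Gs x) (t - 1) * ennreal (\<omega> x powr (1 / t)) = ennreal (c powr (t - 1) * (F x powr (t - 1) * \<omega> x powr (1 / t)))"
        using FG
      proof eventually_elim
        case (elim x)
        then show ?case unfolding elim[symmetric] using c Fpos[of x]
          by (simp add: ennreal_mult[symmetric] powr_mult mult.assoc)
      qed
      then show "AE x in lebesgue. Mop (\<lambda>y. ennreal (F y powr (t - 1) * \<omega> y powr (1 / t))) x \<le> ennreal (c powr (t - 1) * (F x powr (t - 1) * \<omega> x powr (1 / t)))"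
        unfolding eq
      proof eventually_elim
        case (elim x) then show ?case using bound[of x] by simp
      qed
    qed (use Fpos pos c in \<open>auto simp: less_imp_neq[symmetric]\<close>)
    have "a1 A (\<lambda>x. F x powr (t - 1) * \<omega> x powr (1 / t))" "a1 A (\<lambda>x. F x * \<omega> x powr (- 1 / t))"
      by (rule a1_mono[OF u1], simp add: A_def) (rule a1_mono[OF u2], simp add: A_def)
    then show ?thesis
      using Fint Fm by (intro exI[where x = F]) (auto simp: I0_def F_def)
  qed
  moreover have "0 < A" using c by (simp add: A_def less_max_iff_disj)
  ultimately show ?thesis by blast
qed

section \<open>Weights in the limited range classes\<close>

lemma mean_wint: "mean Q g = wint g Q / emeasure lebesgue Q"
  by (simp add: mean_def wint_def)

lemma mean_le:
  assumes "Q \<in> cubes" "0 \<le> m" "wint g Q \<le> ennreal (m * vol Q)"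
  shows "mean Q g \<le> ennreal m"
proof -
  have "mean Q g \<le> ennreal (m * vol Q) / ennreal (vol Q)"
    unfolding mean_wint emeasure_cubes[OF assms(1)] by (rule divide_right_mono_ennreal) fact
  also have "\<dots> = ennreal m" using assms cubes_measure_pos[OF assms(1)]
    by (simp add: divide_ennreal del: cubes_measure_pos)
  finally show ?thesis .
qed

lemma mean_ge:
  assumes "Q \<in> cubes" "0 \<le> m" "ennreal (m * vol Q) \<le> wint g Q"
  shows "ennreal m \<le> mean Q g"
proof -
  have "ennreal m = ennreal (m * vol Q) / ennreal (vol Q)"
    using assms cubes_measure_pos[OF assms(1)] by (simp add: divide_ennreal del: cubes_measure_pos)
  also have "\<dots> \<le> mean Q g"
    unfolding mean_wint emeasure_cubes[OF assms(1)] by (rule divide_right_mono_ennreal) fact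
  finally show ?thesis .
qed

lemma mean_eq:
  assumes "Q \<in> cubes" "0 \<le> m" "wint g Q = ennreal (m * vol Q)"
  shows "mean Q g = ennreal m"
  using mean_le[of Q m g] mean_ge[of Q m g] assms by (intro antisym) auto

lemma wint_mean:
  assumes "Q \<in> cubes" shows "wint g Q = mean Q g * ennreal (vol Q)"
  using cubes_measure_pos[OF assms] unfolding mean_wint emeasure_cubes[OF assms]
  by (simp add: ennreal_divide_times divide_ennreal mult_divide_eq_ennreal del: cubes_measure_pos)

lemma mean_mono_AE:
  assumes "AE x in lebesgue. x \<in> Q \<longrightarrow> u x \<le> v x" shows "mean Q u \<le> mean Q v"
  unfolding mean_wint using assms by (intro divide_right_mono_ennreal wint_mono_AE)

lemma mean_cmult:
  assumes [measurable]: "u \<in> lmeas" "Q \<in> sets lebesgue" and "0 \<le> c"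
  shows "mean Q (\<lambda>x. c * u x) = ennreal c * mean Q u"
  unfolding mean_wint using assms by (simp add: wint_cmult ennreal_times_divide)

lemma weight_measurable:
  assumes "weight w" shows "w \<in> borel_measurable (lebesgue :: (real ^ 'n) measure)"
proof -
  have [measurable]: "(\<lambda>x. indicator (cb 0 (real k)) x *\<^sub>R w x) \<in> lmeas" for k
    using assms cb_compact[of 0 "real k"]
    by (auto simp: weight_def set_integrable_def)
  have "(\<lambda>k. indicator (cb 0 (real k)) x *\<^sub>R w x) \<longlonglongrightarrow> w x" for x
  proof (rule tendsto_eventually)
    obtain t where "x \<in> cb 0 t" using subset_cb[of "{x}" 0] by auto
    moreover obtain N where "t \<le> real N" using real_arch_simple by blast
    ultimately have "x \<in> cb 0 (real k)" if "N \<le> k" for k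
      using that cb_mono[of t "real k" 0] by auto
    then show "\<forall>\<^sub>F k in sequentially. indicator (cb 0 (real k)) x *\<^sub>R w x = w x"
      unfolding eventually_sequentially by (intro exI[where x = N]) simp
  qed
  then show ?thesis by (rule borel_measurable_LIMSEQ_metric[rotated]) measurable
qed

lemma weight_wint_finite:
  assumes "weight w" "Q \<in> cubes" shows "wint w Q < top"
proof -
  obtain c t where "Q = cb c t" using assms(2) by (rule cube_cases)
  then have "integrable lebesgue (\<lambda>x. indicator Q x *\<^sub>R w x)"
    using assms(1) cb_compact by (auto simp: weight_def set_integrable_def)
  then have "(\<integral>\<^sup>+x. ennreal (norm (indicator Q x *\<^sub>R w x)) \<partial>lebesgue) < \<infinity>"
    by (simp add: integrable_iff_bounded)
  also have "(\<integral>\<^sup>+x. ennreal (norm (indicator Q x *\<^sub>R w x)) \<partial>lebesgue) = wint w Q"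
    unfolding wint_def using assms(1) by (intro nn_integral_cong) (auto simp: weight_def indicator_def)
  finally show ?thesis by simp
qed

lemma weightI:
  assumes m[measurable]: "w \<in> lmeas" and "\<And>x. 0 \<le> w x" and fin: "\<And>Q. Q \<in> cubes \<Longrightarrow> wint w Q < top"
  shows "weight w"
  unfolding weight_def
proof (intro conjI allI impI)
  fix K :: "(real ^ 'a) set" assume K: "compact K"
  then obtain t where t: "0 < t" "K \<subseteq> cb 0 t" using subset_cb compact_imp_bounded by blast
  have [measurable]: "K \<in> sets lebesgue" using K by (simp add: lmeasurable_compact fmeasurableD)
  have "(\<integral>\<^sup>+x. ennreal (norm (indicator K x *\<^sub>R w x)) \<partial>lebesgue) = wint w K"
    unfolding wint_def using assms(2) by (intro nn_integral_cong) (auto simp: indicator_def)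
  also have "\<dots> \<le> wint w (cb 0 t)" by (rule wint_mono_set) fact
  also have "\<dots> < \<infinity>" using fin[of "cb 0 t"] t by simp
  finally show "set_integrable lebesgue K w"
    unfolding set_integrable_def by (intro integrableI_bounded) auto
qed fact

lemma a1_const_pos: "a1 C (u :: real ^ 'n \<Rightarrow> real) \<Longrightarrow> 0 < C"
proof -
  assume a: "a1 C u"
  have Q: "cb (0 :: real ^ 'n) 1 \<in> cubes" by simp
  then obtain m where m: "0 < m" "AE x in lebesgue. x \<in> cb 0 1 \<longrightarrow> m \<le> C * u x"
    using a unfolding a1_def by blast
  obtain x where "m \<le> C * u x" using cube_AE_witness[OF Q m(2)] by auto
  then have "0 < C * u x" using m by simp
  then show ?thesis using a by (simp add: a1_def zero_less_mult_iff not_less[symmetric])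
     (metis less_asym)
qed

text \<open>The easy half of the Jones factorisation theorem.\<close>

locale a1_pair =
  fixes u1 u2 :: "real ^ 'n \<Rightarrow> real" and C \<alpha> \<beta> :: real
  assumes u1: "a1 C u1" and u2: "a1 C u2" and \<alpha>: "0 \<le> \<alpha>" "\<alpha> \<le> 1" and \<beta>: "0 \<le> \<beta>"
begin

definition W where "W x = u1 x powr \<alpha> * u2 x powr - \<beta>"

lemma u_measurable [measurable]: "u1 \<in> lmeas" "u2 \<in> lmeas"
  and u_pos: "0 < u1 x" "0 < u2 x"
  using u1 u2 by (auto simp: a1_def)

lemma C_pos: "0 < C" using u1 by (rule a1_const_pos)

lemma W_measurable [measurable]: "W \<in> lmeas"
  unfolding W_def[abs_def] by measurable

lemma W_pos: "0 < W x" using u_pos[of x] by (simp add: W_def)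

text \<open>\<open>m1\<close> and \<open>m2\<close> are the averages of \<open>u1\<close> and
  \<open>u2\<close>. The A_1 condition bounds both functions below by these averages divided by
  \<open>C\<close>, which controls negative powers pointwise; positive powers with exponent at most
  1 are controlled by Jensen. Every class condition on \<open>W\<close> is read off from these
  estimates.\<close>

lemma cube_bounds:
  assumes Q: "Q \<in> cubes"
  obtains m1 m2 where "0 < m1" "0 < m2"
    "AE x in lebesgue. x \<in> Q \<longrightarrow> m1 / C \<le> u1 x \<and> m2 / C \<le> u2 x"
    "\<And>s. 0 \<le> s \<Longrightarrow> \<alpha> * s \<le> 1 \<Longrightarrow> wint (\<lambda>x. W x powr s) Q \<le> ennreal ((m1 powr \<alpha> * (m2 / C) powr - \<beta>) powr s * vol Q)"
    "\<And>s. 0 \<le> s \<Longrightarrow> \<beta> * s \<le> 1 \<Longrightarrow> wint (\<lambda>x. W x powr - s) Q \<le> ennreal (((m1 / C) powr - \<alpha> * m2 powr \<beta>) powr s * vol Q)"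
    "ennreal ((m1 / C) powr \<alpha> * m2 powr - \<beta> * vol Q) \<le> wint W Q"
proof -
  have [measurable]: "Q \<in> sets lebesgue" using Q by simp
  obtain m1 where m1: "0 < m1" "wint u1 Q = ennreal (m1 * vol Q)"
    "AE x in lebesgue. x \<in> Q \<longrightarrow> m1 \<le> C * u1 x" using u1 Q unfolding a1_def by blast
  obtain m2 where m2: "0 < m2" "wint u2 Q = ennreal (m2 * vol Q)"
    "AE x in lebesgue. x \<in> Q \<longrightarrow> m2 \<le> C * u2 x" using u2 Q unfolding a1_def by blast
  have lb: "AE x in lebesgue. x \<in> Q \<longrightarrow> m1 / C \<le> u1 x \<and> m2 / C \<le> u2 x"
    using m1(3) m2(3) by eventually_elim (use C_pos in \<open>auto simp: divide_le_eq mult.commute\<close>)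
  have up: "wint (\<lambda>x. W x powr s) Q \<le> ennreal ((m1 powr \<alpha> * (m2 / C) powr - \<beta>) powr s * vol Q)"
    if s: "0 \<le> s" "\<alpha> * s \<le> 1" for s
  proof -
    have "wint (\<lambda>x. W x powr s) Q \<le> wint (\<lambda>x. (m2 / C) powr (- \<beta> * s) * u1 x powr (\<alpha> * s)) Q"
    proof (rule wint_mono_AE, use lb in eventually_elim, intro impI)
      fix x assume x: "x \<in> Q \<longrightarrow> m1 / C \<le> u1 x \<and> m2 / C \<le> u2 x" "x \<in> Q"
      have "W x powr s = u2 x powr (- \<beta> * s) * u1 x powr (\<alpha> * s)"
        by (simp add: W_def powr_mult powr_powr mult.commute)
      also have "\<dots> \<le> (m2 / C) powr (- \<beta> * s) * u1 x powr (\<alpha> * s)"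
        using x m2(1) C_pos \<beta> s by (intro mult_right_mono powr_mono2') auto
      finally show "W x powr s \<le> (m2 / C) powr (- \<beta> * s) * u1 x powr (\<alpha> * s)" .
    qed
    also have "\<dots> = ennreal ((m2 / C) powr (- \<beta> * s)) * wint (\<lambda>x. u1 x powr (\<alpha> * s)) Q"
      by (rule wint_cmult) auto
    also have "\<dots> \<le> ennreal ((m2 / C) powr (- \<beta> * s)) * ennreal (m1 powr (\<alpha> * s) * vol Q)"
      using m1 \<alpha> s u_pos Q by (intro mult_left_mono wint_powr_le) auto
    also have "\<dots> = ennreal ((m1 powr \<alpha> * (m2 / C) powr - \<beta>) powr s * vol Q)"
      by (simp add: ennreal_mult[symmetric] powr_mult powr_powr mult_ac)
    finally show ?thesis .
  qed
  have low: "wint (\<lambda>x. W x powr - s) Q \<le> ennreal (((m1 / C) powr - \<alpha> * m2 powr \<beta>) powr s * vol Q)"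
    if s: "0 \<le> s" "\<beta> * s \<le> 1" for s
  proof -
    have "wint (\<lambda>x. W x powr - s) Q \<le> wint (\<lambda>x. (m1 / C) powr (- \<alpha> * s) * u2 x powr (\<beta> * s)) Q"
    proof (rule wint_mono_AE, use lb in eventually_elim, intro impI)
      fix x assume x: "x \<in> Q \<longrightarrow> m1 / C \<le> u1 x \<and> m2 / C \<le> u2 x" "x \<in> Q"
      have "W x powr - s = u1 x powr (- \<alpha> * s) * u2 x powr (\<beta> * s)"
        by (simp add: W_def powr_mult powr_powr)
      also have "\<dots> \<le> (m1 / C) powr (- \<alpha> * s) * u2 x powr (\<beta> * s)"
        using x m1(1) C_pos \<alpha> s by (intro mult_right_mono powr_mono2') auto
      finally show "W x powr - s \<le> (m1 / C) powr (- \<alpha> * s) * u2 x powr (\<beta> * s)" .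
    qed
    also have "\<dots> = ennreal ((m1 / C) powr (- \<alpha> * s)) * wint (\<lambda>x. u2 x powr (\<beta> * s)) Q"
      by (rule wint_cmult) auto
    also have "\<dots> \<le> ennreal ((m1 / C) powr (- \<alpha> * s)) * ennreal (m2 powr (\<beta> * s) * vol Q)"
      using m2 \<beta> s u_pos Q by (intro mult_left_mono wint_powr_le) auto
    also have "\<dots> = ennreal (((m1 / C) powr - \<alpha> * m2 powr \<beta>) powr s * vol Q)"
      by (simp add: ennreal_mult[symmetric] powr_mult powr_powr mult_ac)
    finally show ?thesis .
  qed
  have ge: "ennreal ((m1 / C) powr \<alpha> * m2 powr - \<beta> * vol Q) \<le> wint W Q"
  proof -
    have "ennreal ((m1 / C) powr \<alpha> * m2 powr - \<beta> * vol Q) = ennreal ((m1 / C) powr \<alpha>) * ennreal (m2 powr - \<beta> * vol Q)"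
      by (simp add: ennreal_mult[symmetric] mult.assoc)
    also have "\<dots> \<le> ennreal ((m1 / C) powr \<alpha>) * wint (\<lambda>x. u2 x powr - \<beta>) Q"
      using m2 \<beta> u_pos Q by (intro mult_left_mono wint_powr_ge) auto
    also have "\<dots> = wint (\<lambda>x. (m1 / C) powr \<alpha> * u2 x powr - \<beta>) Q"
      by (rule wint_cmult[symmetric]) auto
    also have "\<dots> \<le> wint W Q"
    proof (rule wint_mono_AE, use lb in eventually_elim, intro impI)
      fix x assume x: "x \<in> Q \<longrightarrow> m1 / C \<le> u1 x \<and> m2 / C \<le> u2 x" "x \<in> Q"
      then show "(m1 / C) powr \<alpha> * u2 x powr - \<beta> \<le> W x"
        unfolding W_def using m1(1) C_pos \<alpha> by (intro mult_right_mono powr_mono2) auto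
    qed
    finally show ?thesis .
  qed
  show thesis by (rule that[OF m1(1) m2(1) lb up low ge])
qed

lemma W_weight: "weight W"
proof (rule weightI)
  fix Q :: "(real ^ 'n) set" assume "Q \<in> cubes"
  then obtain m1 m2 where "\<And>s. 0 \<le> s \<Longrightarrow> \<alpha> * s \<le> 1 \<Longrightarrow> wint (\<lambda>x. W x powr s) Q \<le> ennreal ((m1 powr \<alpha> * (m2 / C) powr - \<beta>) powr s * vol Q)"
    by (rule cube_bounds) blast
  from this[of 1] have "wint W Q \<le> ennreal ((m1 powr \<alpha> * (m2 / C) powr - \<beta>) powr 1 * vol Q)"
    using \<alpha> W_pos by (simp add: less_imp_le)
  then show "wint W Q < top" using ennreal_less_top le_less_trans by blast
qed (auto intro: less_imp_le W_pos)

text \<open>In the product of the bounds for \<open>W\<close> and for its dual power,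
  \<open>m1\<close> and \<open>m2\<close> cancel and only \<open>C\<close> survives. The condition
  \<open>\<beta> \<le> t - 1\<close> is what Jensen needs for
  \<open>u2 powr (\<beta> / (t - 1))\<close>; for \<open>t = 1\<close> it forces
  \<open>\<beta> = 0\<close>, and the pointwise lower bound of \<open>u1\<close> suffices.\<close>

lemma W_muckenhoupt_const:
  assumes t: "1 \<le> t" "\<beta> \<le> t - 1"
  shows "muckenhoupt_const t W \<le> ennreal (C powr (\<alpha> + \<beta>))"
proof (cases "t = 1")
  case True
  then have [simp]: "\<beta> = 0" using t \<beta> by simp
  have "AE x in lebesgue. x \<in> Q \<longrightarrow> mean Q W \<le> ennreal (C powr \<alpha>) * ennreal (W x)" if Q: "Q \<in> cubes" for Q
  proof -
    obtain m1 m2 where m: "0 < m1" "AE x in lebesgue. x \<in> Q \<longrightarrow> m1 / C \<le> u1 x \<and> m2 / C \<le> u2 x"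
      "\<And>s. 0 \<le> s \<Longrightarrow> \<alpha> * s \<le> 1 \<Longrightarrow> wint (\<lambda>x. W x powr s) Q \<le> ennreal ((m1 powr \<alpha> * (m2 / C) powr - \<beta>) powr s * vol Q)"
      "0 < m2"
      using Q by (rule cube_bounds) blast
    have "wint W Q \<le> ennreal (m1 powr \<alpha> * vol Q)"
      using m(3)[of 1] \<alpha> W_pos m C_pos by (simp add: less_imp_le)
    then have mean: "mean Q W \<le> ennreal (m1 powr \<alpha>)" using Q by (intro mean_le) auto
    show ?thesis using m(2)
    proof eventually_elim
      case (elim x)
      show ?case
      proof
        assume "x \<in> Q"
        then have "m1 powr \<alpha> \<le> (C * u1 x) powr \<alpha>"
          using elim C_pos \<alpha> m by (intro powr_mono2) (auto simp: divide_le_eq mult.commute)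
        also have "\<dots> = C powr \<alpha> * W x" unfolding W_def using u_pos[of x] by (simp add: powr_mult)
        finally have "ennreal (m1 powr \<alpha>) \<le> ennreal (C powr \<alpha>) * ennreal (W x)"
          by (simp add: ennreal_mult'[symmetric] ennreal_leI)
        then show "mean Q W \<le> ennreal (C powr \<alpha>) * ennreal (W x)" using mean by (rule order_trans[rotated])
      qed
    qed
  qed
  then show ?thesis unfolding muckenhoupt_const_def using True by (auto intro!: Inf_lower)
next
  case False
  then have t1: "1 < t" using t by simp
  have "mean Q W * enn_powr (mean Q (\<lambda>x. W x powr (1 - t / (t - 1)))) (t - 1) \<le> ennreal (C powr (\<alpha> + \<beta>))"
    if Q: "Q \<in> cubes" for Q
  proof -
    obtain m1 m2 where m: "0 < m1" "0 < m2"
      "\<And>s. 0 \<le> s \<Longrightarrow> \<alpha> * s \<le> 1 \<Longrightarrow> wint (\<lambda>x. W x powr s) Q \<le> ennreal ((m1 powr \<alpha> * (m2 / C) powr - \<beta>) powr s * vol Q)"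
      "\<And>s. 0 \<le> s \<Longrightarrow> \<beta> * s \<le> 1 \<Longrightarrow> wint (\<lambda>x. W x powr - s) Q \<le> ennreal (((m1 / C) powr - \<alpha> * m2 powr \<beta>) powr s * vol Q)"
      using Q by (rule cube_bounds) blast
    have "wint W Q \<le> ennreal ((m1 powr \<alpha> * (m2 / C) powr - \<beta>) * vol Q)"
      using m(3)[of 1] \<alpha> W_pos m C_pos by (simp add: less_imp_le)
    then have 1: "mean Q W \<le> ennreal (m1 powr \<alpha> * (m2 / C) powr - \<beta>)" using Q by (intro mean_le) auto
    have e: "1 - t / (t - 1) = - (1 / (t - 1))" using t1 by (simp add: divide_simps)
    have 2: "mean Q (\<lambda>x. W x powr (1 - t / (t - 1))) \<le> ennreal (((m1 / C) powr - \<alpha> * m2 powr \<beta>) powr (1 / (t - 1)))"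
      unfolding e using Q t t1 by (intro mean_le m(4)) (auto simp: field_simps)
    have "mean Q W * enn_powr (mean Q (\<lambda>x. W x powr (1 - t / (t - 1)))) (t - 1)
      \<le> ennreal (m1 powr \<alpha> * (m2 / C) powr - \<beta>) * enn_powr (ennreal (((m1 / C) powr - \<alpha> * m2 powr \<beta>) powr (1 / (t - 1)))) (t - 1)"
      using t1 by (intro mult_mono 1 enn_powr_mono 2) auto
    also have "\<dots> = ennreal (m1 powr \<alpha> * (m2 / C) powr - \<beta> * ((m1 / C) powr - \<alpha> * m2 powr \<beta>))"
      using t1 by (simp add: powr_powr ennreal_mult[symmetric])
    also have "m1 powr \<alpha> * (m2 / C) powr - \<beta> * ((m1 / C) powr - \<alpha> * m2 powr \<beta>) = C powr (\<alpha> + \<beta>)"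
      using m C_pos by (simp add: powr_divide powr_minus powr_add field_simps)
    finally show ?thesis .
  qed
  then show ?thesis unfolding muckenhoupt_const_def using False by (auto intro!: SUP_least)
qed

lemma W_muckenhoupt: "1 \<le> t \<Longrightarrow> \<beta> \<le> t - 1 \<Longrightarrow> W \<in> muckenhoupt t"
  unfolding muckenhoupt_def using W_weight W_pos W_muckenhoupt_const[of t] ennreal_less_top le_less_trans by blast

text \<open>\<open>1 / \<alpha>\<close> is the largest exponent for which \<open>W powr s\<close>
  involves \<open>u1\<close> to a power at most 1. The resulting upper bound and the lower bound for
  the mean of \<open>W\<close> differ by \<open>C powr (\<alpha> + \<beta>)\<close>. For
  \<open>\<alpha> = 0\<close> only a nonpositive power of \<open>u2\<close> is left, which is
  bounded pointwise; this is the exponent infinity.\<close>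

lemma W_reverse_Holder:
  assumes "\<sigma> = (if \<alpha> = 0 then \<infinity> else ereal (1 / \<alpha>))"
  shows "W \<in> reverse_Holder \<sigma>"
  unfolding reverse_Holder_def
proof (intro CollectI conjI W_weight exI ballI)
  fix Q :: "(real ^ 'n) set" assume Q: "Q \<in> cubes"
  then have [measurable]: "Q \<in> sets lebesgue" by simp
  obtain m1 m2 where m: "0 < m1" "0 < m2" "AE x in lebesgue. x \<in> Q \<longrightarrow> m1 / C \<le> u1 x \<and> m2 / C \<le> u2 x"
      "\<And>s. 0 \<le> s \<Longrightarrow> \<alpha> * s \<le> 1 \<Longrightarrow> wint (\<lambda>x. W x powr s) Q \<le> ennreal ((m1 powr \<alpha> * (m2 / C) powr - \<beta>) powr s * vol Q)"
      "ennreal ((m1 / C) powr \<alpha> * m2 powr - \<beta> * vol Q) \<le> wint W Q"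
    using Q by (rule cube_bounds) blast
  have "m1 powr \<alpha> * (m2 / C) powr - \<beta> = C powr (\<alpha> + \<beta>) * ((m1 / C) powr \<alpha> * m2 powr - \<beta>)"
    using m C_pos by (simp add: powr_divide powr_minus powr_add field_simps)
  then have "ennreal (m1 powr \<alpha> * (m2 / C) powr - \<beta>) = ennreal (C powr (\<alpha> + \<beta>)) * ennreal ((m1 / C) powr \<alpha> * m2 powr - \<beta>)"
    by (simp add: ennreal_mult[symmetric])
  also have "\<dots> \<le> ennreal (C powr (\<alpha> + \<beta>)) * mean Q W"
    using Q m by (intro mult_left_mono mean_ge) auto
  finally have le: "ennreal (m1 powr \<alpha> * (m2 / C) powr - \<beta>) \<le> ennreal (C powr (\<alpha> + \<beta>)) * mean Q W" .
  show "(if \<sigma> = \<infinity> then esssup (lebesgue_on Q) (\<lambda>x. ennreal (W x))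
      else enn_powr (mean Q (\<lambda>x. W x powr real_of_ereal \<sigma>)) (1 / real_of_ereal \<sigma>))
     \<le> ennreal (C powr (\<alpha> + \<beta>)) * mean Q W"
  proof (cases "\<alpha> = 0")
    case True
    have "AE x in lebesgue_on Q. ennreal (W x) \<le> ennreal (m1 powr \<alpha> * (m2 / C) powr - \<beta>)"
      unfolding AE_restrict_space_iff[of Q lebesgue, simplified] using m(3)
    proof eventually_elim
      case (elim x)
      then show ?case unfolding W_def using True m(1,2) C_pos \<beta> u_pos[of x]
        by (auto intro!: ennreal_leI powr_mono2')
    qed
    then have "esssup (lebesgue_on Q) (\<lambda>x. ennreal (W x)) \<le> ennreal (m1 powr \<alpha> * (m2 / C) powr - \<beta>)"
      by (intro esssup_I measurable_restrict_space1) auto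
    then show ?thesis using True assms le by simp
  next
    case False
    then have a: "0 < \<alpha>" using \<alpha> by simp
    have "mean Q (\<lambda>x. W x powr (1 / \<alpha>)) \<le> ennreal ((m1 powr \<alpha> * (m2 / C) powr - \<beta>) powr (1 / \<alpha>))"
      using a Q by (intro mean_le m(4)) auto
    then have "enn_powr (mean Q (\<lambda>x. W x powr (1 / \<alpha>))) \<alpha> \<le> enn_powr (ennreal ((m1 powr \<alpha> * (m2 / C) powr - \<beta>) powr (1 / \<alpha>))) \<alpha>"
      using a by (intro enn_powr_mono) auto
    also have "\<dots> = ennreal (m1 powr \<alpha> * (m2 / C) powr - \<beta>)"
      using a by (simp add: powr_powr)
    finally show ?thesis using False assms le by simp
  qed
qed

end

section \<open>Exponents of the limited range class\<close>

lemma conj_exp_real: "1 < x \<Longrightarrow> conj_exp (ereal x) = ereal (x / (x - 1))"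
  by (simp add: conj_exp_def one_ereal_def)

lemma conj_exp_ratio:
  assumes "0 < p" "p \<le> pp"
  shows "conj_exp (ereal (pp / p)) = (if 1 - p / pp = 0 then \<infinity> else ereal (1 / (1 - p / pp)))"
proof (cases "p = pp")
  case True then show ?thesis using assms by (simp add: conj_exp_def one_ereal_def)
next
  case False
  then have "1 < pp / p" using assms by simp
  moreover have "pp / p / (pp / p - 1) = 1 / (1 - p / pp)" using assms False by (simp add: field_simps)
  ultimately show ?thesis using assms False by (simp add: conj_exp_real)
qed

text \<open>For \<open>\<alpha> = 1 - p0 / pp\<close> the exponent \<open>1 / \<alpha>\<close> is
  the conjugate of \<open>pp / p0\<close>, and \<open>\<beta> = p0 / pm - 1\<close> fits the class
  A_(p0/pm). Since also \<open>\<beta> \<le> p0 - 1\<close>, the A_(p0) constant, on which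
  \<open>c1\<close> depends, is bounded in terms of \<open>C\<close>.\<close>

lemma limited_weights_factored:
  assumes "a1 C u1" "a1 C u2" "1 \<le> pm" "pm \<le> p0" "p0 \<le> pp"
  defines "w \<equiv> \<lambda>x. u1 x powr (1 - p0 / pp) * u2 x powr - (p0 / pm - 1)"
  shows "w \<in> limited_weights pm pp p0"
    and "muckenhoupt_const p0 w \<le> ennreal (C powr ((1 - p0 / pp) + (p0 / pm - 1)))"
    and "w \<in> lmeas" "\<And>x. 0 < w x"
proof -
  have "p0 / pp \<le> 1" "0 \<le> p0 / pp" "1 \<le> p0 / pm" using assms by (auto simp: field_simps)
  then interpret a1_pair u1 u2 C "1 - p0 / pp" "p0 / pm - 1"
    using assms by unfold_locales auto
  have w: "w = W" by (simp add: w_def W_def fun_eq_iff)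
  have "p0 / pm - 1 \<le> p0 - 1" using assms by (simp add: field_simps mult_left_mono)
  then show "muckenhoupt_const p0 w \<le> ennreal (C powr ((1 - p0 / pp) + (p0 / pm - 1)))"
    unfolding w using assms by (intro W_muckenhoupt_const) auto
  show "w \<in> limited_weights pm pp p0"
    unfolding limited_weights_def w using assms \<open>1 \<le> p0 / pm\<close>
    by (intro IntI W_muckenhoupt W_reverse_Holder conj_exp_ratio) auto
  show "w \<in> lmeas" "\<And>x. 0 < w x" unfolding w by (auto intro: W_pos)
qed

section \<open>Adjusting the Muckenhoupt constant of a weight\<close>

text \<open>The factor \<open>b\<close> comes from the mean of \<open>w'\<close>, the factor
  \<open>1 / a\<close> from the mean of its dual power, or for \<open>p = 1\<close> from the
  pointwise side of the condition.\<close>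

lemma muckenhoupt_const_comparable:
  fixes w w' :: "real ^ 'n \<Rightarrow> real"
  assumes [measurable]: "w \<in> lmeas" "w' \<in> lmeas"
    and pos: "\<And>x. 0 < w x" and ab: "0 < a" "0 < b" "\<And>x. a * w x \<le> w' x" "\<And>x. w' x \<le> b * w x" and p: "1 \<le> p"
  shows "muckenhoupt_const p w' \<le> ennreal (b / a) * muckenhoupt_const p w"
proof -
  have mean: "mean Q w' \<le> ennreal b * mean Q w" if "Q \<in> cubes" for Q
  proof -
    have "mean Q w' \<le> mean Q (\<lambda>x. b * w x)" using ab by (intro mean_mono_AE) auto
    also have "\<dots> = ennreal b * mean Q w" using ab that by (intro mean_cmult) auto
    finally show ?thesis .
  qed
  show ?thesis
  proof (cases "p = 1")
    case True
    let ?S = "\<lambda>w. {c. \<forall>Q\<in>cubes. AE x in lebesgue. x \<in> Q \<longrightarrow> mean Q w \<le> c * ennreal (w x)}"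
    have "ennreal (a / b) * Inf (?S w') \<le> Inf (?S w)"
    proof (rule Inf_greatest)
      fix c assume c: "c \<in> ?S w"
      have "ennreal (b / a) * c \<in> ?S w'"
      proof (intro CollectI ballI)
        fix Q :: "(real ^ 'n) set" assume Q: "Q \<in> cubes"
        have "AE x in lebesgue. x \<in> Q \<longrightarrow> mean Q w \<le> c * ennreal (w x)" using c Q by blast
        then show "AE x in lebesgue. x \<in> Q \<longrightarrow> mean Q w' \<le> ennreal (b / a) * c * ennreal (w' x)"
        proof eventually_elim
          case (elim x)
          show ?case
          proof
            assume "x \<in> Q"
            have "mean Q w' \<le> ennreal b * (c * ennreal (w x))"
              using order_trans[OF mean[OF Q] mult_left_mono] elim \<open>x \<in> Q\<close> by simp
            also have "\<dots> = ennreal (b / a) * c * ennreal (a * w x)"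
            proof -
              have "ennreal b = ennreal (b / a) * ennreal a" using ab by (simp add: ennreal_mult[symmetric])
              then show ?thesis using ab by (simp add: ennreal_mult' mult_ac)
            qed
            also have "\<dots> \<le> ennreal (b / a) * c * ennreal (w' x)"
              using ab by (intro mult_left_mono ennreal_leI) auto
            finally show "mean Q w' \<le> ennreal (b / a) * c * ennreal (w' x)" .
          qed
        qed
      qed
      then have "ennreal (a / b) * Inf (?S w') \<le> ennreal (a / b) * (ennreal (b / a) * c)"
        by (intro mult_left_mono Inf_lower) auto
      also have "\<dots> = c" using ab by (simp add: mult.assoc[symmetric] ennreal_mult[symmetric])
      finally show "ennreal (a / b) * Inf (?S w') \<le> c" .
    qed
    then have "ennreal (b / a) * (ennreal (a / b) * Inf (?S w')) \<le> ennreal (b / a) * Inf (?S w)"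
      by (rule mult_left_mono) simp
    then show ?thesis
      using ab True by (simp add: muckenhoupt_const_def mult.assoc[symmetric] ennreal_mult[symmetric])
  next
    case False
    then have p1: "1 < p" using p by simp
    define e where "e = - (1 / (p - 1))"
    have e: "1 - p / (p - 1) = e" "e < 0" "e * (p - 1) = - 1" using p1 by (simp_all add: e_def divide_simps)
    have "mean Q w' * enn_powr (mean Q (\<lambda>x. w' x powr e)) (p - 1) \<le> ennreal (b / a) * muckenhoupt_const p w"
      if Q: "Q \<in> cubes" for Q
    proof -
      have "mean Q (\<lambda>x. w' x powr e) \<le> mean Q (\<lambda>x. a powr e * w x powr e)"
      proof (intro mean_mono_AE AE_I2 impI)
        fix x
        have "w' x powr e \<le> (a * w x) powr e" using ab pos[of x] e by (intro powr_mono2') auto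
        then show "w' x powr e \<le> a powr e * w x powr e" by (simp add: powr_mult)
      qed
      also have "\<dots> = ennreal (a powr e) * mean Q (\<lambda>x. w x powr e)" using Q by (intro mean_cmult) auto
      finally have "mean Q w' * enn_powr (mean Q (\<lambda>x. w' x powr e)) (p - 1)
         \<le> (ennreal b * mean Q w) * enn_powr (ennreal (a powr e) * mean Q (\<lambda>x. w x powr e)) (p - 1)"
        using p1 Q by (intro mult_mono mean enn_powr_mono) auto
      also have "\<dots> = ennreal (b / a) * (mean Q w * enn_powr (mean Q (\<lambda>x. w x powr e)) (p - 1))"
      proof -
        have "(a powr e) powr (p - 1) = 1 / a"
          using ab(1) by (simp only: powr_powr e(3)) (simp add: powr_minus_divide)
        then have "ennreal b * ennreal ((a powr e) powr (p - 1)) = ennreal (b / a)"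
          using ab by (simp add: ennreal_mult[symmetric])
        moreover have "ennreal b * mean Q w * enn_powr (ennreal (a powr e) * mean Q (\<lambda>x. w x powr e)) (p - 1)
          = (ennreal b * ennreal ((a powr e) powr (p - 1))) * (mean Q w * enn_powr (mean Q (\<lambda>x. w x powr e)) (p - 1))"
          by (simp add: enn_powr_mult mult_ac)
        ultimately show ?thesis by simp
      qed
      also have "\<dots> \<le> ennreal (b / a) * muckenhoupt_const p w"
        unfolding muckenhoupt_const_def using False Q e by (auto intro!: mult_left_mono SUP_upper)
      finally show ?thesis .
    qed
    then show ?thesis
      unfolding muckenhoupt_const_def[of p w'] using False e by (auto intro!: SUP_least)
  qed
qed

text \<open>The strict inequality supplies an admissible constant below \<open>K\<close>, so
  attainment of the infimum never has to be discussed.\<close>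

lemma a1_of_muckenhoupt_const:
  assumes w: "weight w" "\<And>x. 0 < w x" and K: "muckenhoupt_const 1 w < ennreal K"
  shows "a1 K w"
  unfolding a1_def
proof (intro conjI allI ballI weight_measurable w)
  fix Q :: "(real ^ 'a) set" assume Q: "Q \<in> cubes"
  have mQ: "0 < vol Q" using Q by simp
  obtain b where b: "wint w Q = ennreal b" "0 < b"
    using wint_pos[OF weight_measurable[OF w(1)] w(2) Q] weight_wint_finite[OF w(1) Q] by (cases "wint w Q") auto
  define m where "m = b / vol Q"
  have m: "0 < m" "wint w Q = ennreal (m * vol Q)" using b mQ by (auto simp: m_def)
  from K obtain c where c: "c < ennreal K" "AE x in lebesgue. x \<in> Q \<longrightarrow> mean Q w \<le> c * ennreal (w x)"
    unfolding muckenhoupt_const_def using Q by (auto simp: Inf_less_iff)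
  have "AE x in lebesgue. x \<in> Q \<longrightarrow> m \<le> K * w x"
    using c(2)
  proof eventually_elim
    case (elim x)
    show ?case
    proof
      assume "x \<in> Q"
      then have "ennreal m \<le> c * ennreal (w x)" using elim mean_eq[OF Q _ m(2)] m(1) by simp
      also have "\<dots> \<le> ennreal K * ennreal (w x)" using c(1) by (intro mult_right_mono) auto
      also have "\<dots> = ennreal (K * w x)" using w(2)[of x] by (simp add: ennreal_mult'')
      finally have "ennreal m \<le> ennreal (K * w x)" .
      then show "m \<le> K * w x" using m(1) by (metis ennreal_le_iff2 not_le order.strict_iff_order order_trans)
    qed
  qed
  then show "\<exists>m>0. wint w Q = ennreal (m * vol Q) \<and> (AE x in lebesgue. x \<in> Q \<longrightarrow> m \<le> K * w x)"
    using m by blast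
qed

lemma ap_of_muckenhoupt_const:
  assumes w: "weight w" "\<And>x. 0 < w x" and p: "1 < p" and K: "muckenhoupt_const p w \<le> ennreal K" "0 < K"
  shows "ap p K w"
  unfolding ap_def
proof (intro conjI allI ballI weight_measurable w)
  fix Q :: "(real ^ 'a) set" assume Q: "Q \<in> cubes"
  have mQ: "0 < vol Q" using Q by simp
  have [measurable]: "w \<in> lmeas" by (rule weight_measurable) fact
  let ?v = "\<lambda>x. w x powr (- 1 / (p - 1))"
  obtain b where b: "wint w Q = ennreal b" "0 < b"
    using wint_pos[OF weight_measurable[OF w(1)] w(2) Q] weight_wint_finite[OF w(1) Q] by (cases "wint w Q") auto
  define m where "m = b / vol Q"
  have m: "0 < m" "wint w Q = ennreal (m * vol Q)" using b mQ by (auto simp: m_def)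
  have mean: "mean Q w = ennreal m" using Q m by (intro mean_eq) auto
  have e: "1 - p / (p - 1) = - 1 / (p - 1)" using p by (simp add: divide_simps)
  have "mean Q w * enn_powr (mean Q ?v) (p - 1) \<le> ennreal K"
  proof -
    have "mean Q w * enn_powr (mean Q ?v) (p - 1) \<le> muckenhoupt_const p w"
      unfolding muckenhoupt_const_def using p Q e by (auto intro!: SUP_upper2[OF Q])
    with K show ?thesis by simp
  qed
  then have le: "ennreal m * enn_powr (mean Q ?v) (p - 1) \<le> ennreal K" by (simp add: mean)
  then have "mean Q ?v \<noteq> top" using m(1) by (auto simp: ennreal_mult_top top_unique)
  moreover have vpos: "0 < wint ?v Q"
    using w(2) Q by (intro wint_pos) (auto simp: less_imp_neq[symmetric])
  ultimately obtain d where d: "mean Q ?v = ennreal d" "0 \<le> d" by (cases "mean Q ?v") auto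
  then have d': "wint ?v Q = ennreal (d * vol Q)"
    using wint_mean[OF Q, of ?v] by (simp add: ennreal_mult)
  then have "0 < d" using vpos d(2) by (cases "d = 0") auto
  moreover have "m * d powr (p - 1) \<le> K"
    using le d m K(2) by (simp add: ennreal_mult[symmetric] ennreal_le_iff)
  ultimately show "\<exists>a b. 0 < a \<and> 0 < b \<and> wint w Q = ennreal (a * vol Q) \<and>
       wint ?v Q = ennreal (b * vol Q) \<and> a * b powr (p - 1) \<le> K"
    using m d' by blast
qed

text \<open>The theory of \<open>ap\<close> is developed for exponents above 1, so A_1 weights enter
  it through A_2: the pointwise lower bound of \<open>w\<close> is an upper bound of its
  reciprocal.\<close>

lemma ap_2_of_a1:
  assumes a: "a1 K w" shows "ap 2 K w"
  unfolding ap_def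
proof (intro conjI allI ballI)
  have w[measurable]: "w \<in> lmeas" and pos: "\<And>x. 0 < w x" using a by (auto simp: a1_def)
  have K: "0 < K" using a by (rule a1_const_pos)
  fix Q :: "(real ^ 'a) set" assume Q: "Q \<in> cubes"
  then obtain m where m: "0 < m" "wint w Q = ennreal (m * vol Q)"
    "AE x in lebesgue. x \<in> Q \<longrightarrow> m \<le> K * w x" using a unfolding a1_def by blast
  let ?v = "\<lambda>x. w x powr (- 1 / (2 - 1))"
  have "wint ?v Q \<le> wint (\<lambda>x. K / m) Q"
  proof (rule wint_mono_AE, use m(3) in eventually_elim, intro impI)
    fix x assume "x \<in> Q \<longrightarrow> m \<le> K * w x" "x \<in> Q"
    then show "?v x \<le> K / m" using pos[of x] m(1) by (simp add: powr_minus field_simps)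
  qed
  also have "\<dots> = ennreal (K / m * vol Q)" using Q K m by (intro wint_const) auto
  finally have le: "wint ?v Q \<le> ennreal (K / m * vol Q)" .
  moreover have "0 < wint ?v Q" using pos Q by (intro wint_pos) (auto simp: less_imp_neq[symmetric])
  ultimately obtain b where b: "wint ?v Q = ennreal b" "0 < b"
    by (cases "wint ?v Q") (auto simp: top_unique)
  define d where "d = b / vol Q"
  have mQ: "0 < vol Q" using Q by simp
  have d: "0 < d" "wint ?v Q = ennreal (d * vol Q)" using b mQ by (auto simp: d_def)
  have "d * vol Q \<le> K / m * vol Q"
    using le d K m by (subst (asm) d(2)) (simp add: ennreal_le_iff)
  then have "d \<le> K / m" using mQ by (rule mult_right_le_imp_le)
  then have "m * d powr (2 - 1) \<le> K" using m d by (simp add: field_simps)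
  then show "\<exists>a b. 0 < a \<and> 0 < b \<and> wint w Q = ennreal (a * vol Q) \<and>
       wint ?v Q = ennreal (b * vol Q) \<and> a * b powr (2 - 1) \<le> K"
    using m d by blast
qed (use a in \<open>auto simp: a1_def\<close>)

lemma muckenhoupt_const_ap:
  assumes w: "weight w" "\<And>x. 0 < w x" and p: "1 \<le> p" and K: "muckenhoupt_const p w \<le> ennreal K" "0 < K"
  shows "ap (if p = 1 then 2 else p) (K + 1) w"
proof (cases "p = 1")
  case True
  have "ennreal K < ennreal (K + 1)" using K(2) by (simp add: ennreal_less_iff)
  then have "muckenhoupt_const 1 w < ennreal (K + 1)" using K(1) True le_less_trans by blast
  then have "a1 (K + 1) w" by (intro a1_of_muckenhoupt_const w)
  then show ?thesis using True ap_2_of_a1 by simp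
next
  case False
  have "ennreal K \<le> ennreal (K + 1)" using K(2) by (simp add: ennreal_leI)
  then have "muckenhoupt_const p w \<le> ennreal (K + 1)" using K(1) by (rule order_trans[rotated])
  then have "ap p (K + 1) w" using False p K(2) by (intro ap_of_muckenhoupt_const w) auto
  then show ?thesis using False by simp
qed

text \<open>Multiplying a weight by a large constant on one of the two sets \<open>E\<close>, \<open>- E\<close> makes its
  Muckenhoupt constant large, as both carry a fixed portion of the mass of a cube.\<close>

lemma muckenhoupt_const_jump:
  fixes p K :: real
  assumes p: "1 \<le> p" and K: "0 < K"
  shows "\<exists>L\<ge>1. \<forall>w :: real ^ 'n \<Rightarrow> real. weight w \<longrightarrow> (\<forall>x. 0 < w x) \<longrightarrow> muckenhoupt_const p w \<le> ennreal K \<longrightarrow>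
    (\<exists>E\<in>sets lebesgue. ennreal K \<le> muckenhoupt_const p (\<lambda>x. if x \<in> E then L * w x else w x))"
proof -
  define q where "q = (if p = 1 then 2 else p)"
  have q: "1 < q" using p by (auto simp: q_def)
  \<comment> \<open>\<open>E1\<close> and \<open>E2\<close> are disjoint subcubes with a quarter of
    the side of \<open>Q0\<close>. By doubling each carries at least the fraction
    \<open>1 / D\<close> of the mass of \<open>w\<close> on \<open>Q0\<close>, hence so do
    \<open>E1\<close> and its complement.\<close>
  define Q0 :: "(real ^ 'n) set" where "Q0 = cb 0 1"
  define E1 :: "(real ^ 'n) set" where "E1 = cb (vec (- 1 / 2)) (1 / 4)"
  define E2 :: "(real ^ 'n) set" where "E2 = cb (vec (1 / 2)) (1 / 4)"
  have cub: "Q0 \<in> cubes" "E1 \<in> cubes" "E2 \<in> cubes" by (auto simp: Q0_def E1_def E2_def)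
  have m0: "0 < vol Q0" using cub by simp
  have [measurable]: "Q0 \<in> sets lebesgue" "E1 \<in> sets lebesgue" "E2 \<in> sets lebesgue" using cub by auto
  have [measurable]: "- E1 \<in> sets lebesgue"
    using sets.compl_sets[of E1 lebesgue] by (simp add: Compl_eq_Diff_UNIV)
  have sub: "E1 \<subseteq> Q0" "E2 \<subseteq> Q0"
    unfolding Q0_def E1_def E2_def by (rule cb_subset_cb[where r = "1 / 2"]; simp)+
  have disj: "E1 \<inter> E2 = {}"
  proof (intro equals0I)
    fix x assume "x \<in> E1 \<inter> E2"
    then have "\<bar>x $ undefined - (- 1 / 2)\<bar> \<le> 1 / 4" "\<bar>x $ undefined - 1 / 2\<bar> \<le> 1 / 4"
      unfolding E1_def E2_def cb_def by auto
    then show False by linarith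
  qed
  have ratio: "vol Q0 / vol E1 = 4 ^ CARD('n)" "vol Q0 / vol E2 = 4 ^ CARD('n)"
    by (simp_all add: Q0_def E1_def E2_def measure_cb power_divide[symmetric])
  define D where "D = (K + 1) * (4 ^ CARD('n)) powr q"
  have D: "0 < D" using K by (simp add: D_def)
  \<comment> \<open>The jumped weight has mean at least \<open>L * m / D\<close>, and for
    \<open>p > 1\<close> its dual mean can be kept above \<open>d / 2\<close>, where
    \<open>1 \<le> m * d powr (p - 1)\<close>. So \<open>L \<ge> K * D * 2 powr (p - 1)\<close>
    suffices; the additional 2 yields the strict inequality needed for \<open>p = 1\<close>.\<close>
  define L where "L = max 1 (2 * K * 2 powr (p - 1) * D)"
  have "\<exists>E\<in>sets lebesgue. ennreal K \<le> muckenhoupt_const p (\<lambda>x. if x \<in> E then L * w x else w x)"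
    if w: "weight w" "\<And>x. 0 < w x" and wK: "muckenhoupt_const p w \<le> ennreal K" for w :: "real ^ 'n \<Rightarrow> real"
  proof -
    have wm[measurable]: "w \<in> lmeas" by (rule weight_measurable) fact
    have ap: "ap q (K + 1) w" unfolding q_def by (intro muckenhoupt_const_ap w p wK K)
    obtain b where b: "wint w Q0 = ennreal b" "0 < b"
      using wint_pos[OF wm w(2) cub(1)] weight_wint_finite[OF w(1) cub(1)] by (cases "wint w Q0") auto
    define m where "m = b / vol Q0"
    have m: "0 < m" "wint w Q0 = ennreal (m * vol Q0)" using b m0 by (auto simp: m_def)
    have E12: "ennreal (m / D * vol Q0) \<le> wint w E" if "E = E1 \<or> E = E2" for E
    proof -
      have "wint w Q0 \<le> ennreal D * wint w E"
        using that ap_subset_cubes[OF ap q cub(2) cub(1) sub(1)] ap_subset_cubes[OF ap q cub(3) cub(1) sub(2)]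
        unfolding ratio D_def by auto
      then have "ennreal (1 / D) * wint w Q0 \<le> ennreal (1 / D) * (ennreal D * wint w E)"
        by (rule mult_left_mono) simp
      also have "\<dots> = wint w E" using D by (simp add: mult.assoc[symmetric] ennreal_mult[symmetric])
      also have "ennreal (1 / D) * wint w Q0 = ennreal (m / D * vol Q0)"
        using m D by (simp add: ennreal_mult[symmetric])
      finally show ?thesis .
    qed
    have mass: "ennreal (m / D * vol Q0) \<le> wint w (Q0 \<inter> E)" if "E = E1 \<or> E = - E1" for E
      using that
    proof
      assume "E = E1"
      then show ?thesis using E12[of E1] sub(1) by (simp add: Int_absorb1)
    next
      assume "E = - E1"
      then have "E2 \<subseteq> Q0 \<inter> E" using sub disj by auto
      then show ?thesis using E12[of E2] wint_mono_set[of E2 "Q0 \<inter> E" w] by (auto intro: order_trans)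
    qed
    let ?w = "\<lambda>E x. if x \<in> E then L * w x else w x"
    have L1: "1 \<le> L" by (simp add: L_def)
    have mean_jump: "ennreal (L * (m / D)) \<le> mean Q0 (?w E)" if E: "E = E1 \<or> E = - E1" for E
    proof (rule mean_ge[OF cub(1)])
      have [measurable]: "E \<in> sets lebesgue" using E by auto
      have "ennreal (L * (m / D) * vol Q0) = ennreal L * ennreal (m / D * vol Q0)"
        using L1 m D by (simp add: ennreal_mult[symmetric])
      also have "\<dots> \<le> ennreal L * wint w (Q0 \<inter> E)" by (intro mult_left_mono mass E) simp
      also have "\<dots> = wint (\<lambda>x. L * w x) (Q0 \<inter> E)" using L1 by (intro wint_cmult[symmetric]) auto
      also have "\<dots> = wint (?w E) (Q0 \<inter> E)" by (intro wint_cong_AE) auto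
      also have "\<dots> \<le> wint (?w E) Q0" by (rule wint_mono_set) auto
      finally show "ennreal (L * (m / D) * vol Q0) \<le> wint (?w E) Q0" .
    qed (use L1 m D in auto)
    have "2 powr (p - 1) \<ge> 1" using p by (simp add: ge_one_powr_ge_zero)
    then have "K * D * 1 \<le> K * D * 2 powr (p - 1)" using K D by (intro mult_left_mono) auto
    then have LK: "K * D < L" "K * D * 2 powr (p - 1) \<le> L"
      using mult_pos_pos[OF K D] unfolding L_def by (auto simp: mult_ac)
    have "ennreal K \<le> muckenhoupt_const p (?w E1) \<or> ennreal K \<le> muckenhoupt_const p (?w (- E1))"
    proof (cases "p = 1")
      case True
      show ?thesis
      proof (rule ccontr)
        assume "\<not> ?thesis"
        then have less: "muckenhoupt_const p (?w E) < ennreal K" if "E = E1 \<or> E = - E1" for E using that by auto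
        have AE: "AE x in lebesgue. x \<in> Q0 \<longrightarrow> L * (m / D) \<le> K * ?w E x" if E: "E = E1 \<or> E = - E1" for E
        proof -
          obtain c where c: "c < ennreal K" "AE x in lebesgue. x \<in> Q0 \<longrightarrow> mean Q0 (?w E) \<le> c * ennreal (?w E x)"
            using less[OF E] True cub(1) unfolding muckenhoupt_const_def by (auto simp: Inf_less_iff)
          show ?thesis using c(2)
          proof eventually_elim
            case (elim x)
            show ?case
            proof
              assume "x \<in> Q0"
              then have "ennreal (L * (m / D)) \<le> c * ennreal (?w E x)" using elim mean_jump[OF E] by auto
              also have "\<dots> \<le> ennreal K * ennreal (?w E x)" using c(1) by (intro mult_right_mono) auto
              also have "\<dots> = ennreal (K * ?w E x)" using K by (intro ennreal_mult'[symmetric]) auto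
              finally show "L * (m / D) \<le> K * ?w E x"
                using K L1 w(2)[of x] by (subst (asm) ennreal_le_iff) auto
            qed
          qed
        qed
        \<comment> \<open>At each point one of the two jumped weights coincides with
          \<open>w\<close>. Thus \<open>w\<close> would be at least
          \<open>L * (m / D) / K > m\<close> almost everywhere on \<open>Q0\<close>, although
          \<open>m\<close> is its mean.\<close>
        have "AE x in lebesgue. x \<in> Q0 \<longrightarrow> L * (m / D) / K \<le> w x"
          using AE[OF disjI1[OF refl]] AE[OF disjI2[OF refl]]
        proof eventually_elim
          case (elim x)
          show ?case
          proof
            assume "x \<in> Q0"
            then have "L * (m / D) \<le> K * w x" using elim by (cases "x \<in> E1") auto
            then show "L * (m / D) / K \<le> w x"
              by (simp only: pos_divide_le_eq[OF K] mult.commute[of "w x" K])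
          qed
        qed
        then have "ennreal (L * (m / D) / K * vol Q0) \<le> wint w Q0"
          using K L1 m D by (intro wint_ge_of_AE_le cub) auto
        then have "L * (m / D) / K * vol Q0 \<le> m * vol Q0"
          using m m0 by (simp add: ennreal_le_iff)
        then have "L * (m / D) / K \<le> m" using m0 by (rule mult_right_le_imp_le)
        then have "L \<le> K * D" using m D K by (simp add: field_simps)
        then show False using LK by simp
      qed
    next
      case False
      then have p1: "1 < p" using p by simp
      define e where "e = - 1 / (p - 1)"
      have e: "1 - p / (p - 1) = e" using p1 by (simp add: e_def divide_simps)
      obtain a d where ad: "0 < a" "0 < d" "wint w Q0 = ennreal (a * vol Q0)"
        "wint (\<lambda>x. w x powr e) Q0 = ennreal (d * vol Q0)"
        using ap cub(1) False unfolding ap_def q_def e_def by auto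
      have "a * vol Q0 = m * vol Q0"
        using ad(1,3) m m0 by (simp add: ennreal_inj)
      then have "a = m" using m0 by simp
      have "1 \<le> m * d powr (p - 1)"
        using ad m unfolding e_def by (intro ap_avg_ge_1[OF wm w(2) p1 cub(1)]) (auto simp: \<open>a = m\<close>)
      have split: "wint (\<lambda>x. w x powr e) Q0 \<le> wint (\<lambda>x. w x powr e) (Q0 \<inter> E1) + wint (\<lambda>x. w x powr e) (Q0 \<inter> - E1)"
        unfolding wint_def by (subst nn_integral_add[symmetric]) (auto intro!: nn_integral_mono simp: indicator_def)
      \<comment> \<open>The dual mass of \<open>Q0\<close> is split between \<open>E1\<close> and
        its complement. The jump is placed opposite to a side carrying at least half, where the dual
        weight stays unchanged.\<close>
      have half: "\<exists>E. (E = E1 \<or> E = - E1) \<and> ennreal (d / 2 * vol Q0) \<le> wint (\<lambda>x. w x powr e) (Q0 \<inter> - E)"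
      proof (rule ccontr)
        assume "\<not> ?thesis"
        then have "wint (\<lambda>x. w x powr e) (Q0 \<inter> - E1) < ennreal (d / 2 * vol Q0)"
          "wint (\<lambda>x. w x powr e) (Q0 \<inter> E1) < ennreal (d / 2 * vol Q0)"
          using double_complement[of E1] by (metis not_le)+
        then have "wint (\<lambda>x. w x powr e) Q0 < ennreal (d / 2 * vol Q0) + ennreal (d / 2 * vol Q0)"
          by (intro le_less_trans[OF split] add_strict_mono)
        also have "\<dots> = ennreal (d * vol Q0)"
          using ad m0 by (simp add: ennreal_plus[symmetric] del: ennreal_plus)
        finally show False using ad by simp
      qed
      then obtain E where E: "E = E1 \<or> E = - E1" "ennreal (d / 2 * vol Q0) \<le> wint (\<lambda>x. w x powr e) (Q0 \<inter> - E)" by blast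
      note E(2)
      also have "wint (\<lambda>x. w x powr e) (Q0 \<inter> - E) = wint (\<lambda>x. ?w E x powr e) (Q0 \<inter> - E)" by (intro wint_cong_AE) auto
      also have "\<dots> \<le> wint (\<lambda>x. ?w E x powr e) Q0" by (rule wint_mono_set) auto
      finally have mean2: "ennreal (d / 2) \<le> mean Q0 (\<lambda>x. ?w E x powr e)"
        using ad by (intro mean_ge cub) auto
      have "K \<le> L * (m / D) * (d / 2) powr (p - 1)"
      proof -
        have "K * (D * 2 powr (p - 1)) \<le> L * 1" using LK(2) by (simp add: mult_ac)
        also have "\<dots> \<le> L * (m * d powr (p - 1))" using \<open>1 \<le> m * d powr (p - 1)\<close> L1 by (intro mult_left_mono) auto
        finally show ?thesis using D by (simp add: powr_divide field_simps)
      qed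
      then have "ennreal K \<le> ennreal (L * (m / D)) * enn_powr (ennreal (d / 2)) (p - 1)"
        using ad L1 m D by (simp add: ennreal_mult[symmetric] ennreal_leI)
      also have "\<dots> \<le> mean Q0 (?w E) * enn_powr (mean Q0 (\<lambda>x. ?w E x powr e)) (p - 1)"
        using p1 by (intro mult_mono mean_jump E enn_powr_mono mean2) auto
      also have "\<dots> \<le> muckenhoupt_const p (?w E)"
        unfolding muckenhoupt_const_def using False e by (auto intro!: SUP_upper2[OF cub(1)])
      finally show ?thesis using E(1) by auto
    qed
    then show ?thesis by (auto intro: bexI[of _ E1] bexI[of _ "- E1"])
  qed
  moreover have "1 \<le> L" by (simp add: L_def)
  ultimately show ?thesis by blast
qed

text \<open>The constant \<open>c\<^sub>1\<close> of the extrapolation hypothesis is an arbitrary, possibly unbounded,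
  function of the Muckenhoupt constant. A uniform bound is recovered by giving all weights the same
  Muckenhoupt constant, by the intermediate value theorem.\<close>

lemma muckenhoupt_const_adjust:
  fixes p K :: real
  assumes p: "1 \<le> p" and K: "0 < K"
  shows "\<exists>L\<ge>1. \<forall>w :: real ^ 'n \<Rightarrow> real. weight w \<longrightarrow> (\<forall>x. 0 < w x) \<longrightarrow> muckenhoupt_const p w \<le> ennreal K \<longrightarrow>
    (\<exists>w'. w' \<in> lmeas \<and> (\<forall>x. w x \<le> w' x \<and> w' x \<le> L * w x) \<and> muckenhoupt_const p w' = ennreal K)"
proof -
  obtain L where L: "1 \<le> L" "\<And>w :: real ^ 'n \<Rightarrow> real. weight w \<Longrightarrow> (\<And>x. 0 < w x) \<Longrightarrow> muckenhoupt_const p w \<le> ennreal K \<Longrightarrow>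
    \<exists>E\<in>sets lebesgue. ennreal K \<le> muckenhoupt_const p (\<lambda>x. if x \<in> E then L * w x else w x)"
    using muckenhoupt_const_jump[OF assms, where 'n = 'n] by blast
  have "\<exists>w'. w' \<in> lmeas \<and> (\<forall>x. w x \<le> w' x \<and> w' x \<le> L * w x) \<and> muckenhoupt_const p w' = ennreal K"
    if w: "weight w" "\<And>x. 0 < w x" and wK: "muckenhoupt_const p w \<le> ennreal K" for w :: "real ^ 'n \<Rightarrow> real"
  proof -
    have wm[measurable]: "w \<in> lmeas" by (rule weight_measurable) fact
    obtain E where E[measurable]: "E \<in> sets lebesgue" and EK: "ennreal K \<le> muckenhoupt_const p (\<lambda>x. if x \<in> E then L * w x else w x)"
      using L(2)[OF w wK] by blast
    \<comment> \<open>A path from \<open>w\<close> at \<open>t = 1\<close> to the jumped weight at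
      \<open>t = L\<close>. Its members at \<open>s \<le> t\<close> are comparable with ratio
      \<open>t / s \<le> 1 + (t - s)\<close>, which makes the Muckenhoupt constant Lipschitz along
      the path.\<close>
    define v where "v t x = (if x \<in> E then t * w x else w x)" for t x
    have vm[measurable]: "v t \<in> lmeas" for t unfolding v_def[abs_def] by measurable
    have vpos: "0 < v t x" if "1 \<le> t" for t x using w(2)[of x] that by (simp add: v_def)
    have comp: "muckenhoupt_const p (v t) \<le> ennreal (t / s) * muckenhoupt_const p (v s)"
      "muckenhoupt_const p (v s) \<le> ennreal (t / s) * muckenhoupt_const p (v t)" if "1 \<le> s" "s \<le> t" for s t
    proof -
      have "1 * w x \<le> t / s * w x" for x using that w(2)[of x] by (intro mult_right_mono) auto
      then have "muckenhoupt_const p (v t) \<le> ennreal ((t / s) / 1) * muckenhoupt_const p (v s)"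
        using that w(2) by (intro muckenhoupt_const_comparable vpos p) (auto simp: v_def)
      then show "muckenhoupt_const p (v t) \<le> ennreal (t / s) * muckenhoupt_const p (v s)" by simp
      have "s / t * w x \<le> 1 * w x" for x using that w(2)[of x] by (intro mult_right_mono) auto
      then have "muckenhoupt_const p (v s) \<le> ennreal (1 / (s / t)) * muckenhoupt_const p (v t)"
        using that w(2) by (intro muckenhoupt_const_comparable vpos p) (auto simp: v_def)
      then show "muckenhoupt_const p (v s) \<le> ennreal (t / s) * muckenhoupt_const p (v t)" by simp
    qed
    have v1: "v 1 = w" by (auto simp: v_def)
    have bound: "muckenhoupt_const p (v t) \<le> ennreal (L * K)" if "1 \<le> t" "t \<le> L" for t
    proof -
      have "muckenhoupt_const p (v t) \<le> ennreal (t / 1) * muckenhoupt_const p w" using comp(1)[of 1 t] that v1 by simp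
      also have "\<dots> \<le> ennreal L * ennreal K" using that wK by (intro mult_mono) (auto simp: ennreal_leI)
      finally show ?thesis using K L(1) by (simp add: ennreal_mult'')
    qed
    define \<phi> where "\<phi> t = enn2real (muckenhoupt_const p (v t))" for t
    have \<phi>: "muckenhoupt_const p (v t) = ennreal (\<phi> t)" "0 \<le> \<phi> t" "\<phi> t \<le> L * K" if "1 \<le> t" "t \<le> L" for t
    proof -
      have "muckenhoupt_const p (v t) < top" using bound[OF that] ennreal_less_top le_less_trans by blast
      then show eq: "muckenhoupt_const p (v t) = ennreal (\<phi> t)" by (simp add: \<phi>_def)
      show "0 \<le> \<phi> t" by (simp add: \<phi>_def)
      show "\<phi> t \<le> L * K" using bound[OF that] K L(1) unfolding eq by (subst (asm) ennreal_le_iff) auto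
    qed
    have lip: "\<bar>\<phi> t - \<phi> s\<bar> \<le> (t - s) * (L * K)" if st: "1 \<le> s" "s \<le> t" "t \<le> L" for s t
    proof -
      have eq: "ennreal (t / s) * ennreal (\<phi> s) = ennreal (t / s * \<phi> s)" "ennreal (t / s) * ennreal (\<phi> t) = ennreal (t / s * \<phi> t)"
        by (rule ennreal_mult[symmetric]; use st \<phi>(2)[of s] \<phi>(2)[of t] in simp)+
      have le': "ennreal (\<phi> t) \<le> ennreal (t / s * \<phi> s)" "ennreal (\<phi> s) \<le> ennreal (t / s * \<phi> t)"
        unfolding eq[symmetric] using comp[of s t] st \<phi>(1)[of s] \<phi>(1)[of t] by simp_all
      have nn: "0 \<le> t / s * \<phi> s" "0 \<le> t / s * \<phi> t" using st \<phi>(2)[of s] \<phi>(2)[of t] by auto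
      note le = le'(1)[unfolded ennreal_le_iff[OF nn(1)]] le'(2)[unfolded ennreal_le_iff[OF nn(2)]]
      have ts: "t / s \<le> 1 + (t - s)"
      proof -
        have "(t - s) * 1 \<le> (t - s) * s" using st by (intro mult_left_mono) auto
        then show ?thesis using st by (simp add: field_simps)
      qed
      have "t / s * \<phi> r \<le> \<phi> r + (t - s) * (L * K)" if "1 \<le> r" "r \<le> L" for r
      proof -
        have "t / s * \<phi> r \<le> (1 + (t - s)) * \<phi> r" using ts \<phi>(2)[OF that] by (rule mult_right_mono)
        moreover have "(t - s) * \<phi> r \<le> (t - s) * (L * K)" using st \<phi>(3)[OF that] by (intro mult_left_mono) auto
        ultimately show ?thesis by (simp add: distrib_right)
      qed
      from this[of s] this[of t] show ?thesis using le st by auto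
    qed
    have "continuous_on {1..L} \<phi>"
    proof (rule lipschitz_on_continuous_on[where L = "L * K"], rule lipschitz_onI)
      fix x y assume "x \<in> {1..L}" "y \<in> {1..L}"
      then show "dist (\<phi> x) (\<phi> y) \<le> L * K * dist x y"
        using lip[of x y] lip[of y x] by (cases "x \<le> y") (auto simp: dist_real_def abs_minus_commute mult.commute)
    qed (use K L(1) in auto)
    moreover have "\<phi> 1 \<le> K" using wK \<phi>(1)[of 1] L(1) K by (simp add: v1 ennreal_le_iff)
    moreover have "K \<le> \<phi> L"
    proof -
      have "ennreal K \<le> ennreal (\<phi> L)" using EK \<phi>(1)[of L] L(1) by (simp add: v_def[abs_def])
      then show ?thesis using \<phi>(2)[of L] L(1) by (simp add: ennreal_le_iff)
    qed
    ultimately obtain t where t: "1 \<le> t" "t \<le> L" "\<phi> t = K"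
      using IVT'[of \<phi> 1 K L] L(1) by auto
    have "w x \<le> v t x \<and> v t x \<le> L * w x" for x
      using mult_right_mono[of 1 t "w x"] mult_right_mono[of t L "w x"] mult_right_mono[of 1 L "w x"] t L(1) w(2)[of x]
      by (auto simp: v_def)
    then show ?thesis using t \<phi>(1)[of t] vm[of t] by (intro exI[where x = "v t"]) auto
  qed
  then show ?thesis using L(1) by blast
qed

text \<open>The adjusted weight must remain admissible for the hypothesis on \<open>T\<close>; both
  class conditions survive two-sided bounds, with constants multiplied by \<open>L\<close>.\<close>

lemma limited_weights_comparable:
  assumes w: "w \<in> limited_weights pm pp p" "\<And>x. 0 < w x" and w'[measurable]: "w' \<in> lmeas"
    and L: "1 \<le> L" "\<And>x. w x \<le> w' x" "\<And>x. w' x \<le> L * w x" and p: "1 \<le> p / pm" "1 \<le> pp / p"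
  shows "w' \<in> limited_weights pm pp p"
proof -
  have weight: "weight w" using w(1) by (auto simp: limited_weights_def muckenhoupt_def)
  have [measurable]: "w \<in> lmeas" by (rule weight_measurable) fact
  have pos': "0 < w' x" for x using w(2)[of x] L(2)[of x] by simp
  have wint: "wint w' Q \<le> ennreal L * wint w Q" if "Q \<in> cubes" for Q
    using wint_mono[of Q w' "\<lambda>x. L * w x"] L that by (simp add: wint_cmult)
  have "weight w'"
  proof (rule weightI)
    fix Q :: "(real ^ 'a) set" assume Q: "Q \<in> cubes"
    have "ennreal L * wint w Q < top" using weight_wint_finite[OF weight Q] by (simp add: ennreal_mult_less_top)
    then show "wint w' Q < top" using wint[OF Q] le_less_trans by blast
  qed (auto intro: less_imp_le pos')
  moreover have "muckenhoupt_const (p / pm) w' < top"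
  proof -
    have "muckenhoupt_const (p / pm) w' \<le> ennreal (L / 1) * muckenhoupt_const (p / pm) w"
      using L p by (intro muckenhoupt_const_comparable w) auto
    also have "\<dots> < top" using w(1) by (auto simp: limited_weights_def muckenhoupt_def ennreal_mult_less_top)
    finally show ?thesis .
  qed
  moreover have "w' \<in> reverse_Holder (conj_exp (ereal (pp / p)))"
  proof -
    define \<sigma> where "\<sigma> = conj_exp (ereal (pp / p))"
    obtain c :: real where c: "\<And>Q. Q \<in> cubes \<Longrightarrow> (if \<sigma> = \<infinity> then esssup (lebesgue_on Q) (\<lambda>x. ennreal (w x))
      else enn_powr (mean Q (\<lambda>x. w x powr real_of_ereal \<sigma>)) (1 / real_of_ereal \<sigma>)) \<le> ennreal c * mean Q w"
      using w(1) unfolding limited_weights_def reverse_Holder_def \<sigma>_def by auto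
    have "(if \<sigma> = \<infinity> then esssup (lebesgue_on Q) (\<lambda>x. ennreal (w' x))
      else enn_powr (mean Q (\<lambda>x. w' x powr real_of_ereal \<sigma>)) (1 / real_of_ereal \<sigma>)) \<le> ennreal (L * c) * mean Q w'" if Q: "Q \<in> cubes" for Q
    proof -
      have [measurable]: "Q \<in> sets lebesgue" using Q by simp
      have "(if \<sigma> = \<infinity> then esssup (lebesgue_on Q) (\<lambda>x. ennreal (w' x))
        else enn_powr (mean Q (\<lambda>x. w' x powr real_of_ereal \<sigma>)) (1 / real_of_ereal \<sigma>))
       \<le> ennreal L * (if \<sigma> = \<infinity> then esssup (lebesgue_on Q) (\<lambda>x. ennreal (w x))
        else enn_powr (mean Q (\<lambda>x. w x powr real_of_ereal \<sigma>)) (1 / real_of_ereal \<sigma>))"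
      proof (cases "\<sigma> = \<infinity>")
        case True
        have "AE x in lebesgue_on Q. ennreal (w x) \<le> esssup (lebesgue_on Q) (\<lambda>x. ennreal (w x))"
          by (rule esssup_AE)
        then have "AE x in lebesgue_on Q. ennreal (w' x) \<le> ennreal L * esssup (lebesgue_on Q) (\<lambda>x. ennreal (w x))"
        proof eventually_elim
          case (elim x)
          have "ennreal (w' x) \<le> ennreal (L * w x)" using L by (intro ennreal_leI)
          also have "\<dots> = ennreal L * ennreal (w x)" using L by (intro ennreal_mult') auto
          also have "\<dots> \<le> ennreal L * esssup (lebesgue_on Q) (\<lambda>x. ennreal (w x))" by (intro mult_left_mono elim) simp
          finally show ?case .
        qed
        then have "esssup (lebesgue_on Q) (\<lambda>x. ennreal (w' x)) \<le> ennreal L * esssup (lebesgue_on Q) (\<lambda>x. ennreal (w x))"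
          by (intro esssup_I measurable_restrict_space1) auto
        then show ?thesis using True by simp
      next
        case False
        define s where "s = real_of_ereal \<sigma>"
        have "pp / p \<noteq> 1" using False by (auto simp: \<sigma>_def conj_exp_def one_ereal_def)
        then have "1 < pp / p" using p by linarith
        moreover have "0 < real_of_ereal (conj_exp (ereal y))" if "1 < y" for y
          using that by (simp add: conj_exp_real)
        ultimately have s: "0 < s" by (simp only: s_def \<sigma>_def)
        have "mean Q (\<lambda>x. w' x powr s) \<le> mean Q (\<lambda>x. L powr s * w x powr s)"
          using s L pos' by (intro mean_mono_AE AE_I2 impI) (auto simp: powr_mult[symmetric] less_imp_le intro!: powr_mono2)
        also have "\<dots> = ennreal (L powr s) * mean Q (\<lambda>x. w x powr s)" by (intro mean_cmult) auto
        finally have "enn_powr (mean Q (\<lambda>x. w' x powr s)) (1 / s) \<le> enn_powr (ennreal (L powr s) * mean Q (\<lambda>x. w x powr s)) (1 / s)"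
          using s by (intro enn_powr_mono) auto
        also have "\<dots> = ennreal L * enn_powr (mean Q (\<lambda>x. w x powr s)) (1 / s)"
          using s L by (simp add: enn_powr_mult powr_powr)
        finally show ?thesis using False by (simp add: s_def)
      qed
      also have "\<dots> \<le> ennreal L * (ennreal c * mean Q w)" by (intro mult_left_mono c Q) simp
      also have "\<dots> \<le> ennreal L * (ennreal c * mean Q w')"
        using L by (intro mult_left_mono mean_mono_AE) auto
      also have "\<dots> = ennreal (L * c) * mean Q w'" using L by (simp add: ennreal_mult' mult.assoc)
      finally show ?thesis .
    qed
    then show ?thesis
      unfolding reverse_Holder_def \<sigma>_def[symmetric] using \<open>weight w'\<close> by blast
  qed
  ultimately show ?thesis using pos' by (auto simp: limited_weights_def muckenhoupt_def)
qed

text \<open>Weights factored with a common A_1 bound \<open>A\<close> have A_(p0) constants at most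
  \<open>K\<close>. Each is replaced by a comparable weight whose constant equals \<open>K\<close>,
  so the single number \<open>c1 (ennreal K)\<close> serves all of them, at the cost of the factor
  \<open>L\<close>.\<close>

lemma limited_operator_uniform_bound:
  fixes T :: "(real ^ 'n \<Rightarrow> complex) \<Rightarrow> (real ^ 'n \<Rightarrow> complex)"
  assumes pm: "1 \<le> pm" "pm \<le> p0" "p0 \<le> pp" and A: "0 < A"
    and bound: "\<And>w f. w \<in> limited_weights pm pp p0 \<Longrightarrow> f \<in> Lp_space p0 w \<Longrightarrow>
           Lp_norm p0 w UNIV (T f) \<le> ennreal (c1 (muckenhoupt_const p0 w)) * Lp_norm p0 w UNIV f"
  shows "\<exists>C>0. \<forall>u1 u2 f. a1 A u1 \<longrightarrow> a1 A u2 \<longrightarrow> f \<in> lmeas \<longrightarrow>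
    pint p0 (\<lambda>x. u1 x powr (1 - p0 / pp) * u2 x powr - (p0 / pm - 1)) f < top \<longrightarrow>
    f \<in> limited_domain pm pp p0 \<and>
    pint p0 (\<lambda>x. u1 x powr (1 - p0 / pp) * u2 x powr - (p0 / pm - 1)) (T f)
    \<le> ennreal C * pint p0 (\<lambda>x. u1 x powr (1 - p0 / pp) * u2 x powr - (p0 / pm - 1)) f"
proof -
  define K where "K = A powr ((1 - p0 / pp) + (p0 / pm - 1))"
  have K: "0 < K" using A by (simp add: K_def)
  have p0: "1 \<le> p0" using pm by simp
  obtain L where L: "1 \<le> L" "\<And>w :: real ^ 'n \<Rightarrow> real. weight w \<Longrightarrow> (\<And>x. 0 < w x) \<Longrightarrow> muckenhoupt_const p0 w \<le> ennreal K \<Longrightarrow>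
    \<exists>w'. w' \<in> lmeas \<and> (\<forall>x. w x \<le> w' x \<and> w' x \<le> L * w x) \<and> muckenhoupt_const p0 w' = ennreal K"
    using muckenhoupt_const_adjust[OF p0 K, where 'n = 'n] by blast
  \<comment> \<open>\<open>c1\<close> may be negative, in which case \<open>ennreal\<close> makes it
    0; the maximum gives a positive real constant.\<close>
  define c where "c = max 1 (c1 (ennreal K))"
  define C where "C = c powr p0 * L"
  have "f \<in> limited_domain pm pp p0 \<and> pint p0 w (T f)
    \<le> ennreal C * pint p0 w f"
    if u: "a1 A u1" "a1 A u2" and f[measurable]: "f \<in> lmeas"
    and w_def: "w = (\<lambda>x. u1 x powr (1 - p0 / pp) * u2 x powr - (p0 / pm - 1))"
    and fin: "pint p0 w f < top" for u1 u2 w f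
  proof -
    note W = limited_weights_factored[OF u pm, folded w_def K_def]
    have wm[measurable]: "w \<in> lmeas" by (rule W)
    have Wpos: "\<And>x. 0 < w x" unfolding w_def by (rule limited_weights_factored(4)[OF u pm])
    have "weight w" using W(1) by (auto simp: limited_weights_def muckenhoupt_def)
    then obtain w' where w'm[measurable]: "w' \<in> lmeas" and w': "\<And>x. w x \<le> w' x" "\<And>x. w' x \<le> L * w x"
      and w'K: "muckenhoupt_const p0 w' = ennreal K"
      using L(2)[OF _ Wpos W(2)] by blast
    have mem: "w' \<in> limited_weights pm pp p0"
      using pm by (intro limited_weights_comparable[OF W(1) Wpos w'm L(1) w']) auto
    let ?I = "\<lambda>g w. \<integral>\<^sup>+x. ennreal (norm (g x) powr p0 * w x) \<partial>lebesgue"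
    have Lp: "Lp_norm p0 v UNIV g = enn_powr (?I g v) (1 / p0)" for v and g :: "real ^ 'n \<Rightarrow> complex" by (simp add: Lp_norm_def)
    have If: "?I f w' \<le> ennreal L * ?I f w"
    proof -
      have "?I f w' \<le> (\<integral>\<^sup>+x. ennreal L * ennreal (norm (f x) powr p0 * w x) \<partial>lebesgue)"
      proof (intro nn_integral_mono)
        fix x
        have "norm (f x) powr p0 * w' x \<le> L * (norm (f x) powr p0 * w x)"
          using mult_left_mono[OF w'(2)[of x], of "norm (f x) powr p0"] by (simp add: mult_ac)
        then show "ennreal (norm (f x) powr p0 * w' x) \<le> ennreal L * ennreal (norm (f x) powr p0 * w x)"
          using L(1) by (simp add: ennreal_mult'[symmetric] ennreal_leI)
      qed
      also have "\<dots> = ennreal L * ?I f w" by (rule nn_integral_cmult) measurable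
      finally show ?thesis .
    qed
    also have "\<dots> < top" using fin by (simp add: ennreal_mult_less_top)
    finally have fLp: "f \<in> Lp_space p0 w'" by (simp add: Lp_space_def Lp)
    have "?I (T f) w \<le> ?I (T f) w'"
      using w'(1) by (intro nn_integral_mono ennreal_leI mult_left_mono) auto
    also have "\<dots> = enn_powr (Lp_norm p0 w' UNIV (T f)) p0"
      using p0 by (simp add: Lp enn_powr_powr)
    also have "\<dots> \<le> enn_powr (ennreal c * Lp_norm p0 w' UNIV f) p0"
    proof (intro enn_powr_mono)
      have "Lp_norm p0 w' UNIV (T f) \<le> ennreal (c1 (ennreal K)) * Lp_norm p0 w' UNIV f"
        using bound[OF mem fLp] by (simp add: w'K)
      also have "\<dots> \<le> ennreal c * Lp_norm p0 w' UNIV f"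
        by (intro mult_right_mono ennreal_leI) (auto simp: c_def)
      finally show "Lp_norm p0 w' UNIV (T f) \<le> ennreal c * Lp_norm p0 w' UNIV f" .
    qed (use p0 in auto)
    also have "\<dots> = ennreal (c powr p0) * ?I f w'"
      using p0 by (simp add: Lp enn_powr_mult enn_powr_powr c_def)
    also have "\<dots> \<le> ennreal (c powr p0) * (ennreal L * ?I f w)" by (intro mult_left_mono If) simp
    also have "\<dots> = ennreal C * ?I f w" using L(1) by (simp add: C_def ennreal_mult mult.assoc)
    finally show ?thesis using fLp mem by (auto simp: limited_domain_def)
  qed
  note main = this
  have "0 < C" using L(1) by (simp add: C_def c_def max_def)
  then show ?thesis using main[OF _ _ _ refl] by blast
qed

section \<open>Limited range extrapolation\<close>

text \<open>Adding a multiple of this function makes a nonnegative majorant strictly positive at a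
  controlled cost in integral; powers with negative exponent of the majorant occur later.\<close>

lemma exists_positive_density:
  "\<exists>g :: real ^ 'n \<Rightarrow> real. g \<in> lmeas \<and> (\<forall>x. 0 < g x) \<and> lint g \<le> 1"
proof -
  interpret sigma_finite_measure "lebesgue :: (real ^ 'n) measure" by (rule sigma_finite_lebesgue)
  obtain h :: "real ^ 'n \<Rightarrow> ennreal" where h[measurable]: "h \<in> lmeas"
    and fin: "(\<integral>\<^sup>+x. h x \<partial>lebesgue) \<noteq> \<infinity>" and pos: "\<And>x. 0 < h x \<and> h x < \<infinity>"
    using Ex_finite_integrable_function by auto
  obtain r where r: "(\<integral>\<^sup>+x. h x \<partial>lebesgue) = ennreal r" "0 \<le> r"
    using fin by (cases "\<integral>\<^sup>+x. h x \<partial>lebesgue") auto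
  define g where "g x = enn2real (h x) / (r + 1)" for x
  have "lint g = (\<integral>\<^sup>+x. ennreal (1 / (r + 1)) * h x \<partial>lebesgue)"
  proof (intro nn_integral_cong)
    fix x
    obtain a where "h x = ennreal a" "0 \<le> a" using pos[of x] by (cases "h x") auto
    then show "ennreal (g x) = ennreal (1 / (r + 1)) * h x"
      using r by (simp add: g_def ennreal_mult[symmetric])
  qed
  also have "\<dots> = ennreal (1 / (r + 1)) * ennreal r" by (subst nn_integral_cmult) (auto simp: r)
  also have "\<dots> = ennreal (r / (r + 1))" using r by (simp add: ennreal_mult[symmetric])
  also have "\<dots> \<le> 1" using r by (simp add: ennreal_le_1)
  finally have "lint g \<le> 1" .
  moreover have "0 < g x" for x
    using pos[of x] r by (simp add: g_def enn2real_positive_iff)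
  moreover have "g \<in> lmeas" unfolding g_def[abs_def] by measurable
  ultimately show ?thesis by blast
qed

lemma powr_mult_le_Young:
  fixes \<theta> :: real
  assumes "0 \<le> \<theta>" "\<theta> \<le> 1" "0 \<le> a" "0 < b"
  shows "a powr \<theta> * b powr (1 - \<theta>) \<le> \<theta> * a + (1 - \<theta>) * b"
proof (cases "a = 0")
  case True then show ?thesis using assms by auto
next
  case False then show ?thesis using assms by (intro Youngs_inequality_0) auto
qed

lemma nn_integral_add_cmult_le:
  assumes [measurable]: "f \<in> borel_measurable M" "g \<in> borel_measurable M"
    and "0 \<le> a" "0 \<le> b" "\<And>x. 0 \<le> f x" "\<And>x. 0 \<le> g x" "0 \<le> A" "0 \<le> B"
    and le: "\<And>x. h x \<le> a * f x + b * g x"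
    and fA: "(\<integral>\<^sup>+x. ennreal (f x) \<partial>M) \<le> ennreal A" and gB: "(\<integral>\<^sup>+x. ennreal (g x) \<partial>M) \<le> ennreal B"
  shows "(\<integral>\<^sup>+x. ennreal (h x) \<partial>M) \<le> ennreal (a * A + b * B)"
proof -
  have "(\<integral>\<^sup>+x. ennreal (h x) \<partial>M) \<le> (\<integral>\<^sup>+x. ennreal a * ennreal (f x) + ennreal b * ennreal (g x) \<partial>M)"
  proof (intro nn_integral_mono)
    fix x
    have "ennreal (h x) \<le> ennreal (a * f x + b * g x)" using le by (rule ennreal_leI)
    then show "ennreal (h x) \<le> ennreal a * ennreal (f x) + ennreal b * ennreal (g x)"
      using assms by (simp add: ennreal_mult)
  qed
  also have "\<dots> = ennreal a * (\<integral>\<^sup>+x. ennreal (f x) \<partial>M) + ennreal b * (\<integral>\<^sup>+x. ennreal (g x) \<partial>M)"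
    by (simp add: nn_integral_add nn_integral_cmult)
  also have "\<dots> \<le> ennreal a * ennreal A + ennreal b * ennreal B"
    by (intro add_mono mult_left_mono fA gB) auto
  also have "\<dots> = ennreal (a * A + b * B)" using assms by (simp add: ennreal_mult)
  finally show ?thesis .
qed

context
  fixes pm p0 pp p :: real and T :: "(real ^ 'n \<Rightarrow> complex) \<Rightarrow> (real ^ 'n \<Rightarrow> complex)"
    and c1 :: "ennreal \<Rightarrow> real"
  assumes pm: "1 \<le> pm" "pm \<le> p0" "p0 \<le> pp" and p: "pm < p" "p < pp"
    and op: "operator_on (limited_domain pm pp p0) T"
    and bound: "\<And>w f. w \<in> limited_weights pm pp p0 \<Longrightarrow> f \<in> Lp_space p0 w \<Longrightarrow>
           Lp_norm p0 w UNIV (T f) \<le> ennreal (c1 (muckenhoupt_const p0 w)) * Lp_norm p0 w UNIV f"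
begin

text \<open>For this weight the integrand |f|^p0 \<open>xw G v\<close> equals (|f|^p v)^(p0/p)
  G^(1-p0/p). This geometric combination of |f|^p v and \<open>G\<close> is the bridge between the
  exponents \<open>p\<close> and \<open>p0\<close>.\<close>

abbreviation xw :: "(real ^ 'n \<Rightarrow> real) \<Rightarrow> (real ^ 'n \<Rightarrow> real) \<Rightarrow> real ^ 'n \<Rightarrow> real" where
  "xw G v \<equiv> \<lambda>x. G x powr (1 - p0 / p) * v x powr (p0 / p)"

abbreviation Tbd :: "real \<Rightarrow> (real ^ 'n \<Rightarrow> real) \<Rightarrow> (real ^ 'n \<Rightarrow> complex) \<Rightarrow> bool" where
  "Tbd C w f \<equiv> pint p0 w f < top \<longrightarrow>
     f \<in> limited_domain pm pp p0 \<and> pint p0 w (T f) \<le> ennreal C * pint p0 w f"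

text \<open>The weight \<open>u\<^sub>1\<^bsup>1-p\<^sub>0/p\<^sub>+\<^esup> u\<^sub>2\<^bsup>1-p\<^sub>0/p\<^sub>-\<^esup>\<close>
  of the factorisation of \<open>v\<^sup>s\<close> equals \<open>F\<^bsup>\<tau>(p-p\<^sub>0)/p\<^esup> v\<^bsup>p\<^sub>0/p\<^esup>\<close>.\<close>

lemma extrapolation_weight:
  defines "s \<equiv> pp / (pp - p)"
  defines "\<tau> \<equiv> s * (p / pm - 1) + 1"
  shows "\<exists>C>0. \<forall>v h B f. v \<in> lmeas \<longrightarrow> (\<forall>x. 0 < v x) \<longrightarrow> ap \<tau> A (\<lambda>x. v x powr s) \<longrightarrow>
    h \<in> lmeas \<longrightarrow> (\<forall>x. 0 \<le> h x) \<longrightarrow> 0 < B \<longrightarrow> lint h \<le> ennreal B \<longrightarrow>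
    f \<in> lmeas \<longrightarrow>
    (\<exists>G. G \<in> lmeas \<and> (\<forall>x. 0 < G x) \<and> (\<forall>x. h x \<le> G x) \<and> lint G \<le> ennreal (4 * B) \<and>
      Tbd C (xw G v) f)"
proof -
  have pos: "0 < pm" "0 < p" "0 < p0" "0 < pp" "0 < pp - p" using pm p by auto
  have s: "0 < s" "s * (1 - p / pp) = 1" using pos by (auto simp: s_def field_simps)
  have \<tau>1: "1 < \<tau>" using s(1) p pos by (simp add: \<tau>_def)
  define \<kappa> where "\<kappa> = 1 / pm - 1 / pp"
  have \<tau>: "\<tau> = s * p * \<kappa>"
  proof -
    have "\<tau> = s * (p / pm - 1) + s * (1 - p / pp)" by (simp only: \<tau>_def s(2))
    also have "\<dots> = s * p * \<kappa>" by (simp add: \<kappa>_def algebra_simps)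
    finally show ?thesis .
  qed
  have ab: "(1 - p0 / pp) + (p0 / pm - 1) = p0 * \<kappa>" by (simp add: \<kappa>_def algebra_simps)
  \<comment> \<open>\<open>e1\<close> and \<open>e2\<close> are the exponent identities for
    \<open>v\<close> and \<open>F\<close> in the product of the two factors: the factorisation
    yields precisely \<open>xw\<close> with \<open>G = F powr \<tau>\<close>.\<close>
  have e1: "s * ((1 - p0 / pp) / \<tau> + (p0 / pm - 1) / \<tau>) = p0 / p"
  proof -
    have "s * ((1 - p0 / pp) / \<tau> + (p0 / pm - 1) / \<tau>) = s * (p0 * \<kappa>) / \<tau>"
      by (simp only: add_divide_distrib[symmetric] ab) simp
    also have "\<dots> = p0 * (s * p * \<kappa>) / (p * \<tau>)" using pos by simp
    also have "\<dots> = p0 * \<tau> / (p * \<tau>)" by (simp only: \<tau>[symmetric])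
    also have "\<dots> = p0 / p" using \<tau>1 by simp
    finally show ?thesis .
  qed
  have e2: "(\<tau> - 1) * (1 - p0 / pp) - (p0 / pm - 1) = \<tau> * (1 - p0 / p)"
  proof -
    have sp: "s * (p / pp) = s - 1" using s(2) by (simp add: algebra_simps)
    have "(\<tau> - 1) * (1 - p0 / pp) - (p0 / pm - 1) = \<tau> - \<tau> * p0 / pp - ((1 - p0 / pp) + (p0 / pm - 1))"
      by (simp add: algebra_simps diff_divide_distrib)
    also have "\<dots> = \<tau> - \<kappa> * p0 * (s * (p / pp) + 1)" unfolding ab by (simp add: \<tau> algebra_simps)
    also have "\<dots> = \<tau> - \<kappa> * p0 * s" unfolding sp by simp
    also have "\<dots> = \<tau> * (1 - p0 / p)" using pos by (simp add: \<tau> algebra_simps)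
    finally show ?thesis .
  qed
  obtain A' where A': "0 < A'" "\<And>(\<omega> :: real ^ 'n \<Rightarrow> real) F0. ap \<tau> A \<omega> \<Longrightarrow> F0 \<in> lmeas \<Longrightarrow> (\<And>x. 0 < F0 x) \<Longrightarrow>
    lint (\<lambda>x. F0 x powr \<tau>) < top \<Longrightarrow>
    \<exists>F. F \<in> lmeas \<and> (\<forall>x. F0 x \<le> F x) \<and>
      lint (\<lambda>x. F x powr \<tau>) \<le> 2 * lint (\<lambda>x. F0 x powr \<tau>) \<and>
      a1 A' (\<lambda>x. F x powr (\<tau> - 1) * \<omega> x powr (1 / \<tau>)) \<and> a1 A' (\<lambda>x. F x * \<omega> x powr (- 1 / \<tau>))"
    using ap_factorization[OF \<tau>1, of A, where 'n = 'n] by blast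
  obtain C where C: "0 < C" "\<And>u1 u2 f. a1 A' u1 \<Longrightarrow> a1 A' u2 \<Longrightarrow> f \<in> lmeas \<Longrightarrow>
    pint p0 (\<lambda>x. u1 x powr (1 - p0 / pp) * u2 x powr - (p0 / pm - 1)) f < top \<Longrightarrow>
    f \<in> limited_domain pm pp p0 \<and>
    pint p0 (\<lambda>x. u1 x powr (1 - p0 / pp) * u2 x powr - (p0 / pm - 1)) (T f)
    \<le> ennreal C * pint p0 (\<lambda>x. u1 x powr (1 - p0 / pp) * u2 x powr - (p0 / pm - 1)) f"
    using limited_operator_uniform_bound[OF pm A'(1) bound] by blast
  obtain g :: "real ^ 'n \<Rightarrow> real" where g[measurable]: "g \<in> lmeas" and gpos: "\<And>x. 0 < g x"
    and gint: "lint g \<le> 1"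
    using exists_positive_density by blast
  have "\<exists>G. G \<in> lmeas \<and> (\<forall>x. 0 < G x) \<and> (\<forall>x. h x \<le> G x) \<and> lint G \<le> ennreal (4 * B) \<and>
      Tbd C (xw G v) f"
    if v[measurable]: "v \<in> lmeas" and vpos: "\<And>x. 0 < v x" and ap: "ap \<tau> A (\<lambda>x. v x powr s)"
      and h[measurable]: "h \<in> lmeas" and hpos: "\<And>x. 0 \<le> h x" and B: "0 < B"
      and hB: "lint h \<le> ennreal B" and f[measurable]: "f \<in> lmeas"
    for v h B f
  proof -
    \<comment> \<open>The root makes \<open>F0 powr \<tau>\<close> equal to
      \<open>h + B * g\<close>, of integral at most \<open>2 * B\<close>; the iteration doubles this
      to \<open>4 * B\<close>.\<close>
    define F0 where "F0 x = (h x + B * g x) powr (1 / \<tau>)" for x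
    have hg: "0 < h x + B * g x" for x using hpos[of x] gpos[of x] B by (simp add: add_nonneg_pos)
    have F0m[measurable]: "F0 \<in> lmeas" unfolding F0_def[abs_def] by measurable
    have F0pos: "0 < F0 x" for x using hg[of x] by (simp add: F0_def)
    have F0\<tau>: "F0 x powr \<tau> = h x + B * g x" for x using hg[of x] \<tau>1 by (simp add: F0_def powr_powr)
    have F0int: "lint (\<lambda>x. F0 x powr \<tau>) \<le> ennreal (1 * B + B * 1)"
      unfolding F0\<tau> using hpos gpos B hB gint by (intro nn_integral_add_cmult_le[where f = h and g = g]) (auto intro: less_imp_le)
    then have F0fin: "lint (\<lambda>x. F0 x powr \<tau>) < top"
      using ennreal_less_top le_less_trans by blast
    obtain F where F[measurable]: "F \<in> lmeas" and F0F: "\<And>x. F0 x \<le> F x"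
      and Fint: "lint (\<lambda>x. F x powr \<tau>) \<le> 2 * lint (\<lambda>x. F0 x powr \<tau>)"
      and u: "a1 A' (\<lambda>x. F x powr (\<tau> - 1) * (v x powr s) powr (1 / \<tau>))" "a1 A' (\<lambda>x. F x * (v x powr s) powr (- 1 / \<tau>))"
      using A'(2)[OF ap F0m F0pos F0fin] by blast
    have Fpos: "0 < F x" for x using F0F[of x] F0pos[of x] by simp
    have W: "(F x powr (\<tau> - 1) * (v x powr s) powr (1 / \<tau>)) powr (1 - p0 / pp) * (F x * (v x powr s) powr (- 1 / \<tau>)) powr - (p0 / pm - 1)
       = (F x powr \<tau>) powr (1 - p0 / p) * v x powr (p0 / p)" for x
    proof -
      have "(F x powr (\<tau> - 1) * (v x powr s) powr (1 / \<tau>)) powr (1 - p0 / pp) * (F x * (v x powr s) powr (- 1 / \<tau>)) powr - (p0 / pm - 1)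
        = (F x powr ((\<tau> - 1) * (1 - p0 / pp)) * F x powr - (p0 / pm - 1)) * (v x powr (s * (1 / \<tau>) * (1 - p0 / pp)) * v x powr (s * (- 1 / \<tau>) * - (p0 / pm - 1)))"
        by (simp add: powr_mult powr_powr mult_ac)
      also have "F x powr ((\<tau> - 1) * (1 - p0 / pp)) * F x powr - (p0 / pm - 1) = F x powr (\<tau> * (1 - p0 / p))"
      proof -
        have "(\<tau> - 1) * (1 - p0 / pp) + - (p0 / pm - 1) = \<tau> * (1 - p0 / p)" using e2 by simp
        then show ?thesis by (simp only: powr_add[symmetric])
      qed
      also have "v x powr (s * (1 / \<tau>) * (1 - p0 / pp)) * v x powr (s * (- 1 / \<tau>) * - (p0 / pm - 1)) = v x powr (p0 / p)"
      proof -
        have "s * (1 / \<tau>) * X + s * (- 1 / \<tau>) * - Y = s * (X / \<tau> + Y / \<tau>)" for X Y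
          by (simp add: algebra_simps)
        then show ?thesis by (simp only: powr_add[symmetric] e1)
      qed
      finally show ?thesis by (simp add: powr_powr)
    qed
    have "h x \<le> F x powr \<tau>" for x
    proof -
      have "h x \<le> F0 x powr \<tau>" unfolding F0\<tau> using gpos[of x] B by simp
      also have "\<dots> \<le> F x powr \<tau>" using F0F F0pos[of x] \<tau>1 by (intro powr_mono2) auto
      finally show ?thesis .
    qed
    moreover have "lint (\<lambda>x. F x powr \<tau>) \<le> ennreal (4 * B)"
    proof -
      have "lint (\<lambda>x. F x powr \<tau>) \<le> 2 * ennreal (1 * B + B * 1)"
        using F0int by (intro order_trans[OF Fint] mult_left_mono) auto
      also have "\<dots> = ennreal (4 * B)" using B by (simp add: ennreal_mult[symmetric] ennreal_numeral[symmetric] del: ennreal_numeral ennreal_plus)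
      finally show ?thesis .
    qed
    moreover note C(2)[OF u f, unfolded W]
    ultimately show ?thesis
      by (intro exI[where x = "\<lambda>x. F x powr \<tau>"]) (auto simp: less_imp_neq[OF Fpos, symmetric])
  qed
  then show ?thesis using C(1) by blast
qed

lemma extrapolation_domain_measurable: "f \<in> limited_domain pm pp p0 \<Longrightarrow> T f \<in> lmeas"
  using op by (auto simp: operator_on_def)

text \<open>The condition \<open>ap \<tau>\<close> on \<open>v powr s\<close> encodes, in one
  assertion, membership of \<open>v\<close> in A_(p/pm) and RH_s. For \<open>p \<le> p0\<close> the
  majorant is taken for |f|^p v and Young's inequality is applied to \<open>T f\<close>. For
  \<open>p > p0\<close> it is taken for |T f|^p v, and Young's inequality is applied to
  \<open>f\<close>.\<close>

theorem extrapolation: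
  defines "s \<equiv> pp / (pp - p)"
  defines "\<tau> \<equiv> s * (p / pm - 1) + 1"
  shows "\<exists>C>0. \<forall>v B f. v \<in> lmeas \<longrightarrow> (\<forall>x. 0 < v x) \<longrightarrow> ap \<tau> A (\<lambda>x. v x powr s) \<longrightarrow>
    0 < B \<longrightarrow> f \<in> lmeas \<longrightarrow> pint p v f \<le> ennreal B \<longrightarrow>
    f \<in> limited_domain pm pp p0 \<and> pint p v (T f) \<le> ennreal (C * B)"
proof -
  have pos: "0 < p" "0 < p0" using pm p by auto
  obtain C where C: "0 < C" "\<And>v h B f. v \<in> lmeas \<Longrightarrow> (\<And>x. 0 < v x) \<Longrightarrow> ap \<tau> A (\<lambda>x. v x powr s) \<Longrightarrow>
    h \<in> lmeas \<Longrightarrow> (\<And>x. 0 \<le> h x) \<Longrightarrow> 0 < B \<Longrightarrow> lint h \<le> ennreal B \<Longrightarrow>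
    f \<in> lmeas \<Longrightarrow>
    \<exists>G. G \<in> lmeas \<and> (\<forall>x. 0 < G x) \<and> (\<forall>x. h x \<le> G x) \<and> lint G \<le> ennreal (4 * B) \<and>
      Tbd C (xw G v) f"
    using extrapolation_weight[of A] unfolding s_def[symmetric] \<tau>_def[symmetric] by blast
  have split: "cmod z powr p0 * (G powr (1 - p0 / p) * v powr (p0 / p)) = (cmod z powr p * v) powr (p0 / p) * G powr (1 - p0 / p)"
    for z :: complex and G v :: real using pos by (simp add: powr_mult powr_powr mult_ac)
  show ?thesis
  proof (cases "p \<le> p0")
    case True
    have "f \<in> limited_domain pm pp p0 \<and> pint p v (T f) \<le> ennreal ((4 * (C + 1)) * B)"
      if v[measurable]: "v \<in> lmeas" and vpos: "\<And>x. 0 < v x" and ap: "ap \<tau> A (\<lambda>x. v x powr s)"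
      and B: "0 < B" and f[measurable]: "f \<in> lmeas" and fB: "pint p v f \<le> ennreal B" for v B f
    proof -
      \<comment> \<open>As \<open>p0 / p \<ge> 1\<close>, replacing |f|^p v by its majorant
        \<open>G\<close> in the integrand with weight \<open>xw G v\<close> leaves exactly
        \<open>G\<close>.\<close>
      obtain G where G[measurable]: "G \<in> lmeas" and Gpos: "\<And>x. 0 < G x" and hG: "\<And>x. norm (f x) powr p * v x \<le> G x"
        and Gint: "lint G \<le> ennreal (4 * B)"
        and main: "pint p0 (xw G v) f < top \<Longrightarrow>
       f \<in> limited_domain pm pp p0 \<and>
       pint p0 (xw G v) (T f)
        \<le> ennreal C * pint p0 (xw G v) f"
        using C(2)[OF v vpos ap, of "\<lambda>x. norm (f x) powr p * v x" B f] B fB vpos by (auto simp: less_imp_le)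
      have fW: "pint p0 (xw G v) f \<le> ennreal (4 * B)"
      proof (rule order_trans[OF nn_integral_mono Gint], rule ennreal_leI)
        fix x
        have "norm (f x) powr p0 * (G x powr (1 - p0 / p) * v x powr (p0 / p)) \<le> G x powr (p0 / p) * G x powr (1 - p0 / p)"
          unfolding split using hG vpos[of x] pos by (intro mult_right_mono powr_mono2) auto
        also have "\<dots> = G x" using Gpos[of x] by (simp add: powr_add[symmetric])
        finally show "norm (f x) powr p0 * (G x powr (1 - p0 / p) * v x powr (p0 / p)) \<le> G x" .
      qed
      then have fin: "pint p0 (xw G v) f < top"
        using ennreal_less_top le_less_trans by blast
      have dom: "f \<in> limited_domain pm pp p0" using main[OF fin] by simp
      then have Tf[measurable]: "T f \<in> lmeas" by (rule extrapolation_domain_measurable)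
      have TW: "pint p0 (xw G v) (T f) \<le> ennreal (C * (4 * B))"
      proof -
        have "pint p0 (xw G v) (T f) \<le> ennreal C * ennreal (4 * B)"
          by (rule order_trans[OF conjunct2[OF main[OF fin]] mult_left_mono[OF fW]]) simp
        then show ?thesis using C(1) B by (simp add: ennreal_mult[symmetric])
      qed
      \<comment> \<open>Young's inequality with exponents \<open>p / p0\<close> and
        \<open>1 - p / p0\<close>; the power of \<open>G\<close> in the weight is compensated by the
        second factor.\<close>
      have "pint p v (T f) \<le> ennreal (p / p0 * (C * (4 * B)) + (1 - p / p0) * (4 * B))"
      proof (rule nn_integral_add_cmult_le[OF _ G _ _ _ _ _ _ _ TW Gint])
        fix x
        define X where "X = norm (T f x) powr p0 * (G x powr (1 - p0 / p) * v x powr (p0 / p))"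
        have "X powr (p / p0) * G x powr (1 - p / p0) = norm (T f x) powr p * v x * (G x powr ((1 - p0 / p) * (p / p0)) * G x powr (1 - p / p0))"
          using pos vpos[of x] by (simp add: X_def powr_mult powr_powr mult_ac)
        also have "G x powr ((1 - p0 / p) * (p / p0)) * G x powr (1 - p / p0) = 1"
          using pos Gpos[of x] by (simp add: powr_add[symmetric] algebra_simps)
        finally have "norm (T f x) powr p * v x = X powr (p / p0) * G x powr (1 - p / p0)" by simp
        also have "\<dots> \<le> p / p0 * X + (1 - p / p0) * G x"
          using True pos Gpos[of x] by (intro powr_mult_le_Young) (auto simp: X_def)
        finally show "norm (T f x) powr p * v x \<le> p / p0 * (norm (T f x) powr p0 * (G x powr (1 - p0 / p) * v x powr (p0 / p))) + (1 - p / p0) * G x"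
          by (simp add: X_def)
      qed (use True pos B C(1) Gpos in \<open>auto intro: less_imp_le\<close>)
      also have "\<dots> \<le> ennreal ((4 * (C + 1)) * B)"
      proof (rule ennreal_leI)
        have "p / p0 * (C * (4 * B)) \<le> 1 * (C * (4 * B))" "(1 - p / p0) * (4 * B) \<le> 1 * (4 * B)"
          by (rule mult_right_mono; use True pos B C(1) in simp)+
        then show "p / p0 * (C * (4 * B)) + (1 - p / p0) * (4 * B) \<le> (4 * (C + 1)) * B" by (simp add: algebra_simps)
      qed
      finally show ?thesis using dom by simp
    qed
    then show ?thesis using C(1) by (intro exI[where x = "4 * (C + 1)"]) auto
  next
    case False
    define \<theta> where "\<theta> = p0 / p"
    have \<theta>: "0 < \<theta>" "\<theta> < 1" using False pos by (auto simp: \<theta>_def)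
    \<comment> \<open>Chosen so that Young's inequality has second coefficient
      \<open>1 / (8 * C)\<close>. The majorant has integral at most \<open>4 * J\<close>, so after
      the operator bound it contributes \<open>C * (4 * J) / (8 * C) = J / 2\<close>, which can be
      absorbed.\<close>
    define M where "M = (8 * C) powr ((1 - \<theta>) / \<theta>)"
    have M: "0 < M" using C(1) by (simp add: M_def)
    have Young: "a powr \<theta> * b powr (1 - \<theta>) \<le> M * a + 1 / (8 * C) * b" if "0 \<le> a" "0 < b" for a b
    proof -
      have "M powr \<theta> = (8 * C) powr (1 - \<theta>)" using \<theta> by (simp add: M_def powr_powr)
      then have "M powr \<theta> * (1 / (8 * C)) powr (1 - \<theta>) = 1" using C(1) by (simp add: powr_divide)
      then have "a powr \<theta> * b powr (1 - \<theta>) = (M powr \<theta> * (1 / (8 * C)) powr (1 - \<theta>)) * (a powr \<theta> * b powr (1 - \<theta>))" by simp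
      also have "\<dots> = (M * a) powr \<theta> * (1 / (8 * C) * b) powr (1 - \<theta>)" by (simp only: powr_mult mult_ac)
      also have "\<dots> \<le> \<theta> * (M * a) + (1 - \<theta>) * (1 / (8 * C) * b)"
        using \<theta> M C(1) that by (intro powr_mult_le_Young) auto
      also have "\<dots> \<le> 1 * (M * a) + 1 * (1 / (8 * C) * b)"
        using \<theta> M C(1) that by (intro add_mono mult_right_mono) auto
      finally show ?thesis by simp
    qed
    have "f \<in> limited_domain pm pp p0 \<and> pint p v (T f) \<le> ennreal ((2 * C * M) * B)"
      if v[measurable]: "v \<in> lmeas" and vpos: "\<And>x. 0 < v x" and ap: "ap \<tau> A (\<lambda>x. v x powr s)"
      and B: "0 < B" and f[measurable]: "f \<in> lmeas" and fB: "pint p v f \<le> ennreal B" for v B f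
    proof -
      have key: "\<exists>G. G \<in> lmeas \<and> (\<forall>x. 0 < G x) \<and> (\<forall>x. h x \<le> G x) \<and> f \<in> limited_domain pm pp p0 \<and>
         pint p0 (xw G v) (T f) \<le> ennreal (C * (M * B) + J / 2)"
        if h[measurable]: "h \<in> lmeas" and hpos: "\<And>x. 0 \<le> h x" and J: "0 < J" "lint h \<le> ennreal J" for h J
      proof -
        obtain G where G[measurable]: "G \<in> lmeas" and Gpos: "\<And>x. 0 < G x" and hG: "\<And>x. h x \<le> G x"
          and Gint: "lint G \<le> ennreal (4 * J)"
          and main: "pint p0 (xw G v) f < top \<Longrightarrow>
         f \<in> limited_domain pm pp p0 \<and>
         pint p0 (xw G v) (T f)
          \<le> ennreal C * pint p0 (xw G v) f"
          using C(2)[OF v vpos ap h hpos J f] by blast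
        have fW: "pint p0 (xw G v) f \<le> ennreal (M * B + 1 / (8 * C) * (4 * J))"
        proof (rule nn_integral_add_cmult_le[OF _ G _ _ _ _ _ _ _ fB Gint])
          fix x
          show "norm (f x) powr p0 * (G x powr (1 - p0 / p) * v x powr (p0 / p)) \<le> M * (norm (f x) powr p * v x) + 1 / (8 * C) * G x"
            unfolding split unfolding \<theta>_def[symmetric] using vpos[of x] Gpos[of x] by (intro Young) auto
        qed (use M C(1) B J vpos Gpos in \<open>auto simp: less_imp_le\<close>)
        then have fin: "pint p0 (xw G v) f < top"
          using ennreal_less_top le_less_trans by blast
        have "pint p0 (xw G v) (T f) \<le> ennreal C * ennreal (M * B + 1 / (8 * C) * (4 * J))"
          by (rule order_trans[OF conjunct2[OF main[OF fin]] mult_left_mono[OF fW]]) simp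
        also have "\<dots> = ennreal (C * (M * B + 1 / (8 * C) * (4 * J)))"
          using C(1) by (intro ennreal_mult'[symmetric]) auto
        also have "C * (M * B + 1 / (8 * C) * (4 * J)) = C * (M * B) + J / 2" using C(1) by (simp add: field_simps)
        finally show ?thesis using G Gpos hG conjunct1[OF main[OF fin]] by blast
      qed
      \<comment> \<open>A first use with the trivial prescribed function 0 only puts
        \<open>f\<close> in the domain; this makes \<open>T f\<close> measurable, as the truncations
        below require.\<close>
      have dom: "f \<in> limited_domain pm pp p0" using key[of "\<lambda>_. 0" 1] by auto
      then have Tf[measurable]: "T f \<in> lmeas" by (rule extrapolation_domain_measurable)
      \<comment> \<open>Truncation in height and in space gives a finite integral, because
        \<open>v powr s\<close> and hence \<open>v\<close> is locally integrable. Without finiteness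
        \<open>J / 2\<close> could not be subtracted.\<close>
      define H where "H k x = min (norm (T f x)) (real k + 1) powr p * v x * indicator (cb 0 (real k + 1)) x" for k x
      have Hm[measurable]: "H k \<in> lmeas" for k unfolding H_def[abs_def] by measurable
      have Hpos: "0 \<le> H k x" for k x using vpos[of x] by (simp add: H_def)
      have J: "lint (\<lambda>x. H k x) \<le> ennreal ((2 * C * M) * B)" for k
      proof -
        have "lint (\<lambda>x. H k x) < top"
        proof -
          have Q: "cb (0 :: real ^ 'n) (real k + 1) \<in> cubes" by simp
          obtain a where a: "0 < a" "wint (\<lambda>x. v x powr s) (cb 0 (real k + 1)) = ennreal (a * vol (cb (0 :: real ^ 'n) (real k + 1)))"
            using ap Q unfolding ap_def by blast
          have s1: "1 \<le> s" "0 < s" using pm p by (auto simp: s_def)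
          have "wint (\<lambda>x. (v x powr s) powr (1 / s)) (cb 0 (real k + 1)) \<le> ennreal (a powr (1 / s) * vol (cb (0 :: real ^ 'n) (real k + 1)))"
            using a vpos s1 Q by (intro wint_powr_le) (auto simp: less_imp_neq[symmetric])
          also have "\<dots> < top" by simp
          finally have vfin: "wint v (cb 0 (real k + 1)) < top" using s1 vpos by (simp add: powr_powr less_imp_le)
          have "lint (\<lambda>x. H k x) \<le> (\<integral>\<^sup>+x. ennreal ((real k + 1) powr p) * (ennreal (v x) * indicator (cb 0 (real k + 1)) x) \<partial>lebesgue)"
          proof (rule nn_integral_mono)
            fix x
            have "min (norm (T f x)) (real k + 1) powr p * v x \<le> (real k + 1) powr p * v x"
              using vpos[of x] pos by (intro mult_right_mono powr_mono2) auto
            then show "ennreal (H k x) \<le> ennreal ((real k + 1) powr p) * (ennreal (v x) * indicator (cb 0 (real k + 1)) x)"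
              by (auto simp: H_def indicator_def ennreal_mult'[symmetric] intro!: ennreal_leI)
          qed
          also have "\<dots> = ennreal ((real k + 1) powr p) * wint v (cb 0 (real k + 1))"
            unfolding wint_def by (rule nn_integral_cmult) measurable
          also have "\<dots> < top" using vfin by (simp add: ennreal_mult_less_top)
          finally show ?thesis .
        qed
        then obtain J where J: "lint (\<lambda>x. H k x) = ennreal J" "0 \<le> J"
          by (cases "\<integral>\<^sup>+x. ennreal (H k x) \<partial>lebesgue") auto
        show ?thesis
        proof (cases "J = 0")
          case True then show ?thesis using J by simp
        next
          case False
          then have "0 < J" using J by simp
          then obtain G where G[measurable]: "G \<in> lmeas" and Gpos: "\<And>x. 0 < G x" and HG: "\<And>x. H k x \<le> G x"
            and TG: "pint p0 (xw G v) (T f) \<le> ennreal (C * (M * B) + J / 2)"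
            using key[OF Hm Hpos, of J k] J by auto
          have "ennreal J \<le> pint p0 (xw G v) (T f)"
            unfolding J(1)[symmetric]
          proof (intro nn_integral_mono ennreal_leI)
            fix x
            show "H k x \<le> norm (T f x) powr p0 * (G x powr (1 - p0 / p) * v x powr (p0 / p))"
            proof (cases "H k x = 0")
              case True then show ?thesis by simp
            next
              case False
              have "H k x \<le> norm (T f x) powr p * v x"
                using vpos[of x] pos by (auto simp: H_def indicator_def intro!: mult_right_mono powr_mono2)
              \<comment> \<open>\<open>H\<close> lies below both |T f|^p v and \<open>G\<close>,
                hence below their geometric mean with weights \<open>\<theta>\<close> and
                \<open>1 - \<theta>\<close>, which is the integrand of \<open>T f\<close> for the
                exponent \<open>p0\<close>.\<close>
              then have "H k x powr \<theta> * H k x powr (1 - \<theta>) \<le> (norm (T f x) powr p * v x) powr \<theta> * G x powr (1 - \<theta>)"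
                using Hpos[of k x] HG[of x] \<theta> by (intro mult_mono powr_mono2) auto
              then show ?thesis
                unfolding split unfolding \<theta>_def[symmetric] using False Hpos[of k x] by (simp add: powr_add[symmetric])
            qed
          qed
          also note TG
          finally have "J \<le> C * (M * B) + J / 2"
            using J C(1) M B by (subst (asm) ennreal_le_iff) auto
          then have "J \<le> (2 * C * M) * B" by simp
          then show ?thesis using J by (simp add: ennreal_leI)
        qed
      qed
      have "pint p v (T f) = (\<integral>\<^sup>+x. (SUP k. ennreal (H k x)) \<partial>lebesgue)"
      proof (rule nn_integral_cong)
        fix x
        show "ennreal (norm (T f x) powr p * v x) = (SUP k. ennreal (H k x))"
        proof (rule antisym)
          obtain t where "x \<in> cb 0 t" using subset_cb[of "{x}" 0] by auto
          moreover obtain k where "max t (norm (T f x)) \<le> real k" using real_arch_simple by blast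
          ultimately have "H k x = norm (T f x) powr p * v x"
            using cb_mono[of t "real k + 1" 0] by (auto simp: H_def min_def)
          then show "ennreal (norm (T f x) powr p * v x) \<le> (SUP k. ennreal (H k x))"
            by (intro SUP_upper2[of k]) auto
          show "(SUP k. ennreal (H k x)) \<le> ennreal (norm (T f x) powr p * v x)"
            using vpos[of x] pos by (intro SUP_least ennreal_leI) (auto simp: H_def indicator_def intro!: mult_right_mono powr_mono2)
        qed
      qed
      also have "\<dots> = (SUP k. \<integral>\<^sup>+x. ennreal (H k x) \<partial>lebesgue)"
      proof (rule nn_integral_monotone_convergence_SUP)
        show "incseq (\<lambda>k x. ennreal (H k x))"
        proof (intro incseq_SucI le_funI ennreal_leI)
          fix k x
          have "cb (0 :: real ^ 'n) (real k + 1) \<subseteq> cb 0 (real (Suc k) + 1)" by (rule cb_mono) simp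
          moreover have "min (norm (T f x)) (real k + 1) powr p * v x \<le> min (norm (T f x)) (real (Suc k) + 1) powr p * v x"
            using vpos[of x] pos by (intro mult_right_mono powr_mono2) auto
          ultimately show "H k x \<le> H (Suc k) x" using vpos[of x] by (auto simp: H_def indicator_def)
        qed
      qed measurable
      also have "\<dots> \<le> ennreal ((2 * C * M) * B)" by (intro SUP_least J)
      finally show ?thesis using dom by simp
    qed
    then show ?thesis using C(1) M by (intro exI[where x = "2 * C * M"]) auto
  qed
qed

end

section \<open>Weights adapted to a cube\<close>

text \<open>The reverse Hoelder inequality is stated after raising to the power
  \<open>\<sigma>\<close>, with the mean \<open>m\<close> as a positive real, in the same format as
  \<open>ap\<close>.\<close>

locale RH_weight =
  fixes w :: "real ^ 'n \<Rightarrow> real" and q K \<sigma> c :: real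
  assumes ap: "ap q K w" and q: "1 < q" and \<sigma>: "1 < \<sigma>" and c: "0 < c"
    and RH: "\<And>Q m. Q \<in> cubes \<Longrightarrow> 0 < m \<Longrightarrow> wint w Q = ennreal (m * vol Q) \<Longrightarrow>
      wint (\<lambda>x. w x powr \<sigma>) Q \<le> ennreal (c * m powr \<sigma> * vol Q)"
begin

definition mw :: "(real ^ 'n) set \<Rightarrow> real" where
  "mw Q = enn2real (wint w Q) / vol Q"

lemma w_measurable [measurable]: "w \<in> lmeas" and w_pos: "0 < w x"
  using ap by (auto simp: ap_def)

lemma w_nonneg: "0 \<le> w x" using w_pos[of x] by simp

lemma mw:
  assumes "Q \<in> cubes" shows "0 < mw Q" "wint w Q = ennreal (mw Q * vol Q)"
proof -
  obtain a where a: "0 < a" "wint w Q = ennreal (a * vol Q)"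
    using ap assms unfolding ap_def by blast
  have "mw Q = a" using a cubes_measure_pos[OF assms] by (simp add: mw_def del: cubes_measure_pos)
  with a show "0 < mw Q" "wint w Q = ennreal (mw Q * vol Q)" by auto
qed

lemma mw_doubling:
  assumes ER: "E \<in> cubes" "R \<in> cubes" "E \<subseteq> R" and \<rho>: "vol R \<le> \<rho> * vol E"
  shows "mw R * vol R \<le> K * \<rho> powr q * (mw E * vol E)"
proof -
  have K: "0 < K" using ap by (rule ap_const_pos)
  have m: "0 < vol E" "0 < vol R" using ER by auto
  have "ennreal (mw R * vol R) \<le> ennreal (K * (vol R / vol E) powr q) * ennreal (mw E * vol E)"
    using ap_subset_cubes[OF ap q ER] mw ER by simp
  also have "\<dots> = ennreal (K * (vol R / vol E) powr q * (mw E * vol E))"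
    using K mw(1)[OF ER(1)] by (intro ennreal_mult[symmetric]) auto
  finally have "mw R * vol R \<le> K * (vol R / vol E) powr q * (mw E * vol E)"
    using K mw(1)[OF ER(1)] by (subst (asm) ennreal_le_iff) auto
  also have "\<dots> \<le> K * \<rho> powr q * (mw E * vol E)"
    using K mw(1)[OF ER(1)] m \<rho> q by (intro mult_right_mono mult_left_mono powr_mono2) (auto simp: divide_le_eq)
  finally show ?thesis .
qed

lemma RH_lower:
  assumes s: "0 < s" "s \<le> \<sigma>" and Q: "Q \<in> cubes"
  shows "wint (\<lambda>x. w x powr s) Q \<le> ennreal (c powr (s / \<sigma>) * mw Q powr s * vol Q)"
proof -
  have m: "0 < c * mw Q powr \<sigma>" using mw(1)[OF Q] c by simp
  have "wint (\<lambda>x. (w x powr \<sigma>) powr (s / \<sigma>)) Q \<le> ennreal ((c * mw Q powr \<sigma>) powr (s / \<sigma>) * vol Q)"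
    using s \<sigma> Q m mw w_pos by (intro wint_powr_le RH) (auto simp: less_imp_neq[symmetric])
  also have "(c * mw Q powr \<sigma>) powr (s / \<sigma>) = c powr (s / \<sigma>) * mw Q powr s"
    using \<sigma> by (simp add: powr_mult powr_powr)
  finally show ?thesis using \<sigma> by (simp add: powr_powr)
qed

definition uw :: "(real ^ 'n) set \<Rightarrow> real" where
  "uw Q = enn2real (wint (\<lambda>x. w x powr \<sigma>) Q)"

text \<open>The upper bound is the reverse Hoelder inequality and the lower one Jensen's. Up to
  \<open>c\<close>, the mass of \<open>w powr \<sigma>\<close> may thus be exchanged with
  \<open>mw Q powr \<sigma> * vol Q\<close>.\<close>

lemma uw:
  assumes Q: "Q \<in> cubes"
  shows "wint (\<lambda>x. w x powr \<sigma>) Q = ennreal (uw Q)" "0 < uw Q"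
    "uw Q \<le> c * mw Q powr \<sigma> * vol Q" "mw Q powr \<sigma> * vol Q \<le> uw Q"
proof -
  have le: "wint (\<lambda>x. w x powr \<sigma>) Q \<le> ennreal (c * mw Q powr \<sigma> * vol Q)"
    using Q mw by (intro RH) auto
  have "wint (\<lambda>x. w x powr \<sigma>) Q < top" by (rule le_less_trans[OF le]) simp
  then show 1: "wint (\<lambda>x. w x powr \<sigma>) Q = ennreal (uw Q)"
    unfolding uw_def by simp
  have m: "0 < vol Q" using Q by simp
  show "uw Q \<le> c * mw Q powr \<sigma> * vol Q"
    using le m c mw(1)[OF Q] unfolding 1 by (subst (asm) ennreal_le_iff) auto
  have "0 < wint (\<lambda>x. w x powr \<sigma>) Q" using Q w_pos by (intro wint_pos) (auto simp: less_imp_neq[symmetric])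
  then show "0 < uw Q" by (simp add: 1)
  define b where "b = uw Q / vol Q"
  have b: "0 < b" "uw Q = b * vol Q" using \<open>0 < uw Q\<close> m by (auto simp: b_def)
  have "wint (\<lambda>x. (w x powr \<sigma>) powr (1 / \<sigma>)) Q \<le> ennreal (b powr (1 / \<sigma>) * vol Q)"
    using \<sigma> Q b 1 w_pos by (intro wint_powr_le) (auto simp: less_imp_neq[symmetric])
  then have "mw Q * vol Q \<le> b powr (1 / \<sigma>) * vol Q"
    using \<sigma> mw[OF Q] w_nonneg by (simp add: powr_powr ennreal_le_iff)
  then have "mw Q \<le> b powr (1 / \<sigma>)" using m by (rule mult_right_le_imp_le)
  then have "mw Q powr \<sigma> \<le> (b powr (1 / \<sigma>)) powr \<sigma>" using mw(1)[OF Q] \<sigma> by (intro powr_mono2) auto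
  then have "mw Q powr \<sigma> \<le> b" using b \<sigma> by (simp add: powr_powr)
  then show "mw Q powr \<sigma> * vol Q \<le> uw Q" unfolding b(2) by (intro mult_right_mono) auto
qed

text \<open>Reverse doubling of \<open>w\<^sup>\<sigma>\<close> improves the bound
  \<open>w(2\<^sup>iQ) \<lesssim> 2\<^bsup>-(j-i)n/\<sigma>'\<^esup> w(2\<^sup>jQ)\<close> given by the reverse Hoelder inequality by a
  geometric factor; this is what allows the endpoint values of \<open>r\<close>, without Gehring's lemma.\<close>

lemma uw_reverse_doubling:
  shows "\<exists>\<theta>. 0 < \<theta> \<and> \<theta> < 1 \<and> (\<forall>d t. 0 < t \<longrightarrow> uw (cb d t) \<le> \<theta> * uw (cb d (2 * t)))"
proof -
  define \<rho> where "\<rho> = (8 :: real) ^ CARD('n)"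
  have \<rho>: "1 \<le> \<rho>" by (simp add: \<rho>_def)
  have K: "0 < K" using ap by (rule ap_const_pos)
  define D where "D = 1 + c * (K * \<rho> powr q) powr \<sigma> * \<rho>"
  have D: "1 < D" using c K \<rho> by (simp add: D_def)
  have "uw (cb d t) \<le> (1 - 1 / D) * uw (cb d (2 * t))" if t: "0 < t" for d :: "real ^ 'n" and t
  proof -
    define R where "R = cb d (2 * t)"
    \<comment> \<open>Each coordinate of \<open>E - d\<close> lies between \<open>5 / 4 * t\<close>
      and \<open>7 / 4 * t\<close>, so \<open>E\<close> sits in the larger cube and avoids the
      smaller one. Its side is an eighth of that of \<open>R\<close>, so it carries at least the
      fraction \<open>1 / D\<close> of the mass of \<open>w powr \<sigma>\<close> on
      \<open>R\<close>.\<close>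
    define E where "E = cb (d + vec (3 / 2 * t)) (t / 4)"
    have RE: "R \<in> cubes" "E \<in> cubes" "cb d t \<in> cubes" using t by (auto simp: R_def E_def)
    have sub: "E \<subseteq> R" unfolding E_def R_def using t by (intro cb_subset_cb[where r = "3 / 2 * t"]) auto
    have disj: "cb d t \<inter> E = {}"
    proof (intro equals0I)
      fix x assume "x \<in> cb d t \<inter> E"
      then have "\<bar>x $ undefined - d $ undefined\<bar> \<le> t" "\<bar>x $ undefined - (d $ undefined + 3 / 2 * t)\<bar> \<le> t / 4"
        unfolding E_def cb_def by auto
      then show False using t by linarith
    qed
    have m: "0 < vol E" "0 < vol R" using RE by auto
    have \<rho>R: "vol R = \<rho> * vol E"
    proof -
      have "vol R = (8 * (2 * (t / 4))) ^ CARD('n)" using t by (simp add: R_def measure_cb)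
      also have "\<dots> = \<rho> * vol E"
        unfolding power_mult_distrib[of 8] using t by (simp add: E_def \<rho>_def measure_cb)
      finally show ?thesis .
    qed
    have "mw R * vol R \<le> K * \<rho> powr q * (mw E * vol E)"
      using RE sub \<rho>R by (intro mw_doubling) auto
    also have "\<dots> \<le> K * \<rho> powr q * (mw E * vol R)"
      using RE \<rho>R \<rho> m K mw(1)[OF RE(2)] by (intro mult_left_mono) auto
    finally have "mw R * vol R \<le> (K * \<rho> powr q * mw E) * vol R"
      by (simp only: mult.assoc)
    then have "mw R \<le> K * \<rho> powr q * mw E" using m(2) by (rule mult_right_le_imp_le)
    then have "mw R powr \<sigma> \<le> (K * \<rho> powr q * mw E) powr \<sigma>" using mw(1)[OF RE(1)] \<sigma> by (intro powr_mono2) auto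
    also have "\<dots> = (K * \<rho> powr q) powr \<sigma> * mw E powr \<sigma>" by (simp add: powr_mult)
    finally have mRE: "mw R powr \<sigma> \<le> (K * \<rho> powr q) powr \<sigma> * mw E powr \<sigma>" .
    have "uw R \<le> c * mw R powr \<sigma> * vol R" by (rule uw(3)[OF RE(1)])
    also have "\<dots> \<le> c * ((K * \<rho> powr q) powr \<sigma> * mw E powr \<sigma>) * (\<rho> * vol E)"
      unfolding \<rho>R using mRE c m by (intro mult_mono) (auto simp: \<rho>_def)
    also have "\<dots> = c * (K * \<rho> powr q) powr \<sigma> * \<rho> * (mw E powr \<sigma> * vol E)" by simp
    also have "\<dots> \<le> c * (K * \<rho> powr q) powr \<sigma> * \<rho> * uw E"
      using c \<rho> uw(4)[OF RE(2)] by (intro mult_left_mono) auto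
    finally have uRE: "uw R \<le> c * (K * \<rho> powr q) powr \<sigma> * \<rho> * uw E" .
    have "uw (cb d t) + uw E \<le> uw R"
    proof -
      have [measurable]: "cb d t \<in> sets lebesgue" "E \<in> sets lebesgue" using RE by auto
      have "wint (\<lambda>x. w x powr \<sigma>) (cb d t) + wint (\<lambda>x. w x powr \<sigma>) E \<le> wint (\<lambda>x. w x powr \<sigma>) R"
        unfolding wint_def
        using cb_mono[of t "2 * t" d] t sub disj by (subst nn_integral_add[symmetric])
          (auto intro!: nn_integral_mono simp: indicator_def R_def)
      then show ?thesis
        using uw(1,2)[OF RE(1)] uw(1,2)[OF RE(2)] uw(1,2)[OF RE(3)]
        by (simp add: ennreal_plus[symmetric] ennreal_le_iff del: ennreal_plus)
    qed
    moreover have "uw R \<le> D * uw E"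
      using uRE uw(2)[OF RE(2)] by (simp add: D_def distrib_right)
    then have "uw R / D \<le> uw E" using D by (simp add: divide_le_eq mult.commute)
    ultimately show ?thesis by (simp add: R_def left_diff_distrib)
  qed
  then show ?thesis using D by (intro exI[where x = "1 - 1 / D"]) auto
qed

text \<open>Reverse doubling is iterated \<open>k\<close> times for \<open>w powr \<sigma>\<close>
  and translated back by the two bounds in \<open>uw\<close>. Then \<eta> is
  \<open>\<theta> powr (1 / \<sigma>)\<close> times the rate that the reverse Hoelder inequality
  alone would give; this factor below 1 makes the inequality for \<eta> strict.\<close>

lemma mw_decay:
  "\<exists>\<eta> C. 0 < \<eta> \<and> \<eta> < 2 powr - (CARD('n) * (1 - 1 / \<sigma>)) \<and> 1 \<le> C \<and>
    (\<forall>d t k. 0 < t \<longrightarrow> mw (cb d t) * vol (cb d t) \<le>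
       C * \<eta> ^ k * (mw (cb d (2 ^ k * t)) * vol (cb d (2 ^ k * t))))"
proof -
  obtain \<theta> where \<theta>: "0 < \<theta>" "\<theta> < 1" "\<And>d t. 0 < t \<Longrightarrow> uw (cb d t) \<le> \<theta> * uw (cb d (2 * t))"
    using uw_reverse_doubling by blast
  have \<theta>k: "uw (cb d t) \<le> \<theta> ^ k * uw (cb d (2 ^ k * t))" if "0 < t" for d t and k :: nat
  proof (induction k)
    case (Suc k)
    have "\<theta> ^ k * uw (cb d (2 ^ k * t)) \<le> \<theta> ^ k * (\<theta> * uw (cb d (2 * (2 ^ k * t))))"
      using that \<theta> by (intro mult_left_mono \<theta>(3)) auto
    with Suc show ?case by (simp add: mult_ac)
  qed simp
  define \<eta> where "\<eta> = (\<theta> * 2 ^ CARD('n)) powr (1 / \<sigma>) / 2 ^ CARD('n)"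
  have \<eta>: "0 < \<eta>" using \<theta> by (simp add: \<eta>_def)
  have "\<eta> = \<theta> powr (1 / \<sigma>) * 2 powr - (CARD('n) * (1 - 1 / \<sigma>))"
    by (simp add: \<eta>_def powr_mult powr_realpow[symmetric] powr_powr powr_diff[symmetric] powr_divide right_diff_distrib)
      (simp add: powr_diff)
  also have "\<dots> < 1 * 2 powr - (CARD('n) * (1 - 1 / \<sigma>))"
  proof (rule mult_strict_right_mono)
    have "\<theta> powr (1 / \<sigma>) < 1 powr (1 / \<sigma>)" using \<theta> \<sigma> by (intro powr_less_mono2) auto
    then show "\<theta> powr (1 / \<sigma>) < 1" by simp
  qed simp
  finally have \<eta>2: "\<eta> < 2 powr - (CARD('n) * (1 - 1 / \<sigma>))" by simp
  have "mw (cb d t) * vol (cb d t) \<le>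
       max 1 (c powr (1 / \<sigma>)) * \<eta> ^ k * (mw (cb d (2 ^ k * t)) * vol (cb d (2 ^ k * t)))"
    if t: "0 < t" for d t and k :: nat
  proof -
    let ?E = "cb d t" and ?R = "cb d (2 ^ k * t)"
    have ER: "?E \<in> cubes" "?R \<in> cubes" using t by auto
    have m: "0 < vol ?E" using ER(1) by simp
    have R: "vol ?R = (2 ^ CARD('n)) ^ k * vol ?E"
      using t by (simp add: measure_cb power_mult_distrib power_mult[symmetric] mult.commute)
    have "mw ?E powr \<sigma> * vol ?E \<le> uw ?E" by (rule uw(4)[OF ER(1)])
    also have "\<dots> \<le> \<theta> ^ k * uw ?R" by (rule \<theta>k[OF t])
    also have "\<dots> \<le> \<theta> ^ k * (c * mw ?R powr \<sigma> * vol ?R)"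
      using \<theta> by (intro mult_left_mono uw(3) ER) auto
    also have "\<dots> = c * (\<theta> * 2 ^ CARD('n)) ^ k * mw ?R powr \<sigma> * vol ?E"
      by (simp add: R power_mult_distrib)
    finally have "mw ?E powr \<sigma> \<le> c * (\<theta> * 2 ^ CARD('n)) ^ k * mw ?R powr \<sigma>"
      using m by (rule mult_right_le_imp_le)
    then have "(mw ?E powr \<sigma>) powr (1 / \<sigma>) \<le> (c * (\<theta> * 2 ^ CARD('n)) ^ k * mw ?R powr \<sigma>) powr (1 / \<sigma>)"
      using \<sigma> by (intro powr_mono2) auto
    then have "mw ?E \<le> c powr (1 / \<sigma>) * ((\<theta> * 2 ^ CARD('n)) ^ k) powr (1 / \<sigma>) * mw ?R"
      using \<sigma> mw(1)[OF ER(1)] mw(1)[OF ER(2)] by (simp add: powr_mult powr_powr)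
    also have "((\<theta> * 2 ^ CARD('n)) ^ k) powr (1 / \<sigma>) = (\<eta> * 2 ^ CARD('n)) ^ k"
    proof -
      have "((\<theta> * 2 ^ CARD('n)) ^ k) powr (1 / \<sigma>) = ((\<theta> * 2 ^ CARD('n)) powr (1 / \<sigma>)) ^ k"
        using \<theta> by (simp add: powr_realpow[symmetric] powr_powr mult.commute)
      then show ?thesis by (simp add: \<eta>_def)
    qed
    finally have "mw ?E \<le> c powr (1 / \<sigma>) * (\<eta> * 2 ^ CARD('n)) ^ k * mw ?R" .
    also have "\<dots> \<le> max 1 (c powr (1 / \<sigma>)) * (\<eta> * 2 ^ CARD('n)) ^ k * mw ?R"
      using \<eta> mw(1)[OF ER(2)] by (intro mult_right_mono) auto
    finally have "mw ?E * vol ?E \<le> max 1 (c powr (1 / \<sigma>)) * (\<eta> * 2 ^ CARD('n)) ^ k * mw ?R * vol ?E"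
      using m by (intro mult_right_mono) auto
    then show ?thesis unfolding R by (simp only: power_mult_distrib mult_ac)
  qed
  then show ?thesis using \<eta> \<eta>2 by (intro exI[where x = \<eta>] exI[where x = "max 1 (c powr (1 / \<sigma>))"]) auto
qed

text \<open>\<open>j\<close> is the least index with \<open>R\<close> inside the dilate. If
  \<open>R\<close> is small compared with that dilate and met the one with index
  \<open>j - 2\<close>, it would already fit into the one with index \<open>j - 1\<close>. So
  \<open>R\<close> either touches only the last two shells or is comparable in volume to the
  dilate.\<close>

lemma cube_position:
  fixes d :: "real ^ 'n" and t :: real
  assumes t: "0 < t" and R: "R \<in> cubes"
  obtains j where "R \<subseteq> cb d (2 ^ j * t)"
    "(\<forall>x\<in>R. \<forall>i. Suc i < j \<longrightarrow> x \<notin> cb d (2 ^ i * t)) \<or>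
     vol (cb d (2 ^ j * t)) \<le> 8 ^ CARD('n) * vol R"
proof -
  obtain e r where r: "0 < r" "R = cb e r" using R by (rule cube_cases)
  have ex: "\<exists>i. R \<subseteq> cb d (2 ^ i * t)"
  proof -
    obtain u where u: "0 < u" "R \<subseteq> cb d u" using subset_cb[of R d] cb_compact[of e r] r compact_imp_bounded by metis
    obtain i where "u / t < 2 ^ i" using real_arch_pow[of 2 "u / t"] by auto
    then have "u \<le> 2 ^ i * t" using t by (simp add: divide_less_eq)
    then show ?thesis using u cb_mono by blast
  qed
  define j where "j = (LEAST i. R \<subseteq> cb d (2 ^ i * t))"
  have sub: "R \<subseteq> cb d (2 ^ j * t)" unfolding j_def using ex by (rule LeastI_ex)
  show thesis
  proof (cases "2 ^ j * t < 8 * r")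
    case True
    have "vol (cb d (2 ^ j * t)) = (2 * (2 ^ j * t)) ^ CARD('n)" using t by (simp add: measure_cb)
    also have "\<dots> \<le> (2 * (8 * r)) ^ CARD('n)" using True t by (intro power_mono mult_left_mono) auto
    also have "(2 * (8 * r)) ^ CARD('n) = 8 ^ CARD('n) * (2 * r) ^ CARD('n)"
      by (simp only: mult.left_commute[of 2] power_mult_distrib[of 8])
    also have "(2 * r) ^ CARD('n) = vol R" using r by (simp add: measure_cb)
    finally show ?thesis using sub that by blast
  next
    case False
    have "x \<notin> cb d (2 ^ i * t)" if x: "x \<in> R" and i: "Suc i < j" for x i
    proof
      assume xi: "x \<in> cb d (2 ^ i * t)"
      have "R \<subseteq> cb d (2 ^ i * t + 2 * r)"
        unfolding r(2) using x xi r by (intro cb_meet_subset) auto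
      also have "\<dots> \<subseteq> cb d (2 ^ (j - 1) * t)"
      proof (rule cb_mono)
        have "(2::real) ^ i \<le> 2 ^ (j - 2)" using i by (intro power_increasing) auto
        then have "2 ^ i * t \<le> 2 ^ (j - 2) * t" using t by simp
        moreover have "(2::real) ^ j = 4 * 2 ^ (j - 2)" "(2::real) ^ (j - 1) = 2 * 2 ^ (j - 2)"
          using i power_add[of "2::real" 2 "j - 2"] power_add[of "2::real" 1 "j - 2"]
          by (auto simp: Suc_diff_Suc numeral_2_eq_2)
        ultimately show "2 ^ i * t + 2 * r \<le> 2 ^ (j - 1) * t" using False by (simp add: algebra_simps not_less)
      qed
      finally have "j \<le> j - 1" unfolding j_def by (intro Least_le) (simp add: j_def)
      then show False using i by simp
    qed
    then show ?thesis using sub that by blast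
  qed
qed

end

context RH_weight
begin

text \<open>The interface between construction and use of the weight. The condition on each
  \<open>R\<close> says that \<open>v\<close> behaves there like \<open>\<alpha> * w\<close> as far
  as a lower bound and the mean of the power \<open>s\<close> are concerned, which suffices to
  transfer Muckenhoupt conditions. The last clause is applied to g = |f|^p.\<close>

definition localized :: "real \<Rightarrow> real \<Rightarrow> ((real ^ 'n) set \<Rightarrow> real) \<Rightarrow> real \<Rightarrow> real \<Rightarrow> real ^ 'n \<Rightarrow> real \<Rightarrow> (real ^ 'n \<Rightarrow> real) \<Rightarrow> bool" where
  "localized s \<kappa> \<nu> A C d t v \<longleftrightarrow> v \<in> lmeas \<and> (\<forall>x. 0 < v x) \<and> (\<forall>x\<in>cb d t. w x \<le> v x) \<and>
    (\<forall>R\<in>cubes. \<exists>\<alpha>>0. (\<forall>x\<in>R. \<alpha> * w x \<le> v x) \<and>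
        wint (\<lambda>x. v x powr s) R \<le> ennreal (A * (\<alpha> * mw R) powr s * vol R)) \<and>
    (\<forall>g N. g \<in> lmeas \<longrightarrow> (\<forall>x. 0 \<le> g x) \<longrightarrow> 0 \<le> N \<longrightarrow>
        (\<forall>Q\<in>cubes. (\<integral>\<^sup>+x\<in>Q. ennreal (g x * w x) \<partial>lebesgue) \<le> ennreal (N * \<nu> Q powr \<kappa>)) \<longrightarrow>
        lint (\<lambda>x. g x * v x) \<le> ennreal (C * N * \<nu> (cb d t) powr \<kappa>))"

lemma localized_cube:
  assumes "localized s \<kappa> \<nu> A C d t v" "R \<in> cubes"
  shows "\<exists>\<alpha>>0. (\<forall>x\<in>R. \<alpha> * w x \<le> v x) \<and> wint (\<lambda>x. v x powr s) R \<le> ennreal (A * (\<alpha> * mw R) powr s * vol R)"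
  using assms(1) unfolding localized_def by (elim conjE) (rule bspec[OF _ assms(2)])

text \<open>The weight is \<open>v = (\<nu>(Q) / \<nu>(2\<^sup>iQ))\<^sup>\<gamma> w\<close> on
  \<open>2\<^sup>iQ - 2\<^bsup>i-1\<^esup>Q\<close>, where \<open>Q\<close> is the cube \<open>cb d t\<close>.\<close>

lemma localized_weight:
  fixes \<nu> :: "(real ^ 'n) set \<Rightarrow> real"
  assumes s: "1 < s" "s \<le> \<sigma>" and \<nu>pos: "\<And>Q. Q \<in> cubes \<Longrightarrow> 0 < \<nu> Q"
    and \<nu>inc: "\<And>d t. 0 < t \<Longrightarrow> \<nu> (cb d t) \<le> \<nu> (cb d (2 * t))"
    and \<nu>dbl: "\<And>d t. 0 < t \<Longrightarrow> \<nu> (cb d (2 * t)) \<le> D * \<nu> (cb d t)"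
    and \<nu>dec: "\<And>d t k. 0 < t \<Longrightarrow> \<nu> (cb d t) \<le> C1 * \<eta> ^ k * \<nu> (cb d (2 ^ k * t))" and \<eta>: "0 < \<eta>" "\<eta> < 1" and C1: "0 < C1"
    and \<gamma>: "0 \<le> \<kappa>" "\<kappa> < \<gamma>" and \<xi>: "0 < \<xi>" "\<xi> < 1" and C2: "0 < C2"
    and S: "\<And>d t k. 0 < t \<Longrightarrow> \<nu> (cb d t) powr - (\<gamma> * s) * (vol (cb d t) * mw (cb d t) powr s)
      \<le> C2 * \<xi> ^ k * (\<nu> (cb d (2 ^ k * t)) powr - (\<gamma> * s) * (vol (cb d (2 ^ k * t)) * mw (cb d (2 ^ k * t)) powr s))"
  shows "\<exists>A C. 0 < A \<and> 0 < C \<and> (\<forall>d t. 0 < t \<longrightarrow> (\<exists>v. localized s \<kappa> \<nu> A C d t v))"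
proof -
  have K: "0 < K" using ap by (rule ap_const_pos)
  define \<rho> where "\<rho> = (8 :: real) ^ CARD('n)"
  have \<rho>: "1 \<le> \<rho>" by (simp add: \<rho>_def)
  define c' where "c' = c powr (s / \<sigma>)"
  have c': "0 < c'" using c by (simp add: c'_def)
  have RHs: "wint (\<lambda>x. w x powr s) Q \<le> ennreal (c' * mw Q powr s * vol Q)" if "Q \<in> cubes" for Q
    unfolding c'_def using s that by (intro RH_lower) auto
  have "0 < \<nu> (cb 0 (2 * 1))" "0 < \<nu> (cb 0 1)" by (rule \<nu>pos; simp)+
  then have D: "0 < D" using \<nu>dbl[of 1 0] by (metis less_le_trans zero_less_mult_pos2 zero_less_one)
  \<comment> \<open>\<open>A1\<close> and \<open>A2\<close> serve the two alternatives of
    \<open>cube_position\<close>: few shells, or a cube comparable to a dilate.\<close>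
  define A1 where "A1 = c' * (D powr \<gamma>) powr s"
  define A2 where "A2 = c' * C2 * (1 / (1 - \<xi>)) * (K * \<rho> powr q) powr s"
  define A where "A = A1 + A2"
  have A12: "0 < A1" "0 < A2" using c' D C2 \<xi> K \<rho> by (auto simp: A1_def A2_def)
  define C where "C = C1 powr (\<gamma> - \<kappa>) * (1 / (1 - \<eta> powr (\<gamma> - \<kappa>)))"
  have \<eta>1: "0 < \<eta> powr (\<gamma> - \<kappa>)" "\<eta> powr (\<gamma> - \<kappa>) < 1"
    using \<eta> \<gamma> powr_less_mono2[of "\<gamma> - \<kappa>" \<eta> 1] by auto
  have C: "0 < C" using C1 \<eta>1 by (simp add: C_def)
  have "\<exists>v. localized s \<kappa> \<nu> A C d t v"
    if t: "0 < t" for d t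
  proof -
    define Q where "Q i = cb d (2 ^ i * t)" for i :: nat
    have Qc: "Q i \<in> cubes" for i using t by (simp add: Q_def)
    have Qm[measurable]: "Q i \<in> sets lebesgue" for i by (simp add: Q_def)
    have Qmono: "Q i \<subseteq> Q j" if "i \<le> j" for i j
      unfolding Q_def using that t by (intro cb_mono mult_right_mono power_increasing) auto
    define N where "N i = \<nu> (Q i)" for i
    define a where "a i = (N 0 / N i) powr \<gamma>" for i
    have Q0: "Q 0 = cb d t" by (simp add: Q_def)
    have QS: "cb d (2 * (2 ^ i * t)) = Q (Suc i)" for i by (simp add: Q_def mult.assoc)
    have t2: "0 < 2 ^ i * t" for i :: nat using t by simp
    have \<nu>p: "0 < N i" for i unfolding N_def by (rule \<nu>pos[OF Qc])
    have Ninc: "N i \<le> N (Suc i)" and Ndbl: "N (Suc i) \<le> D * N i" for i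
      using \<nu>inc[OF t2[of i], of d] \<nu>dbl[OF t2[of i], of d] unfolding QS by (simp_all add: N_def Q_def)
    have Ndec: "N 0 \<le> C1 * \<eta> ^ i * N i" for i using \<nu>dec[OF t, of d i] by (simp add: N_def Q_def)
    \<comment> \<open>Hypothesis \<open>S\<close> rescaled by \<open>N 0\<close>: the bounds for the
      integrals of \<open>(a i * w) powr s\<close> over \<open>Q i\<close> grow geometrically in
      \<open>i\<close>, so the largest cube dominates any sum of them.\<close>
    have NS: "(N 0 / N i) powr (\<gamma> * s) * (vol (Q i) * mw (Q i) powr s)
      \<le> C2 * \<xi> ^ (j - i) * ((N 0 / N j) powr (\<gamma> * s) * (vol (Q j) * mw (Q j) powr s))" if ij: "i \<le> j" for i j
    proof -
      have "2 ^ (j - i) * (2 ^ i * t) = 2 ^ j * t" using ij by (simp flip: power_add mult.assoc)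
      note S' = S[OF t2[of i], of d "j - i", unfolded this]
      have "N i powr - (\<gamma> * s) * (vol (Q i) * mw (Q i) powr s) \<le> C2 * \<xi> ^ (j - i) * (N j powr - (\<gamma> * s) * (vol (Q j) * mw (Q j) powr s))"
        using S' by (simp only: N_def Q_def)
      then have "N 0 powr (\<gamma> * s) * (N i powr - (\<gamma> * s) * (vol (Q i) * mw (Q i) powr s))
        \<le> N 0 powr (\<gamma> * s) * (C2 * \<xi> ^ (j - i) * (N j powr - (\<gamma> * s) * (vol (Q j) * mw (Q j) powr s)))"
        by (rule mult_left_mono) simp
      moreover have "(N 0 / N k) powr (\<gamma> * s) = N 0 powr (\<gamma> * s) * N k powr - (\<gamma> * s)" for k
        using \<nu>p by (simp add: powr_divide powr_minus_divide)
      ultimately show ?thesis by (simp only: mult_ac)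
    qed
    have \<gamma>0: "0 < \<gamma>" using \<gamma> by simp
    have apos: "0 < a i" for i using \<nu>p[of i] \<nu>p[of 0] by (simp add: a_def)
    have a0: "a 0 = 1" using \<nu>p[of 0] by (simp add: a_def)
    have adec1: "a (Suc i) \<le> a i" for i
      unfolding a_def using Ninc[of i] \<nu>p[of i] \<nu>p[of 0] \<nu>p[of "Suc i"] \<gamma>0
      by (intro powr_mono2 divide_left_mono) auto
    then have adec: "a j \<le> a i" if "i \<le> j" for i j
      using that by (rule lift_Suc_antimono_le)
    have adbl: "a i \<le> D powr \<gamma> * a (Suc i)" for i
    proof -
      have "N 0 / N i \<le> D * (N 0 / N (Suc i))"
        using mult_left_mono[OF Ndbl[of i], of "N 0"] \<nu>p[of i] \<nu>p[of 0] \<nu>p[of "Suc i"]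
        by (simp add: field_simps)
      then have "a i \<le> (D * (N 0 / N (Suc i))) powr \<gamma>"
        unfolding a_def using \<nu>p[of i] \<nu>p[of 0] \<gamma>0 by (intro powr_mono2) auto
      then show ?thesis by (simp only: a_def powr_mult)
    qed
    have ex: "\<exists>i. x \<in> Q i" for x
    proof -
      obtain j where "cb x 1 \<subseteq> cb d (2 ^ j * t)" using cube_position[OF t, of "cb x 1" d] by (metis cb_in_cubes zero_less_one)
      moreover have "x \<in> cb x 1" by (simp add: cb_def)
      ultimately show ?thesis by (auto simp: Q_def)
    qed
    define ix where "ix x = (LEAST i. x \<in> Q i)" for x
    have ixQ: "x \<in> Q (ix x)" for x unfolding ix_def using ex by (rule LeastI_ex)
    have ix_le: "ix x \<le> i" if "x \<in> Q i" for x i unfolding ix_def using that by (rule Least_le)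
    define v where "v x = a (ix x) * w x" for x
    have vm[measurable]: "v \<in> lmeas"
    proof -
      \<comment> \<open>Because \<open>a\<close> decreases, its value at the first cube containing
        \<open>x\<close> is a supremum over all cubes containing \<open>x\<close>; a countable
        supremum is measurable.\<close>
      have "v = (\<lambda>x. (SUP i. if x \<in> Q i then a i else 0) * w x)"
      proof
        fix x
        have "(SUP i. if x \<in> Q i then a i else 0) = a (ix x)"
        proof (rule cSup_eq_maximum)
          show "a (ix x) \<in> range (\<lambda>i. if x \<in> Q i then a i else 0)"
            using ixQ[of x] by (intro image_eqI[where x = "ix x"]) auto
          show "y \<le> a (ix x)" if "y \<in> range (\<lambda>i. if x \<in> Q i then a i else 0)" for y
            using that adec ix_le apos[of "ix x"] by (auto intro: less_imp_le)
        qed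
        then show "v x = (SUP i. if x \<in> Q i then a i else 0) * w x" by (simp add: v_def)
      qed
      moreover have "(\<lambda>x. (SUP i. if x \<in> Q i then a i else 0) * w x) \<in> lmeas"
      proof (intro borel_measurable_times borel_measurable_cSUP)
        fix x :: "real ^ 'n"
        show "bdd_above ((\<lambda>i. if x \<in> Q i then a i else 0) ` UNIV)"
          using adec[of 0] a0 by (intro bdd_aboveI[where M = 1]) (auto)
      qed auto
      ultimately show ?thesis by simp
    qed
    have vpos: "0 < v x" for x using apos w_pos by (simp add: v_def)
    have vQ: "w x \<le> v x" if "x \<in> cb d t" for x
    proof -
      have "ix x = 0" using ix_le[of x 0] that by (simp add: Q_def)
      then show ?thesis by (simp add: v_def a0)
    qed
    have vlow: "a j * w x \<le> v x" if "x \<in> Q j" for x j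
      unfolding v_def using adec[OF ix_le[OF that]] w_nonneg[of x] by (rule mult_right_mono)
    have cube: "\<exists>\<alpha>>0. (\<forall>x\<in>R. \<alpha> * w x \<le> v x) \<and> wint (\<lambda>x. v x powr s) R \<le> ennreal (A * (\<alpha> * mw R) powr s * vol R)"
      if R: "R \<in> cubes" for R
    proof -
      have Rm[measurable]: "R \<in> sets lebesgue" using R by simp
      obtain j where j: "R \<subseteq> Q j" "(\<forall>x\<in>R. \<forall>i. Suc i < j \<longrightarrow> x \<notin> Q i) \<or> vol (Q j) \<le> \<rho> * vol R"
        using cube_position[OF t R, of d] unfolding Q_def \<rho>_def by metis
      have "wint (\<lambda>x. v x powr s) R \<le> ennreal (max A1 A2 * ((a j * mw R) powr s * vol R))"
        using j(2)
      proof
        assume far: "\<forall>x\<in>R. \<forall>i. Suc i < j \<longrightarrow> x \<notin> Q i"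
        have "wint (\<lambda>x. v x powr s) R \<le> wint (\<lambda>x. (D powr \<gamma> * a j) powr s * w x powr s) R"
        proof (rule wint_mono)
          fix x assume x: "x \<in> R"
          \<comment> \<open>Only the shells \<open>j\<close> and \<open>j - 1\<close> can occur
            here, and doubling of \<nu> compares their coefficients.\<close>
          have "a (ix x) \<le> D powr \<gamma> * a j"
          proof (cases "ix x = j")
            case True
            have "1 \<le> D powr \<gamma>" using order_trans[OF adec1 adbl] apos[of "Suc 0"]
              by (metis less_eq_real_def mult_le_cancel_right1 not_less)
            then show ?thesis using True apos[of j] by (simp add: mult_le_cancel_right1)
          next
            case False
            then have "ix x < j" using ix_le[of x j] j(1) x by auto
            moreover have "\<not> Suc (ix x) < j" using far x ixQ by blast
            ultimately have "j = Suc (ix x)" by simp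
            then show ?thesis using adbl[of "ix x"] by simp
          qed
          then have "v x \<le> (D powr \<gamma> * a j) * w x" unfolding v_def using w_nonneg by (rule mult_right_mono)
          then have "v x powr s \<le> ((D powr \<gamma> * a j) * w x) powr s"
            using vpos[of x] s by (intro powr_mono2) auto
          then show "v x powr s \<le> (D powr \<gamma> * a j) powr s * w x powr s" by (simp add: powr_mult)
        qed
        also have "\<dots> = ennreal ((D powr \<gamma> * a j) powr s) * wint (\<lambda>x. w x powr s) R"
          by (rule wint_cmult) auto
        also have "\<dots> \<le> ennreal ((D powr \<gamma> * a j) powr s) * ennreal (c' * mw R powr s * vol R)"
          by (intro mult_left_mono RHs R) auto
        also have "\<dots> = ennreal (A1 * ((a j * mw R) powr s * vol R))"
          using c' by (simp add: ennreal_mult[symmetric] A1_def powr_mult mult_ac)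
        also have "\<dots> \<le> ennreal (max A1 A2 * ((a j * mw R) powr s * vol R))"
          by (intro ennreal_leI mult_right_mono) auto
        finally show ?thesis .
      next
        assume near: "vol (Q j) \<le> \<rho> * vol R"
        define Sj where "Sj i = vol (Q i) * mw (Q i) powr s" for i
        have "wint (\<lambda>x. v x powr s) R \<le> wint (\<lambda>x. v x powr s) (Q j)" by (rule wint_mono_set[OF j(1)])
        also have "\<dots> \<le> (\<integral>\<^sup>+x. (\<Sum>i\<le>j. ennreal (a i powr s) * (ennreal (w x powr s) * indicator (Q i) x)) \<partial>lebesgue)"
          unfolding wint_def
        proof (rule nn_integral_mono)
          fix x
          show "ennreal (v x powr s) * indicator (Q j) x \<le> (\<Sum>i\<le>j. ennreal (a i powr s) * (ennreal (w x powr s) * indicator (Q i) x))"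
          proof (cases "x \<in> Q j")
            case True
            have "ennreal (v x powr s) * indicator (Q j) x = ennreal (a (ix x) powr s) * (ennreal (w x powr s) * indicator (Q (ix x)) x)"
              using True ixQ[of x] by (simp add: v_def powr_mult ennreal_mult)
            also have "\<dots> \<le> (\<Sum>i\<le>j. ennreal (a i powr s) * (ennreal (w x powr s) * indicator (Q i) x))"
              by (rule member_le_sum[where i = "ix x" and f = "\<lambda>i. ennreal (a i powr s) * (ennreal (w x powr s) * indicator (Q i) x)"]) (use ix_le[OF True] in auto)
            finally show ?thesis .
          qed simp
        qed
        also have "\<dots> = (\<Sum>i\<le>j. ennreal (a i powr s) * wint (\<lambda>x. w x powr s) (Q i))"
          unfolding wint_def by (simp add: nn_integral_sum nn_integral_cmult)
        also have "\<dots> \<le> (\<Sum>i\<le>j. ennreal (c' * C2 * (a j powr s * Sj j) * \<xi> ^ (j - i)))"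
        proof (rule sum_mono)
          fix i assume "i \<in> {..j}"
          then have ij: "i \<le> j" by simp
          have "ennreal (a i powr s) * wint (\<lambda>x. w x powr s) (Q i) \<le> ennreal (a i powr s) * ennreal (c' * mw (Q i) powr s * vol (Q i))"
            by (intro mult_left_mono RHs Qc) auto
          also have "\<dots> = ennreal (c' * (a i powr s * Sj i))"
            using c' by (simp add: ennreal_mult[symmetric] Sj_def mult_ac)
          also have "\<dots> \<le> ennreal (c' * (C2 * \<xi> ^ (j - i) * (a j powr s * Sj j)))"
            using NS[OF ij] c' unfolding a_def Sj_def powr_powr by (intro ennreal_leI mult_left_mono) auto
          finally show "ennreal (a i powr s) * wint (\<lambda>x. w x powr s) (Q i) \<le> ennreal (c' * C2 * (a j powr s * Sj j) * \<xi> ^ (j - i))"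
            by (simp add: mult_ac)
        qed
        also have "\<dots> = ennreal (\<Sum>i\<le>j. c' * C2 * (a j powr s * Sj j) * \<xi> ^ (j - i))"
          using c' C2 \<xi> by (intro sum_ennreal) (auto simp: Sj_def)
        also have "(\<Sum>i\<le>j. c' * C2 * (a j powr s * Sj j) * \<xi> ^ (j - i)) = c' * C2 * (a j powr s * Sj j) * (\<Sum>i\<le>j. \<xi> ^ i)"
          using sum.nat_diff_reindex[of "\<lambda>i. \<xi> ^ i" "Suc j"]
          by (simp add: sum_distrib_left[symmetric] lessThan_Suc_atMost del: sum.lessThan_Suc sum.atMost_Suc)
        also have "ennreal (c' * C2 * (a j powr s * Sj j) * (\<Sum>i\<le>j. \<xi> ^ i)) \<le> ennreal (A2 * ((a j * mw R) powr s * vol R))"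
        proof (rule ennreal_leI)
          have "(\<Sum>i\<le>j. \<xi> ^ i) \<le> (\<Sum>i. \<xi> ^ i)"
            using \<xi> by (intro sum_le_suminf summable_geometric) auto
          also have "\<dots> = 1 / (1 - \<xi>)" using \<xi> by (intro suminf_geometric) auto
          finally have g: "(\<Sum>i\<le>j. \<xi> ^ i) \<le> 1 / (1 - \<xi>)" .
          have mR: "0 < vol R" using R by simp
          have mono: "vol R \<le> vol (Q j)"
          proof -
            have "emeasure lebesgue R \<le> emeasure lebesgue (Q j)" using j(1) by (rule emeasure_mono) simp
            then show ?thesis using emeasure_cubes[OF R] emeasure_cubes[OF Qc[of j]] by simp
          qed
          have Sj: "Sj j \<le> (K * \<rho> powr q) powr s * (mw R powr s * vol R)"
          proof -
            have W: "mw (Q j) * vol (Q j) \<le> K * \<rho> powr q * (mw R * vol R)"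
              by (rule mw_doubling[OF R Qc j(1) near])
            have mQ: "0 < vol (Q j)" "0 < mw (Q j)" using Qc[of j] mw(1)[OF Qc[of j]] by auto
            \<comment> \<open>Written through the mass of \<open>w\<close>, which doubling controls;
              the remaining power \<open>1 - s\<close> of the volume is negative, so passing to the
              smaller volume of \<open>R\<close> is an upper bound.\<close>
            have "Sj j = (mw (Q j) * vol (Q j)) powr s * vol (Q j) powr (1 - s)"
              using mQ by (simp add: Sj_def powr_mult powr_diff mult_ac)
            also have "\<dots> \<le> (K * \<rho> powr q * (mw R * vol R)) powr s * vol R powr (1 - s)"
              by (rule mult_mono[OF powr_mono2[OF _ _ W] powr_mono2'[OF _ mR mono]]) (use mQ s in auto)
            also have "\<dots> = (K * \<rho> powr q) powr s * (mw R powr s * vol R)"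
              using mR by (simp add: powr_mult powr_diff mult_ac)
            finally show ?thesis .
          qed
          have "c' * C2 * (a j powr s * Sj j) * (\<Sum>i\<le>j. \<xi> ^ i) \<le> c' * C2 * (a j powr s * ((K * \<rho> powr q) powr s * (mw R powr s * vol R))) * (1 / (1 - \<xi>))"
            using Sj g c' C2 \<xi> by (intro mult_mono mult_left_mono) (auto simp: Sj_def intro: sum_nonneg)
          also have "\<dots> = A2 * ((a j * mw R) powr s * vol R)"
            by (simp add: A2_def powr_mult mult_ac)
          finally show "c' * C2 * (a j powr s * Sj j) * (\<Sum>i\<le>j. \<xi> ^ i) \<le> A2 * ((a j * mw R) powr s * vol R)" .
        qed
        also have "\<dots> \<le> ennreal (max A1 A2 * ((a j * mw R) powr s * vol R))"
          by (intro ennreal_leI mult_right_mono) auto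
        finally show ?thesis .
      qed
      also have "\<dots> \<le> ennreal (A * (a j * mw R) powr s * vol R)"
      proof -
        have "max A1 A2 * ((a j * mw R) powr s * vol R) \<le> A * ((a j * mw R) powr s * vol R)"
          using A12 by (intro mult_right_mono) (auto simp: A_def)
        then show ?thesis by (simp add: ennreal_leI mult.assoc)
      qed
      finally show ?thesis using apos[of j] vlow j(1) by (intro exI[where x = "a j"]) auto
    qed
    have int: "lint (\<lambda>x. g x * v x) \<le> ennreal (C * B * N 0 powr \<kappa>)"
      if g[measurable]: "g \<in> lmeas" and gpos: "\<And>x. 0 \<le> g x" and B: "0 \<le> B"
        and gN: "\<And>i. (\<integral>\<^sup>+x\<in>Q i. ennreal (g x * w x) \<partial>lebesgue) \<le> ennreal (B * N i powr \<kappa>)" for g B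
    proof -
      have "lint (\<lambda>x. g x * v x) \<le> (\<integral>\<^sup>+x. (\<Sum>i. ennreal (a i) * (ennreal (g x * w x) * indicator (Q i) x)) \<partial>lebesgue)"
      proof (rule nn_integral_mono)
        fix x
        have "ennreal (g x * v x) = ennreal (a (ix x)) * (ennreal (g x * w x) * indicator (Q (ix x)) x)"
          using ixQ[of x] gpos[of x] w_nonneg[of x] apos[of "ix x"] by (simp add: v_def ennreal_mult[symmetric] mult_ac)
        also have "\<dots> = (\<Sum>i\<in>{ix x}. ennreal (a i) * (ennreal (g x * w x) * indicator (Q i) x))" by simp
        also have "\<dots> \<le> (\<Sum>i. ennreal (a i) * (ennreal (g x * w x) * indicator (Q i) x))"
          by (intro sum_le_suminf) auto
        finally show "ennreal (g x * v x) \<le> (\<Sum>i. ennreal (a i) * (ennreal (g x * w x) * indicator (Q i) x))" .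
      qed
      also have "\<dots> = (\<Sum>i. ennreal (a i) * (\<integral>\<^sup>+x\<in>Q i. ennreal (g x * w x) \<partial>lebesgue))"
        by (simp add: nn_integral_suminf nn_integral_cmult)
      also have "\<dots> \<le> (\<Sum>i. ennreal (B * N 0 powr \<kappa> * C1 powr (\<gamma> - \<kappa>) * (\<eta> powr (\<gamma> - \<kappa>)) ^ i))"
      proof (rule suminf_le)
        fix i
        have "ennreal (a i) * (\<integral>\<^sup>+x\<in>Q i. ennreal (g x * w x) \<partial>lebesgue) \<le> ennreal (a i) * ennreal (B * N i powr \<kappa>)"
          by (intro mult_left_mono gN) simp
        also have "\<dots> = ennreal (B * (a i * N i powr \<kappa>))"
          using apos[of i] B by (simp add: ennreal_mult[symmetric] mult_ac)
        \<comment> \<open>The surplus \<open>\<gamma> - \<kappa> > 0\<close> turns the Morrey bounds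
          into a geometric series through the decay of \<nu>.\<close>
        also have "a i * N i powr \<kappa> = N 0 powr \<kappa> * (N 0 / N i) powr (\<gamma> - \<kappa>)"
          using \<nu>p[of i] \<nu>p[of 0] by (simp add: a_def powr_divide powr_diff)
        also have "ennreal (B * \<dots>) \<le> ennreal (B * (N 0 powr \<kappa> * (C1 * \<eta> ^ i) powr (\<gamma> - \<kappa>)))"
          using Ndec[of i] \<nu>p[of i] \<nu>p[of 0] \<gamma> B
          by (intro ennreal_leI mult_left_mono powr_mono2) (auto simp: divide_le_eq)
        also have "(C1 * \<eta> ^ i) powr (\<gamma> - \<kappa>) = C1 powr (\<gamma> - \<kappa>) * (\<eta> powr (\<gamma> - \<kappa>)) ^ i"
          using \<eta> by (simp add: powr_mult powr_realpow[symmetric] powr_powr mult.commute)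
        finally show "ennreal (a i) * (\<integral>\<^sup>+x\<in>Q i. ennreal (g x * w x) \<partial>lebesgue) \<le> ennreal (B * N 0 powr \<kappa> * C1 powr (\<gamma> - \<kappa>) * (\<eta> powr (\<gamma> - \<kappa>)) ^ i)"
          by (simp add: mult_ac)
      qed auto
      also have "\<dots> = ennreal (\<Sum>i. B * N 0 powr \<kappa> * C1 powr (\<gamma> - \<kappa>) * (\<eta> powr (\<gamma> - \<kappa>)) ^ i)"
        using \<eta>1 B by (intro suminf_ennreal2 summable_mult summable_geometric) auto
      also have "(\<Sum>i. B * N 0 powr \<kappa> * C1 powr (\<gamma> - \<kappa>) * (\<eta> powr (\<gamma> - \<kappa>)) ^ i) = B * N 0 powr \<kappa> * C1 powr (\<gamma> - \<kappa>) * (1 / (1 - \<eta> powr (\<gamma> - \<kappa>)))"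
        using \<eta>1 by (subst suminf_mult) (auto simp: suminf_geometric summable_geometric)
      finally show ?thesis by (simp add: C_def mult_ac)
    qed
    have "localized s \<kappa> \<nu> A C d t v"
      unfolding localized_def
    proof (intro conjI allI impI ballI vm vpos vQ cube)
      fix g B assume "g \<in> lmeas" "\<forall>x. 0 \<le> g x" "0 \<le> B"
        "\<forall>Q\<in>cubes. (\<integral>\<^sup>+x\<in>Q. ennreal (g x * w x) \<partial>lebesgue) \<le> ennreal (B * \<nu> Q powr \<kappa>)"
      then show "lint (\<lambda>x. g x * v x) \<le> ennreal (C * B * \<nu> (cb d t) powr \<kappa>)"
        using int[of g B] Qc by (simp add: N_def Q0)
    qed
    then show ?thesis by blast
  qed
  moreover have "0 < A" using A12 by (simp add: A_def)
  ultimately show ?thesis using C by blast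
qed

end

text \<open>Continuity: a strict inequality at the critical exponent \<kappa> itself leaves room for
  a slightly larger \<gamma>.\<close>

lemma exists_right_neighbour:
  fixes h :: "real \<Rightarrow> real"
  assumes "isCont h \<kappa>" "h \<kappa> < b" "\<kappa> < u"
  shows "\<exists>\<gamma>. \<kappa> < \<gamma> \<and> \<gamma> < u \<and> h \<gamma> < b"
proof -
  have "(h \<longlongrightarrow> h \<kappa>) (at_right \<kappa>)" using assms(1) by (simp add: isCont_def filterlim_at_split)
  then have "eventually (\<lambda>\<gamma>. h \<gamma> < b) (at_right \<kappa>)" using assms(2) by (rule order_tendstoD)
  moreover have "eventually (\<lambda>\<gamma>. \<gamma> \<in> {\<kappa><..<u}) (at_right \<kappa>)" using assms(3) by (rule eventually_at_right_real)
  ultimately have "eventually (\<lambda>\<gamma>. h \<gamma> < b \<and> \<gamma> \<in> {\<kappa><..<u}) (at_right \<kappa>)" by (rule eventually_conj)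
  then show ?thesis using eventually_happens'[of "at_right \<kappa>"] by force
qed

section \<open>Choice of the decay exponent for the two normalisations\<close>

context RH_weight
begin

lemma vol_dilated_cube:
  fixes d :: "real ^ 'n"
  assumes "0 < t"
  shows "vol (cb d (2 ^ k * t)) = (2 ^ CARD('n)) ^ k * vol (cb d t)"
  using assms by (simp add: measure_cb power_mult_distrib power_mult[symmetric] mult.commute)

lemma powr_factor_bound:
  fixes b x y \<theta> :: real
  assumes "0 < b" "0 < y" "0 \<le> \<theta>" "0 \<le> x" "x \<le> b * y"
  shows "x powr \<theta> \<le> b powr \<theta> * y powr \<theta>"
  using powr_mono2[OF assms(3,4,5)] by (simp add: powr_mult)

text \<open>With \<kappa> = 1 + pr/n and s = (p_+/p)', the bound on \<kappa> is the condition r <=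
  -n sigma'/p_+. It makes the growth ratio at \<gamma> = \<kappa> at most 1 for the plain reverse
  Hoelder rate, and the strictly smaller rate \<eta> pushes it below 1.\<close>

lemma localized_weight_w:
  assumes s: "1 < s" "s \<le> \<sigma>" and \<kappa>: "0 \<le> \<kappa>" "(1 - 1 / s) / (1 - 1 / \<sigma>) \<le> 1 - \<kappa>"
  shows "\<exists>A C. 0 < A \<and> 0 < C \<and> (\<forall>d t. 0 < t \<longrightarrow> (\<exists>v. localized s \<kappa> (\<lambda>Q. mw Q * vol Q) A C d t v))"
proof -
  obtain \<eta> C where \<eta>: "0 < \<eta>" "\<eta> < 2 powr - (CARD('n) * (1 - 1 / \<sigma>))" and C: "1 \<le> C"
    and decay: "\<forall>d t k. 0 < t \<longrightarrow> mw (cb d t) * vol (cb d t) \<le>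
       C * \<eta> ^ k * (mw (cb d (2 ^ k * t)) * vol (cb d (2 ^ k * t)))"
    using mw_decay by blast
  have K: "0 < K" using ap by (rule ap_const_pos)
  have \<sigma>1: "0 < 1 - 1 / \<sigma>" "0 < 1 - 1 / s" using \<sigma> s by auto
  have "2 powr - (CARD('n) * (1 - 1 / \<sigma>)) \<le> 2 powr (0::real)" using \<sigma>1 by (intro powr_mono) auto
  then have \<eta>1: "\<eta> < 1" using \<eta>(2) by simp
  have \<kappa>1: "\<kappa> < 1" using \<kappa>(2) divide_pos_pos[OF \<sigma>1(2,1)] by simp
  define B where "B = (2::real) ^ CARD('n)"
  have B: "0 < B" "1 \<le> B" by (auto simp: B_def)
  \<comment> \<open>The ratio of successive terms in hypothesis \<open>S\<close>: the volume to the
    power \<open>1 - s\<close> contributes \<open>B powr (s - 1)\<close>, the mass of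
    \<open>w\<close> to the power \<open>s * (1 - \<gamma>)\<close> the rest.\<close>
  define h where "h \<gamma> = B powr (s - 1) * \<eta> powr (s * (1 - \<gamma>))" for \<gamma>
  have "h \<kappa> < 1"
  proof -
    have pos: "0 < s * (1 - \<kappa>)" using s \<kappa>1 by simp
    have "\<eta> powr (s * (1 - \<kappa>)) < (2 powr - (CARD('n) * (1 - 1 / \<sigma>))) powr (s * (1 - \<kappa>))"
      using \<eta> pos by (intro powr_less_mono2) auto
    also have "\<dots> = 2 powr - (CARD('n) * (s * ((1 - \<kappa>) * (1 - 1 / \<sigma>))))" by (simp add: powr_powr mult_ac)
    also have "\<dots> \<le> 2 powr - (CARD('n) * (s - 1))"
    proof (rule powr_mono)
      have "1 - 1 / s \<le> (1 - \<kappa>) * (1 - 1 / \<sigma>)" using \<kappa>(2) \<sigma>1 by (simp add: pos_divide_le_eq)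
      then have "s * (1 - 1 / s) \<le> s * ((1 - \<kappa>) * (1 - 1 / \<sigma>))" using s by (intro mult_left_mono) auto
      moreover have "s * (1 - 1 / s) = s - 1" using s by (simp add: right_diff_distrib)
      ultimately have "s - 1 \<le> s * ((1 - \<kappa>) * (1 - 1 / \<sigma>))" by simp
      then show "- (real CARD('n) * (s * ((1 - \<kappa>) * (1 - 1 / \<sigma>)))) \<le> - (real CARD('n) * (s - 1))"
        by (simp add: mult_left_mono)
    qed simp
    also have "\<dots> = B powr - (s - 1)" by (simp add: B_def powr_powr algebra_simps flip: powr_realpow)
    finally have "h \<kappa> < B powr (s - 1) * B powr - (s - 1)" unfolding h_def using B by (intro mult_strict_left_mono) auto
    also have "\<dots> = 1" using B by (simp flip: powr_add)
    finally show ?thesis .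
  qed
  moreover have "isCont h \<kappa>" unfolding h_def using \<eta> by (intro continuous_intros) auto
  ultimately obtain \<gamma> where \<gamma>: "\<kappa> < \<gamma>" "\<gamma> < 1" "h \<gamma> < 1" using exists_right_neighbour \<kappa>1 by blast
  have mV: "0 < mw Q" "0 < vol Q" if "Q \<in> cubes" for Q using mw(1)[OF that] that by auto
  have trm: "(mw Q * vol Q) powr - (\<gamma> * s) * (vol Q * mw Q powr s) = vol Q powr (1 - s) * (mw Q * vol Q) powr (s * (1 - \<gamma>))"
    if "Q \<in> cubes" for Q
    using mV[OF that] by (simp add: powr_mult powr_diff powr_minus right_diff_distrib field_simps)
  show ?thesis
  proof (rule localized_weight[where D = "K * B powr q" and ?C1.0 = C and \<eta> = \<eta> and \<gamma> = \<gamma> and \<xi> = "h \<gamma>" and ?C2.0 = "C powr (s * (1 - \<gamma>))"])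
    show "0 < mw Q * vol Q" if "Q \<in> cubes" for Q using mV[OF that] by simp
    fix d :: "real ^ 'n" and t :: real and k :: nat assume t: "0 < t"
    have cub: "cb d t \<in> cubes" "cb d (2 * t) \<in> cubes" "cb d (2 ^ k * t) \<in> cubes" using t by auto
    have sub: "cb d t \<subseteq> cb d (2 * t)" using t by (intro cb_mono) auto
    show "mw (cb d t) * vol (cb d t) \<le> mw (cb d (2 * t)) * vol (cb d (2 * t))"
      using wint_mono_set[OF sub, of w] mw(2)[OF cub(1)] mw(2)[OF cub(2)] mV[OF cub(2)]
      by (simp add: ennreal_le_iff del: cubes_measure_pos)
    show "mw (cb d (2 * t)) * vol (cb d (2 * t)) \<le> K * B powr q * (mw (cb d t) * vol (cb d t))"
      using vol_dilated_cube[OF t, of d 1] by (intro mw_doubling cub sub) (simp add: B_def)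
    show dec: "mw (cb d t) * vol (cb d t) \<le> C * \<eta> ^ k * (mw (cb d (2 ^ k * t)) * vol (cb d (2 ^ k * t)))"
      using decay t by blast
    define V W V' W' where "V = vol (cb d t)" and "W = mw (cb d t) * vol (cb d t)"
      and "V' = vol (cb d (2 ^ k * t))" and "W' = mw (cb d (2 ^ k * t)) * vol (cb d (2 ^ k * t))"
    have pos: "0 < W" "0 < W'" using mV[OF cub(1)] mV[OF cub(3)] by (simp_all add: W_def W'_def)
    have "V powr (1 - s) = (B powr (s - 1)) ^ k * V' powr (1 - s)"
    proof -
      have "V' powr (1 - s) = (B ^ k) powr (1 - s) * V powr (1 - s)"
        unfolding V'_def V_def B_def vol_dilated_cube[OF t] by (rule powr_mult)
      moreover have "(B powr (s - 1)) ^ k * (B ^ k) powr (1 - s) = 1"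
        using B by (simp add: powr_powr mult.commute flip: powr_realpow powr_add) (simp add: algebra_simps)
      ultimately show ?thesis by (simp flip: mult.assoc)
    qed
    moreover have "W powr (s * (1 - \<gamma>)) \<le> C powr (s * (1 - \<gamma>)) * (\<eta> powr (s * (1 - \<gamma>))) ^ k * W' powr (s * (1 - \<gamma>))"
    proof -
      have "W powr (s * (1 - \<gamma>)) \<le> (C * \<eta> ^ k) powr (s * (1 - \<gamma>)) * W' powr (s * (1 - \<gamma>))"
        using dec pos C \<eta> s \<gamma> by (intro powr_factor_bound) (auto simp: W_def W'_def)
      also have "(C * \<eta> ^ k) powr (s * (1 - \<gamma>)) = C powr (s * (1 - \<gamma>)) * (\<eta> powr (s * (1 - \<gamma>))) ^ k"
        using \<eta> by (simp add: powr_mult powr_powr mult.commute flip: powr_realpow)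
      finally show ?thesis .
    qed
    ultimately have "V powr (1 - s) * W powr (s * (1 - \<gamma>)) \<le> ((B powr (s - 1)) ^ k * V' powr (1 - s)) *
        (C powr (s * (1 - \<gamma>)) * (\<eta> powr (s * (1 - \<gamma>))) ^ k * W' powr (s * (1 - \<gamma>)))"
      using B by (simp add: mult_left_mono)
    also have "\<dots> = C powr (s * (1 - \<gamma>)) * h \<gamma> ^ k * (V' powr (1 - s) * W' powr (s * (1 - \<gamma>)))"
      by (simp add: h_def power_mult_distrib mult_ac)
    finally show "(mw (cb d t) * vol (cb d t)) powr - (\<gamma> * s) * (vol (cb d t) * mw (cb d t) powr s) \<le> C powr (s * (1 - \<gamma>)) * h \<gamma> ^ k *
      ((mw (cb d (2 ^ k * t)) * vol (cb d (2 ^ k * t))) powr - (\<gamma> * s) * (vol (cb d (2 ^ k * t)) * mw (cb d (2 ^ k * t)) powr s))"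
      unfolding trm[OF cub(1)] trm[OF cub(3)] V_def W_def V'_def W'_def .
  qed (use s \<kappa> \<gamma> \<eta> \<eta>1 C B in \<open>auto simp: h_def\<close>)
qed

text \<open>Here the coefficients decay like powers of the volume, so \<open>w\<close> enters only
  through its power \<open>s\<close>. For \<kappa> = 1 + pr/n the bound on \<kappa> is r <= -n/(p
  sigma) - n/p_+, again the case where the plain reverse Hoelder rate gives ratio at most 1.\<close>

lemma localized_weight_lebesgue:
  assumes s: "1 < s" "s \<le> \<sigma>" and \<kappa>: "0 \<le> \<kappa>" "\<kappa> \<le> 1 / s - 1 / \<sigma>"
  shows "\<exists>A C. 0 < A \<and> 0 < C \<and> (\<forall>d t. 0 < t \<longrightarrow> (\<exists>v. localized s \<kappa> (vol) A C d t v))"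
proof -
  obtain \<eta> C where \<eta>: "0 < \<eta>" "\<eta> < 2 powr - (CARD('n) * (1 - 1 / \<sigma>))" and C: "1 \<le> C"
    and decay: "\<forall>d t k. 0 < t \<longrightarrow> mw (cb d t) * vol (cb d t) \<le>
       C * \<eta> ^ k * (mw (cb d (2 ^ k * t)) * vol (cb d (2 ^ k * t)))"
    using mw_decay by blast
  define B where "B = (2::real) ^ CARD('n)"
  have B: "0 < B" "1 < B" by (auto simp: B_def one_less_power)
  define h where "h \<gamma> = B powr (s - 1 + \<gamma> * s) * \<eta> powr s" for \<gamma>
  have "h \<kappa> < 1"
  proof -
    have "\<eta> powr s < (2 powr - (CARD('n) * (1 - 1 / \<sigma>))) powr s"
      using \<eta> s by (intro powr_less_mono2) auto
    also have "\<dots> = B powr - (s * (1 - 1 / \<sigma>))" by (simp add: B_def powr_powr algebra_simps flip: powr_realpow)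
    finally have "h \<kappa> < B powr (s - 1 + \<kappa> * s) * B powr - (s * (1 - 1 / \<sigma>))"
      unfolding h_def using B by (intro mult_strict_left_mono) auto
    also have "\<dots> = B powr (s - 1 + \<kappa> * s - s * (1 - 1 / \<sigma>))" by (simp flip: powr_add)
    also have "\<dots> \<le> B powr 0"
    proof (rule powr_mono)
      have "\<kappa> * s \<le> (1 / s - 1 / \<sigma>) * s" using \<kappa> s by (intro mult_right_mono) auto
      also have "\<dots> = 1 - s / \<sigma>" using s by (simp add: left_diff_distrib)
      finally show "s - 1 + \<kappa> * s - s * (1 - 1 / \<sigma>) \<le> 0" by (simp add: right_diff_distrib)
    qed (use B in auto)
    finally show ?thesis using B by simp
  qed
  moreover have "isCont h \<kappa>" unfolding h_def using B by (intro continuous_intros) auto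
  ultimately obtain \<gamma> where \<gamma>: "\<kappa> < \<gamma>" "h \<gamma> < 1" using exists_right_neighbour[where h = h and \<kappa> = \<kappa> and b = 1 and u = "\<kappa> + 1"] by auto
  have mV: "0 < mw Q" "0 < vol Q" if "Q \<in> cubes" for Q using mw(1)[OF that] that by auto
  define \<epsilon> where "\<epsilon> = s - 1 + \<gamma> * s"
  have trm: "vol Q powr - (\<gamma> * s) * (vol Q * mw Q powr s) = vol Q powr - \<epsilon> * (mw Q * vol Q) powr s" if "Q \<in> cubes" for Q
  proof -
    have "vol Q powr - \<epsilon> = vol Q / (vol Q powr s * vol Q powr (\<gamma> * s))"
      using mV[OF that] by (simp add: \<epsilon>_def powr_diff powr_minus powr_add field_simps)
    then show ?thesis using mV[OF that] by (simp add: powr_mult powr_minus_divide field_simps)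
  qed
  show ?thesis
  proof (rule localized_weight[where D = B and ?C1.0 = 1 and \<eta> = "1 / B" and \<gamma> = \<gamma> and \<xi> = "h \<gamma>" and ?C2.0 = "C powr s"])
    fix d :: "real ^ 'n" and t :: real and k :: nat assume t: "0 < t"
    have cub: "cb d t \<in> cubes" "cb d (2 ^ k * t) \<in> cubes" using t by auto
    note V = vol_dilated_cube[OF t, folded B_def]
    show "vol (cb d t) \<le> vol (cb d (2 * t))" "vol (cb d (2 * t)) \<le> B * vol (cb d t)"
      using V[of d 1] B mV(2)[OF cub(1)] by (simp_all del: cubes_measure_pos)
    show "vol (cb d t) \<le> 1 * (1 / B) ^ k * vol (cb d (2 ^ k * t))"
      unfolding V using B by (simp add: power_one_over)
    define X W W' where "X = vol (cb d t)" and "W = mw (cb d t) * vol (cb d t)"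
      and "W' = mw (cb d (2 ^ k * t)) * vol (cb d (2 ^ k * t))"
    have pos: "0 < W" "0 < W'" using mV[OF cub(1)] mV[OF cub(2)] by (simp_all add: W_def W'_def)
    have "X powr - \<epsilon> = (B powr \<epsilon>) ^ k * (B ^ k * X) powr - \<epsilon>"
    proof -
      have "(B powr \<epsilon>) ^ k * (B ^ k) powr - \<epsilon> = 1"
        using B by (simp add: powr_powr mult.commute flip: powr_realpow powr_add)
      then show ?thesis by (simp add: powr_mult flip: mult.assoc)
    qed
    moreover have "W powr s \<le> C powr s * (\<eta> powr s) ^ k * W' powr s"
    proof -
      have "W \<le> C * \<eta> ^ k * W'" unfolding W_def W'_def using decay t by blast
      then have "W powr s \<le> (C * \<eta> ^ k) powr s * W' powr s"
        using pos C \<eta> s by (intro powr_factor_bound) auto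
      also have "(C * \<eta> ^ k) powr s = C powr s * (\<eta> powr s) ^ k"
        using \<eta> by (simp add: powr_mult powr_powr mult.commute flip: powr_realpow)
      finally show ?thesis .
    qed
    ultimately have "X powr - \<epsilon> * W powr s \<le> ((B powr \<epsilon>) ^ k * (B ^ k * X) powr - \<epsilon>) * (C powr s * (\<eta> powr s) ^ k * W' powr s)"
      using B by (simp add: mult_left_mono)
    also have "\<dots> = C powr s * h \<gamma> ^ k * ((B ^ k * X) powr - \<epsilon> * W' powr s)"
      by (simp add: h_def \<epsilon>_def power_mult_distrib mult_ac)
    finally show "vol (cb d t) powr - (\<gamma> * s) * (vol (cb d t) * mw (cb d t) powr s) \<le> C powr s * h \<gamma> ^ k *
      (vol (cb d (2 ^ k * t)) powr - (\<gamma> * s) * (vol (cb d (2 ^ k * t)) * mw (cb d (2 ^ k * t)) powr s))"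
      unfolding trm[OF cub(1)] trm[OF cub(2)] X_def W_def W'_def V[of d k, symmetric] .
  qed (use s \<kappa> \<gamma> \<eta> C B mV in \<open>auto simp: h_def\<close>)
qed

text \<open>The factor \<open>\<alpha> powr s\<close> from the mean of \<open>v powr s\<close>
  cancels against \<open>\<alpha> powr - s\<close> from the dual mean, so the constant is
  independent of the cube. The dual power of \<open>v powr s\<close> for the exponent
  \<open>s * (q - 1) + 1\<close> is that of \<open>v\<close> for \<open>q\<close>.\<close>

lemma localized_ap:
  assumes v: "localized s \<kappa> \<nu> A C d t v" and s: "0 < s" and A: "0 < A"
  shows "ap (s * (q - 1) + 1) (A * K powr s) (\<lambda>x. v x powr s)"
  unfolding ap_def
proof (intro conjI allI ballI)
  have [measurable]: "v \<in> lmeas" and vpos: "\<And>x. 0 < v x"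
    using v by (auto simp: localized_def)
  show "(\<lambda>x. v x powr s) \<in> lmeas" by measurable
  show "0 < v x powr s" for x using vpos[of x] by simp
  fix R :: "(real ^ 'n) set" assume R: "R \<in> cubes"
  then have mR: "0 < vol R" by simp
  obtain \<alpha> where \<alpha>: "0 < \<alpha>" "\<And>x. x \<in> R \<Longrightarrow> \<alpha> * w x \<le> v x"
    and le: "wint (\<lambda>x. v x powr s) R \<le> ennreal (A * (\<alpha> * mw R) powr s * vol R)"
    using localized_cube[OF v R] by blast
  obtain a b where ab: "0 < a" "0 < b" "wint w R = ennreal (a * vol R)"
      "wint (\<lambda>x. w x powr (- 1 / (q - 1))) R = ennreal (b * vol R)" "a * b powr (q - 1) \<le> K"
    using ap R unfolding ap_def by blast
  have "a * vol R = mw R * vol R"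
    using ab(1,3) mw[OF R] mR by (simp add: ennreal_inj)
  then have a: "a = mw R" using mR by simp
  have "0 < wint (\<lambda>x. v x powr s) R" using R vpos by (intro wint_pos) (auto simp: less_imp_neq[symmetric])
  then obtain a' where a': "wint (\<lambda>x. v x powr s) R = ennreal a'" "0 < a'"
    using le by (cases "wint (\<lambda>x. v x powr s) R") (auto simp: top_unique)
  have e: "(v x powr s) powr (- 1 / (s * (q - 1) + 1 - 1)) = v x powr (- 1 / (q - 1))" for x
    using s q by (simp add: powr_powr)
  have le2: "wint (\<lambda>x. v x powr (- 1 / (q - 1))) R \<le> ennreal (\<alpha> powr (- 1 / (q - 1)) * b * vol R)"
  proof -
    have "wint (\<lambda>x. v x powr (- 1 / (q - 1))) R \<le> wint (\<lambda>x. \<alpha> powr (- 1 / (q - 1)) * w x powr (- 1 / (q - 1))) R"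
    proof (rule wint_mono)
      fix x assume "x \<in> R"
      then have "v x powr (- 1 / (q - 1)) \<le> (\<alpha> * w x) powr (- 1 / (q - 1))"
        using \<alpha> w_pos[of x] q by (intro powr_mono2') auto
      then show "v x powr (- 1 / (q - 1)) \<le> \<alpha> powr (- 1 / (q - 1)) * w x powr (- 1 / (q - 1))" by (simp only: powr_mult)
    qed
    also have "\<dots> = ennreal (\<alpha> powr (- 1 / (q - 1))) * wint (\<lambda>x. w x powr (- 1 / (q - 1))) R"
      using R by (intro wint_cmult) auto
    also have "\<dots> = ennreal (\<alpha> powr (- 1 / (q - 1)) * b * vol R)"
      using ab by (simp add: ennreal_mult[symmetric] mult.assoc)
    finally show ?thesis .
  qed
  have "0 < wint (\<lambda>x. v x powr (- 1 / (q - 1))) R" using R vpos by (intro wint_pos) (auto simp: less_imp_neq[symmetric])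
  then obtain b' where b': "wint (\<lambda>x. v x powr (- 1 / (q - 1))) R = ennreal b'" "0 < b'"
    using le2 by (cases "wint (\<lambda>x. v x powr (- 1 / (q - 1))) R") (auto simp: top_unique)
  define x where "x = a' / vol R"
  define y where "y = b' / vol R"
  have xy: "0 < x" "0 < y" "a' = x * vol R" "b' = y * vol R" using a' b' mR by (auto simp: x_def y_def)
  have "x \<le> A * (\<alpha> * mw R) powr s"
  proof -
    have "x * vol R \<le> A * (\<alpha> * mw R) powr s * vol R"
      using le A unfolding a'(1) xy(3) by (subst (asm) ennreal_le_iff) auto
    then show ?thesis using mR by (rule mult_right_le_imp_le)
  qed
  moreover have "y \<le> \<alpha> powr (- 1 / (q - 1)) * b"
  proof -
    have "y * vol R \<le> \<alpha> powr (- 1 / (q - 1)) * b * vol R"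
      using le2 ab unfolding b'(1) xy(4) by (subst (asm) ennreal_le_iff) auto
    then show ?thesis using mR by (rule mult_right_le_imp_le)
  qed
  then have "y powr (s * (q - 1)) \<le> (\<alpha> powr (- 1 / (q - 1)) * b) powr (s * (q - 1))"
    using xy s q by (intro powr_mono2) auto
  ultimately have "x * y powr (s * (q - 1)) \<le> A * (\<alpha> * mw R) powr s * (\<alpha> powr (- 1 / (q - 1)) * b) powr (s * (q - 1))"
    using xy A by (intro mult_mono) auto
  also have "\<dots> = A * (a * b powr (q - 1)) powr s"
  proof -
    have "- 1 / (q - 1) * (s * (q - 1)) = - s" using q by simp
    then have "(\<alpha> powr (- 1 / (q - 1))) powr (s * (q - 1)) = \<alpha> powr - s" by (simp only: powr_powr)
    moreover have "\<alpha> powr s * \<alpha> powr - s = 1" using \<alpha> by (simp flip: powr_add)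
    moreover have "A * (\<alpha> * mw R) powr s * (\<alpha> powr (- 1 / (q - 1)) * b) powr (s * (q - 1))
      = (\<alpha> powr s * (\<alpha> powr (- 1 / (q - 1))) powr (s * (q - 1))) * (A * (mw R powr s * b powr (s * (q - 1))))"
      by (simp only: powr_mult mult_ac)
    ultimately show ?thesis by (simp add: a powr_mult powr_powr mult.commute)
  qed
  also have "\<dots> \<le> A * K powr s" using ab A s by (intro mult_left_mono powr_mono2) auto
  finally have "x * y powr (s * (q - 1)) \<le> A * K powr s" .
  then show "\<exists>a b. 0 < a \<and> 0 < b \<and> wint (\<lambda>x. v x powr s) R = ennreal (a * vol R) \<and>
     wint (\<lambda>x. (v x powr s) powr (- 1 / (s * (q - 1) + 1 - 1))) R = ennreal (b * vol R) \<and>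
     a * b powr (s * (q - 1) + 1 - 1) \<le> A * K powr s"
    unfolding e using a' b' xy by (intro exI[where x = x] exI[where x = y]) auto
qed

text \<open>As in \<open>localized_ap\<close>, \<open>\<alpha>\<close> cancels; the pointwise bounds
  of \<open>w\<close> by its mean and of \<open>v\<close> by \<open>\<alpha> * w\<close> take the
  place of the dual mean.\<close>

lemma localized_a1:
  assumes v: "localized s \<kappa> \<nu> A C d t v" and s: "0 < s" and A: "0 < A" and w: "a1 L w"
  shows "a1 (A * L powr s) (\<lambda>x. v x powr s)"
  unfolding a1_def
proof (intro conjI allI ballI)
  have [measurable]: "v \<in> lmeas" and vpos: "\<And>x. 0 < v x"
    using v by (auto simp: localized_def)
  show "(\<lambda>x. v x powr s) \<in> lmeas" by measurable
  show "0 < v x powr s" for x using vpos[of x] by simp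
  have L: "0 < L" using w by (rule a1_const_pos)
  fix R :: "(real ^ 'n) set" assume R: "R \<in> cubes"
  then have mR: "0 < vol R" by simp
  obtain \<alpha> where \<alpha>: "0 < \<alpha>" "\<And>x. x \<in> R \<Longrightarrow> \<alpha> * w x \<le> v x"
    and le: "wint (\<lambda>x. v x powr s) R \<le> ennreal (A * (\<alpha> * mw R) powr s * vol R)"
    using localized_cube[OF v R] by blast
  obtain a where a: "0 < a" "wint w R = ennreal (a * vol R)" "AE x in lebesgue. x \<in> R \<longrightarrow> a \<le> L * w x"
    using w R unfolding a1_def by blast
  have "a * vol R = mw R * vol R"
    using a(1,2) mw[OF R] mR by (simp add: ennreal_inj)
  then have am: "a = mw R" using mR by simp
  have "0 < wint (\<lambda>x. v x powr s) R" using R vpos by (intro wint_pos) (auto simp: less_imp_neq[symmetric])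
  then obtain a' where a': "wint (\<lambda>x. v x powr s) R = ennreal a'" "0 < a'"
    using le by (cases "wint (\<lambda>x. v x powr s) R") (auto simp: top_unique)
  define x where "x = a' / vol R"
  have x: "0 < x" "a' = x * vol R" using a' mR by (auto simp: x_def)
  have xle: "x \<le> A * (\<alpha> * mw R) powr s"
  proof -
    have "x * vol R \<le> A * (\<alpha> * mw R) powr s * vol R"
      using le A unfolding a'(1) x(2) by (subst (asm) ennreal_le_iff) auto
    then show ?thesis using mR by (rule mult_right_le_imp_le)
  qed
  have "AE y in lebesgue. y \<in> R \<longrightarrow> x \<le> A * L powr s * v y powr s"
    using a(3)
  proof eventually_elim
    case (elim y)
    show ?case
    proof
      assume y: "y \<in> R"
      have "\<alpha> * mw R \<le> \<alpha> * (L * w y)" using elim y \<alpha> am by (intro mult_left_mono) auto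
      also have "\<dots> = L * (\<alpha> * w y)" by simp
      also have "\<dots> \<le> L * v y" using \<alpha>(2)[OF y] L by (intro mult_left_mono) auto
      finally have "(\<alpha> * mw R) powr s \<le> (L * v y) powr s"
        using \<alpha> mw(1)[OF R] s by (intro powr_mono2) auto
      then have "A * (\<alpha> * mw R) powr s \<le> A * (L powr s * v y powr s)" using A by (simp add: powr_mult)
      then show "x \<le> A * L powr s * v y powr s" using xle by (simp add: mult.assoc)
    qed
  qed
  then show "\<exists>m>0. wint (\<lambda>x. v x powr s) R = ennreal (m * vol R) \<and>
     (AE y in lebesgue. y \<in> R \<longrightarrow> m \<le> A * L powr s * v y powr s)"
    using a' x by blast
qed

end

section \<open>Boundedness on Morrey spaces\<close>

lemma muckenhoupt_const_cong_AE:
  fixes u v :: "real ^ 'n \<Rightarrow> real"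
  assumes "AE x in lebesgue. u x = v x" shows "muckenhoupt_const p u = muckenhoupt_const p v"
proof -
  have m: "mean Q u = mean Q v" "mean Q (\<lambda>x. u x powr e) = mean Q (\<lambda>x. v x powr e)" for Q e
    unfolding mean_wint using assms by (auto intro!: arg_cong2[where f = "(/)"] wint_cong_AE elim!: eventually_mono)
  have "(AE x in lebesgue. x \<in> Q \<longrightarrow> c \<le> d * ennreal (u x)) \<longleftrightarrow> (AE x in lebesgue. x \<in> Q \<longrightarrow> c \<le> d * ennreal (v x))"
    for Q :: "(real ^ 'n) set" and c d using assms by (rule eventually_cong[OF _ _]) auto
  then show ?thesis unfolding muckenhoupt_const_def m by simp
qed

text \<open>Finiteness of the quasinorm is rewritten as a bound for the integrals of |f|^p over
  cubes, the form in which the weights act. One statement covers both normalisations through \<nu>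
  and \<open>N\<close>.\<close>

lemma morrey_transfer:
  fixes \<nu> :: "(real ^ 'n) set \<Rightarrow> real" and N :: "(real ^ 'n \<Rightarrow> complex) \<Rightarrow> ennreal"
  assumes p: "0 < p" and \<nu>: "\<And>Q. Q \<in> cubes \<Longrightarrow> 0 < \<nu> Q"
    and N: "\<And>f. N f = (SUP Q\<in>cubes. ennreal (\<nu> Q powr - (\<kappa> / p)) * Lp_norm p w Q f)"
    and C: "0 < C" and main: "\<And>f B. f \<in> lmeas \<Longrightarrow> 0 < B \<Longrightarrow>
      (\<forall>Q\<in>cubes. pint_on Q p w f \<le> ennreal (B * \<nu> Q powr \<kappa>)) \<Longrightarrow>
      f \<in> \<D> \<and> (\<forall>Q\<in>cubes. pint_on Q p w (T f) \<le> ennreal (C * B * \<nu> Q powr \<kappa>))"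
  shows "{f \<in> lmeas. N f < top} \<subseteq> \<D> \<and>
    (\<exists>c::real. \<forall>f\<in>{f \<in> lmeas. N f < top}. N (T f) \<le> ennreal c * N f)"
proof -
  have step: "f \<in> \<D> \<and> N (T f) \<le> ennreal (C powr (1 / p) * x)"
    if f: "f \<in> lmeas" and x: "0 < x" "N f \<le> ennreal x" for f x
  proof -
    have bound: "pint_on Q p w f \<le> ennreal (x powr p * \<nu> Q powr \<kappa>)" if Q: "Q \<in> cubes" for Q
    proof -
      have 1: "ennreal (\<nu> Q powr (\<kappa> / p)) * ennreal (\<nu> Q powr - (\<kappa> / p)) = 1"
        using \<nu>[OF Q] by (simp add: ennreal_mult[symmetric] powr_add[symmetric])
      have "ennreal (\<nu> Q powr - (\<kappa> / p)) * Lp_norm p w Q f \<le> N f"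
        unfolding N by (rule SUP_upper[OF Q])
      then have "ennreal (\<nu> Q powr (\<kappa> / p)) * (ennreal (\<nu> Q powr - (\<kappa> / p)) * Lp_norm p w Q f) \<le> ennreal (\<nu> Q powr (\<kappa> / p)) * ennreal x"
        using x(2) by (intro mult_left_mono) auto
      then have "Lp_norm p w Q f \<le> ennreal (\<nu> Q powr (\<kappa> / p) * x)"
        using x(1) by (simp add: mult.assoc[symmetric] 1 ennreal_mult[symmetric])
      then have "enn_powr (Lp_norm p w Q f) p \<le> enn_powr (ennreal (\<nu> Q powr (\<kappa> / p) * x)) p"
        using p by (intro enn_powr_mono) auto
      then show ?thesis using p x(1) by (simp add: Lp_norm_def enn_powr_powr powr_mult powr_powr mult.commute)
    qed
    have m: "f \<in> \<D>" "\<And>Q. Q \<in> cubes \<Longrightarrow> pint_on Q p w (T f) \<le> ennreal (C * x powr p * \<nu> Q powr \<kappa>)"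
      using main[OF f, of "x powr p"] bound x(1) by auto
    have "N (T f) \<le> ennreal (C powr (1 / p) * x)"
      unfolding N
    proof (rule SUP_least)
      fix Q :: "(real ^ 'n) set" assume Q: "Q \<in> cubes"
      have "Lp_norm p w Q (T f) \<le> enn_powr (ennreal (C * x powr p * \<nu> Q powr \<kappa>)) (1 / p)"
        unfolding Lp_norm_def using p m(2)[OF Q] by (intro enn_powr_mono) auto
      also have "\<dots> = ennreal (C powr (1 / p) * x * \<nu> Q powr (\<kappa> / p))"
        using p C x(1) by (simp add: powr_mult powr_powr)
      finally have "ennreal (\<nu> Q powr - (\<kappa> / p)) * Lp_norm p w Q (T f) \<le> ennreal (\<nu> Q powr - (\<kappa> / p)) * ennreal (C powr (1 / p) * x * \<nu> Q powr (\<kappa> / p))"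
        by (rule mult_left_mono) simp
      also have "\<dots> = ennreal (C powr (1 / p) * x)"
        using \<nu>[OF Q] x(1) by (simp add: ennreal_mult[symmetric] powr_minus field_simps)
      finally show "ennreal (\<nu> Q powr - (\<kappa> / p)) * Lp_norm p w Q (T f) \<le> ennreal (C powr (1 / p) * x)" .
    qed
    with m(1) show ?thesis by simp
  qed
  have "f \<in> \<D> \<and> N (T f) \<le> ennreal (C powr (1 / p)) * N f" if f: "f \<in> lmeas" "N f < top" for f
  proof -
    obtain y where y: "N f = ennreal y" "0 \<le> y" using f(2) by (cases "N f") auto
    have "f \<in> \<D>" using step[OF f(1), of "y + 1"] y by (auto simp: ennreal_leI simp del: ennreal_plus)
    moreover have "N (T f) \<le> ennreal (C powr (1 / p) * y)"
    \<comment> \<open>\<open>main\<close> requires \<open>0 < B\<close>, so a possibly vanishing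
      norm \<open>y\<close> is enlarged by \<delta>, which then tends to 0.\<close>
    proof (rule ennreal_le_epsilon)
      fix e :: real assume e: "0 < e"
      define \<delta> where "\<delta> = e / C powr (1 / p)"
      have \<delta>: "0 < \<delta>" "C powr (1 / p) * (y + \<delta>) = C powr (1 / p) * y + e"
        using e C by (auto simp: \<delta>_def field_simps)
      have "N (T f) \<le> ennreal (C powr (1 / p) * (y + \<delta>))"
        using step[OF f(1), of "y + \<delta>"] y \<delta>(1) by (auto simp: ennreal_leI simp del: ennreal_plus)
      also have "\<dots> = ennreal (C powr (1 / p) * y) + ennreal e"
        unfolding \<delta>(2) using y e by (intro ennreal_plus) auto
      finally show "N (T f) \<le> ennreal (C powr (1 / p) * y) + ennreal e" .
    qed
    ultimately show ?thesis using y by (simp add: ennreal_mult)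
  qed
  then show ?thesis by blast
qed

lemma (in RH_weight) localized_cong:
  assumes "0 < t" and eq: "\<And>Q. Q \<in> cubes \<Longrightarrow> \<nu> Q = \<nu>' Q" and v: "localized s \<kappa> \<nu> A C d t v"
  shows "localized s \<kappa> \<nu>' A C d t v"
proof -
  have 1: "(\<forall>Q\<in>cubes. F Q \<le> ennreal (N * \<nu> Q powr \<kappa>)) \<longleftrightarrow> (\<forall>Q\<in>cubes. F Q \<le> ennreal (N * \<nu>' Q powr \<kappa>))" for F N
    by (intro ball_cong refl) (simp add: eq)
  have 2: "\<nu> (cb d t) = \<nu>' (cb d t)" using assms(1) by (intro eq) simp
  show ?thesis using v unfolding localized_def 1 2 .
qed

text \<open>For each cube the weight built for it converts the Morrey bounds into a single global
  bound for the weight \<open>v\<close>, to which \<open>U\<close> applies; \<open>w \<le> v\<close>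
  on the cube brings the estimate back.\<close>

lemma (in RH_weight) localized_bound:
  assumes \<nu>: "\<And>Q. Q \<in> cubes \<Longrightarrow> 0 < \<nu> Q" and loc: "\<And>d t. 0 < t \<Longrightarrow> \<exists>v. localized s \<kappa> \<nu> A C d t v" and C: "0 < C"
    and U: "\<And>v B f d t. localized s \<kappa> \<nu> A C d t v \<Longrightarrow> 0 < B \<Longrightarrow> f \<in> lmeas \<Longrightarrow>
      pint p v f \<le> ennreal B \<Longrightarrow>
      f \<in> \<D> \<and> pint p v (T f) \<le> ennreal (CU * B)"
    and f[measurable]: "f \<in> lmeas" and B: "0 < B"
    and fB: "\<forall>Q\<in>cubes. pint_on Q p w f \<le> ennreal (B * \<nu> Q powr \<kappa>)"
  shows "f \<in> \<D> \<and> (\<forall>Q\<in>cubes. pint_on Q p w (T f) \<le> ennreal (CU * C * B * \<nu> Q powr \<kappa>))"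
proof -
  have "f \<in> \<D> \<and> pint_on Q p w (T f) \<le> ennreal (CU * C * B * \<nu> Q powr \<kappa>)"
    if Q: "Q \<in> cubes" for Q
  proof -
    obtain d t where t: "0 < t" "Q = cb d t" using Q by (rule cube_cases)
    obtain v where v: "localized s \<kappa> \<nu> A C d t v" using loc[OF t(1)] by blast
    have "pint p v f \<le> ennreal (C * B * \<nu> Q powr \<kappa>)"
      using v fB B unfolding localized_def t(2) by simp
    then have *: "f \<in> \<D>" "pint p v (T f) \<le> ennreal (CU * (C * B * \<nu> Q powr \<kappa>))"
      using U[OF v, of "C * B * \<nu> Q powr \<kappa>" f] C B \<nu>[OF Q] by auto
    have wv: "w x \<le> v x" if "x \<in> Q" for x using v that unfolding localized_def t(2) by blast
    have "pint_on Q p w (T f) \<le> pint p v (T f)"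
      by (intro nn_integral_mono) (auto simp: indicator_def intro!: ennreal_leI mult_left_mono wv)
    then show ?thesis using * by (simp add: mult.assoc)
  qed
  moreover have "cb (0 :: real ^ 'n) 1 \<in> cubes" by simp
  ultimately show ?thesis by blast
qed

context
  fixes pm p0 pp p :: real and T :: "(real ^ 'n \<Rightarrow> complex) \<Rightarrow> (real ^ 'n \<Rightarrow> complex)"
    and c1 :: "ennreal \<Rightarrow> real"
  assumes pm: "1 \<le> pm" "pm \<le> p0" "p0 \<le> pp" and p: "pm < p \<or> p = pm \<and> p0 = pm" "p < pp"
    and op: "operator_on (limited_domain pm pp p0) T"
    and bound: "\<And>w f. w \<in> limited_weights pm pp p0 \<Longrightarrow> f \<in> Lp_space p0 w \<Longrightarrow>
           Lp_norm p0 w UNIV (T f) \<le> ennreal (c1 (muckenhoupt_const p0 w)) * Lp_norm p0 w UNIV f"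
begin

text \<open>For \<open>pm < p\<close> this is extrapolation. At the endpoint
  \<open>p = pm = p0\<close> the weight \<open>v powr s\<close> is in A_1 and
  \<open>v = (v powr s) powr (1 - p / pp)\<close> is already a factored weight with second factor 1,
  so the uniform bound applies directly.\<close>

lemma localized_operator_bound:
  fixes w :: "real ^ 'n \<Rightarrow> real" and \<nu> :: "(real ^ 'n) set \<Rightarrow> real"
  defines "s \<equiv> pp / (pp - p)"
  assumes w: "RH_weight w q K \<sigma> c" and qp: "pm < p \<Longrightarrow> q = p / pm" and L: "p = pm \<Longrightarrow> a1 L w" and A: "0 < A"
  shows "\<exists>CU>0. \<forall>v B f d t. RH_weight.localized w s \<kappa> \<nu> A C d t v \<longrightarrow> 0 < B \<longrightarrow> f \<in> lmeas \<longrightarrow>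
      pint p v f \<le> ennreal B \<longrightarrow>
      f \<in> limited_domain pm pp p0 \<and> pint p v (T f) \<le> ennreal (CU * B)"
proof -
  interpret RH_weight w q K \<sigma> c by fact
  have s: "0 < s" "s * (1 - p / pp) = 1" using p pm by (auto simp: s_def field_simps)
  show ?thesis
  proof (cases "pm < p")
    case True
    obtain CU where CU: "0 < CU" "\<And>v B f. v \<in> lmeas \<Longrightarrow> (\<And>x. 0 < v x) \<Longrightarrow>
      ap (s * (p / pm - 1) + 1) (A * K powr s) (\<lambda>x. v x powr s) \<Longrightarrow> 0 < B \<Longrightarrow> f \<in> lmeas \<Longrightarrow>
      pint p v f \<le> ennreal B \<Longrightarrow>
      f \<in> limited_domain pm pp p0 \<and> pint p v (T f) \<le> ennreal (CU * B)"
      using extrapolation[OF pm True p(2) op bound, of "A * K powr s"] unfolding s_def[symmetric] by blast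
    have "f \<in> limited_domain pm pp p0 \<and> pint p v (T f) \<le> ennreal (CU * B)"
      if v: "localized s \<kappa> \<nu> A C d t v" and B: "0 < B" "f \<in> lmeas"
        "pint p v f \<le> ennreal B" for v B f d t
    proof -
      have "v \<in> lmeas" "\<And>x. 0 < v x" using v by (auto simp: localized_def)
      moreover have "ap (s * (p / pm - 1) + 1) (A * K powr s) (\<lambda>x. v x powr s)"
        using localized_ap[OF v s(1) A] qp[OF True] by simp
      ultimately show ?thesis using B by (intro CU(2))
    qed
    then show ?thesis using CU(1) by blast
  next
    case False
    then have eq: "p = pm" "p0 = pm" using p by auto
    define A' where "A' = max 1 (A * L powr s)"
    have A': "0 < A'" by (simp add: A'_def)
    obtain CU where CU: "0 < CU" "\<And>u1 u2 f. a1 A' u1 \<Longrightarrow> a1 A' u2 \<Longrightarrow> f \<in> lmeas \<Longrightarrow>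
      pint p0 (\<lambda>x. u1 x powr (1 - p0 / pp) * u2 x powr - (p0 / pm - 1)) f < top \<Longrightarrow>
      f \<in> limited_domain pm pp p0 \<and>
      pint p0 (\<lambda>x. u1 x powr (1 - p0 / pp) * u2 x powr - (p0 / pm - 1)) (T f)
      \<le> ennreal CU * pint p0 (\<lambda>x. u1 x powr (1 - p0 / pp) * u2 x powr - (p0 / pm - 1)) f"
      using limited_operator_uniform_bound[OF pm A' bound] by blast
    have one: "a1 A' (\<lambda>_ :: real ^ 'n. 1)"
      unfolding a1_def A'_def by (auto simp: wint_const intro!: exI[where x = 1])
    have "f \<in> limited_domain pm pp p0 \<and> pint p v (T f) \<le> ennreal (CU * B)"
      if v: "localized s \<kappa> \<nu> A C d t v" and B: "0 < B" "f \<in> lmeas"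
        "pint p v f \<le> ennreal B" for v B f d t
    proof -
      have vpos: "0 < v x" for x using v by (auto simp: localized_def)
      have a: "a1 A' (\<lambda>x. v x powr s)"
        using localized_a1[OF v s(1) A L[OF eq(1)]] by (rule a1_mono) (simp add: A'_def)
      have W: "(v x powr s) powr (1 - p0 / pp) * (1::real) powr - (p0 / pm - 1) = v x" for x
        using vpos[of x] s(2) eq by (simp add: powr_powr)
      have fin: "pint p v f < top"
        by (rule le_less_trans[OF B(3)]) simp
      have "f \<in> limited_domain pm pp p0 \<and> pint p v (T f)
        \<le> ennreal CU * pint p v f"
        using CU(2)[OF a one B(2), unfolded W] fin eq by simp
      moreover have "ennreal CU * pint p v f \<le> ennreal CU * ennreal B"
        by (intro mult_left_mono B) simp
      moreover have "ennreal CU * ennreal B = ennreal (CU * B)" using CU(1) B(1) by (simp add: ennreal_mult)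
      ultimately show ?thesis by (auto intro: order_trans)
    qed
    then show ?thesis using CU(1) by blast
  qed
qed

lemma morrey_bounds:
  fixes w :: "real ^ 'n \<Rightarrow> real"
  defines "s \<equiv> pp / (pp - p)"
  assumes w: "w \<in> muckenhoupt (p / pm)" "w \<in> reverse_Holder (ereal \<sigma>)" and s\<sigma>: "s \<le> \<sigma>" and \<kappa>0: "0 \<le> \<kappa>"
    and \<nu>: "\<nu> = (\<lambda>Q. enn2real (wint w Q)) \<and> (1 - 1 / s) / (1 - 1 / \<sigma>) \<le> 1 - \<kappa> \<or> \<nu> = vol \<and> \<kappa> \<le> 1 / s - 1 / \<sigma>"
  shows "\<exists>C>0. \<forall>f B. f \<in> lmeas \<longrightarrow> 0 < B \<longrightarrow>
      (\<forall>Q\<in>cubes. pint_on Q p w f \<le> ennreal (B * \<nu> Q powr \<kappa>)) \<longrightarrow>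
      f \<in> limited_domain pm pp p0 \<and> (\<forall>Q\<in>cubes. pint_on Q p w (T f) \<le> ennreal (C * B * \<nu> Q powr \<kappa>))"
proof -
  have s1: "1 < s" using p pm by (auto simp: s_def field_simps)
  have \<sigma>1: "1 < \<sigma>" using s1 s\<sigma> by simp
  have t: "1 \<le> p / pm" using p pm by (auto simp: field_simps)
  have weight: "weight w" and wpos: "AE x in lebesgue. 0 < w x" and const: "muckenhoupt_const (p / pm) w < top"
    using w(1) by (auto simp: muckenhoupt_def)
  have [measurable]: "w \<in> lmeas" by (rule weight_measurable) fact
  \<comment> \<open>The classes give positivity only almost everywhere; a change on a null set makes
    it hold everywhere, as \<open>ap\<close> and \<open>a1\<close> demand, and affects none of the
    integrals.\<close>
  define w' where "w' x = (if 0 < w x then w x else 1)" for x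
  have w'm[measurable]: "w' \<in> lmeas" unfolding w'_def[abs_def] by measurable
  have w'pos: "0 < w' x" for x by (simp add: w'_def)
  have eq: "AE x in lebesgue. w x = w' x" using wpos by eventually_elim (simp add: w'_def)
  have wint: "wint (\<lambda>x. w x powr e) Q = wint (\<lambda>x. w' x powr e) Q" "wint w Q = wint w' Q" for e Q
    using eq by (auto intro!: wint_cong_AE elim!: eventually_mono)
  have int: "pint_on Q p w f = pint_on Q p w' f"
    for Q and f :: "real ^ 'n \<Rightarrow> complex"
    using eq by (intro nn_integral_cong_AE) (auto elim!: eventually_mono)
  have weight': "weight w'"
    using weight_wint_finite[OF weight] w'pos by (intro weightI) (auto simp: wint less_imp_le)
  obtain K where K: "0 < K" "muckenhoupt_const (p / pm) w' \<le> ennreal K" "muckenhoupt_const (p / pm) w' < ennreal (K + 1)"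
  proof -
    obtain k where k: "muckenhoupt_const (p / pm) w = ennreal k" "0 \<le> k" using const by (cases "muckenhoupt_const (p / pm) w") auto
    show thesis
      using k muckenhoupt_const_cong_AE[OF eq, of "p / pm"]
      by (intro that[of "k + 1"]) (auto simp: ennreal_leI ennreal_less_iff simp del: ennreal_plus)
  qed
  \<comment> \<open>For \<open>p = pm\<close> the weight is in A_1 and is treated as an A_2
    weight.\<close>
  define q where "q = (if p / pm = 1 then 2 else p / pm)"
  obtain c0 where c0: "\<And>Q. Q \<in> cubes \<Longrightarrow> enn_powr (mean Q (\<lambda>x. w x powr \<sigma>)) (1 / \<sigma>) \<le> ennreal c0 * mean Q w"
    using w(2) unfolding reverse_Holder_def by auto
  have "RH_weight w' q (K + 1) \<sigma> (max 1 c0 powr \<sigma>)"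
  proof
    show "ap q (K + 1) w'" unfolding q_def by (intro muckenhoupt_const_ap weight' w'pos t K)
    show "1 < q" unfolding q_def
      by (rule if_split[of "\<lambda>x. 1 < x", THEN iffD2]) (use t in linarith)
    show "wint (\<lambda>x. w' x powr \<sigma>) Q \<le> ennreal (max 1 c0 powr \<sigma> * m powr \<sigma> * vol Q)"
      if Q: "Q \<in> cubes" and m: "0 < m" "wint w' Q = ennreal (m * vol Q)" for Q m
    proof -
      have "mean Q w = ennreal m" using m by (intro mean_eq Q) (auto simp: wint)
      then have "enn_powr (mean Q (\<lambda>x. w x powr \<sigma>)) (1 / \<sigma>) \<le> ennreal c0 * ennreal m" using c0[OF Q] by simp
      also have "\<dots> \<le> ennreal (max 1 c0) * ennreal m" by (intro mult_right_mono ennreal_leI) auto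
      also have "\<dots> = ennreal (max 1 c0 * m)" using m by (intro ennreal_mult[symmetric]) auto
      finally have "enn_powr (enn_powr (mean Q (\<lambda>x. w x powr \<sigma>)) (1 / \<sigma>)) \<sigma> \<le> enn_powr (ennreal (max 1 c0 * m)) \<sigma>"
        using \<sigma>1 by (intro enn_powr_mono) auto
      then have le: "mean Q (\<lambda>x. w x powr \<sigma>) \<le> ennreal (max 1 c0 powr \<sigma> * m powr \<sigma>)"
        using \<sigma>1 m by (simp add: enn_powr_powr powr_mult)
      have "wint (\<lambda>x. w' x powr \<sigma>) Q = mean Q (\<lambda>x. w x powr \<sigma>) * ennreal (vol Q)"
        unfolding wint(1)[symmetric] by (rule wint_mean[OF Q])
      also have "\<dots> \<le> ennreal (max 1 c0 powr \<sigma> * m powr \<sigma>) * ennreal (vol Q)"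
        by (intro mult_right_mono le) simp
      finally show ?thesis by (simp add: ennreal_mult)
    qed
  qed (use \<sigma>1 in auto)
  then interpret RH_weight w' q "K + 1" \<sigma> "max 1 c0 powr \<sigma>" .
  have L: "a1 (K + 1) w'" if "p = pm"
    using K(3) that pm by (intro a1_of_muckenhoupt_const weight' w'pos) simp
  have qp: "q = p / pm" if "pm < p" using that pm by (auto simp: q_def)
  have \<nu>w: "enn2real (wint w Q) = mw Q * vol Q" if "Q \<in> cubes" for Q
    using mw[OF that] by (simp add: wint)
  have \<nu>pos: "0 < \<nu> Q" if "Q \<in> cubes" for Q
    using \<nu> \<nu>w[OF that] mw(1)[OF that] cubes_measure_pos[OF that] by (elim disjE conjE) simp_all
  define \<nu>' where "\<nu>' Q = (if \<nu> = vol then vol Q else mw Q * vol Q)" for Q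
  have \<nu>': "\<nu> Q = \<nu>' Q" if "Q \<in> cubes" for Q
    using \<nu> \<nu>w[OF that] by (auto simp: \<nu>'_def)
  obtain A C where AC: "0 < A" "0 < C" "\<And>d t. 0 < t \<Longrightarrow> \<exists>v. localized s \<kappa> \<nu>' A C d t v"
  proof (cases "\<nu> = vol \<and> \<kappa> \<le> 1 / s - 1 / \<sigma>")
    case True
    then have "\<nu>' = vol" by (auto simp: \<nu>'_def)
    then show ?thesis using localized_weight_lebesgue[OF s1 s\<sigma> \<kappa>0] True that by blast
  next
    case False
    then have c: "(1 - 1 / s) / (1 - 1 / \<sigma>) \<le> 1 - \<kappa>" and "\<nu> = (\<lambda>Q. enn2real (wint w Q))" using \<nu> by auto
    obtain A C where AC: "0 < A" "0 < C" "\<And>d t. 0 < t \<Longrightarrow> \<exists>v. localized s \<kappa> (\<lambda>Q. mw Q * vol Q) A C d t v"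
      using localized_weight_w[OF s1 s\<sigma> \<kappa>0 c] by blast
    have "mw Q * vol Q = \<nu>' Q" if "Q \<in> cubes" for Q
      using \<nu>'[OF that] \<nu>w[OF that] \<open>\<nu> = (\<lambda>Q. enn2real (wint w Q))\<close> by simp
    then have "\<exists>v. localized s \<kappa> \<nu>' A C d t v" if "0 < t" for d t
      using AC(3)[OF that, of d] localized_cong[OF that, of "\<lambda>Q. mw Q * vol Q" \<nu>'] by blast
    then show ?thesis using AC(1,2) that by blast
  qed
  obtain CU where CU: "0 < CU" "\<And>v B f d t. localized s \<kappa> \<nu>' A C d t v \<Longrightarrow> 0 < B \<Longrightarrow> f \<in> lmeas \<Longrightarrow>
      pint p v f \<le> ennreal B \<Longrightarrow>
      f \<in> limited_domain pm pp p0 \<and> pint p v (T f) \<le> ennreal (CU * B)"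
    using localized_operator_bound[OF RH_weight_axioms qp L AC(1), of \<kappa> \<nu>' C] unfolding s_def[symmetric] by blast
  have \<nu>'pos: "0 < \<nu>' Q" if "Q \<in> cubes" for Q using \<nu>pos \<nu>' that by simp
  show ?thesis
  proof (intro exI[where x = "CU * C"] conjI allI impI)
    fix f :: "real ^ 'n \<Rightarrow> complex" and B :: real
    assume f: "f \<in> lmeas" "0 < B"
      "\<forall>Q\<in>cubes. pint_on Q p w f \<le> ennreal (B * \<nu> Q powr \<kappa>)"
    have "f \<in> limited_domain pm pp p0 \<and> (\<forall>Q\<in>cubes. pint_on Q p w' (T f) \<le> ennreal (CU * C * B * \<nu>' Q powr \<kappa>))"
      by (rule localized_bound[OF \<nu>'pos AC(3) AC(2) CU(2) f(1,2)]) (use f(3) \<nu>' in \<open>auto simp: int\<close>)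
    then show "f \<in> limited_domain pm pp p0" "\<forall>Q\<in>cubes. pint_on Q p w (T f) \<le> ennreal (CU * C * B * \<nu> Q powr \<kappa>)"
      using \<nu>' by (auto simp: int)
  qed (use CU(1) AC(2) in simp)
qed

end

section \<open>Return to the quasinorms of the theorem\<close>

lemma set_lebesgue_integral_weight:
  assumes "weight w" "Q \<in> cubes" shows "(LINT x:Q|lebesgue. w x) = enn2real (wint w Q)"
proof -
  have [measurable]: "w \<in> lmeas" "Q \<in> sets lebesgue"
    using assms weight_measurable by auto
  have "0 \<le> w x" for x using assms(1) by (simp add: weight_def)
  then have "(LINT x:Q|lebesgue. w x) = enn2real (lint (\<lambda>x. indicator Q x *\<^sub>R w x))"
    unfolding set_lebesgue_integral_def by (intro integral_eq_nn_integral) auto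
  also have "lint (\<lambda>x. indicator Q x *\<^sub>R w x) = wint w Q"
    unfolding wint_def by (intro nn_integral_cong) (auto simp: indicator_def)
  finally show ?thesis .
qed

lemma enn2real_wint_pos:
  assumes "weight w" "AE x in lebesgue. 0 < w x" "Q \<in> cubes" shows "0 < enn2real (wint w Q)"
proof -
  have [measurable]: "w \<in> lmeas" using assms weight_measurable by auto
  define w' where "w' x = (if 0 < w x then w x else 1)" for x
  have [measurable]: "w' \<in> lmeas" unfolding w'_def[abs_def] by measurable
  have "wint w Q = wint w' Q"
    using assms(2) by (intro wint_cong_AE) (auto elim!: eventually_mono simp: w'_def)
  moreover have "0 < wint w' Q" using assms(3) by (intro wint_pos) (auto simp: w'_def)
  ultimately show ?thesis
    using weight_wint_finite[OF assms(1,3)] by (simp add: enn2real_positive_iff)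
qed

lemma nn_integral_UNIV_le_cubes:
  fixes F :: "real ^ 'n \<Rightarrow> ennreal"
  assumes [measurable]: "F \<in> lmeas" and le: "\<And>Q. Q \<in> cubes \<Longrightarrow> (\<integral>\<^sup>+x\<in>Q. F x \<partial>lebesgue) \<le> B"
  shows "(\<integral>\<^sup>+x. F x \<partial>lebesgue) \<le> B"
proof -
  have "(SUP k. F x * indicator (cb 0 (real k + 1)) x) = F x" for x
  proof (rule antisym)
    obtain t where "x \<in> cb 0 t" using subset_cb[of "{x}" 0] by auto
    moreover obtain k where "t \<le> real k" using real_arch_simple by blast
    ultimately have "x \<in> cb 0 (real k + 1)" using cb_mono[of t "real k + 1" 0] by auto
    then show "F x \<le> (SUP k. F x * indicator (cb 0 (real k + 1)) x)"
      by (intro SUP_upper2[of k]) auto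
  qed (auto intro!: SUP_least simp: indicator_def)
  then have "(\<integral>\<^sup>+x. F x \<partial>lebesgue) = (\<integral>\<^sup>+x. (SUP k. F x * indicator (cb 0 (real k + 1)) x) \<partial>lebesgue)" by simp
  also have "\<dots> = (SUP k. \<integral>\<^sup>+x\<in>cb 0 (real k + 1). F x \<partial>lebesgue)"
  proof (rule nn_integral_monotone_convergence_SUP)
    show "incseq (\<lambda>k x. F x * indicator (cb 0 (real k + 1)) x)"
    proof (intro incseq_SucI le_funI mult_left_mono)
      fix k and x :: "real ^ 'n"
      have "cb (0 :: real ^ 'n) (real k + 1) \<subseteq> cb 0 (real (Suc k) + 1)" by (rule cb_mono) simp
      then show "indicator (cb 0 (real k + 1)) x \<le> (indicator (cb 0 (real (Suc k) + 1)) x :: ennreal)"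
        by (auto simp: indicator_def)
    qed simp
  qed measurable
  also have "\<dots> \<le> B" by (intro SUP_least le) auto
  finally show ?thesis .
qed

theorem corollary4p9:
  fixes pm p0 pp :: real
    and T :: "(real ^ 'n \<Rightarrow> complex) \<Rightarrow> (real ^ 'n \<Rightarrow> complex)"
    and c1 :: "ennreal \<Rightarrow> real"
  assumes "1 \<le> pm" and "pm \<le> p0" and "p0 \<le> pp"
    and "operator_on (limited_domain pm pp p0) T"
    and "\<And>w f. w \<in> limited_weights pm pp p0 \<Longrightarrow> f \<in> Lp_space p0 w \<Longrightarrow>
           Lp_norm p0 w UNIV (T f) \<le> ennreal (c1 (muckenhoupt_const p0 w)) * Lp_norm p0 w UNIV f"
  shows "\<forall>(p::real) (\<sigma>::ereal) (w :: real ^ 'n \<Rightarrow> real) (r::real).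
     (pm < p \<and> p < pp \<or> p = pm \<and> p0 = pm) \<and>
     conj_exp (ereal (pp / p)) \<le> \<sigma> \<and> (\<sigma> = \<infinity> \<longrightarrow> p = pp) \<and>
     w \<in> muckenhoupt (p / pm) \<inter> reverse_Holder \<sigma> \<and>
     - real CARD('n) / p \<le> r
     \<longrightarrow>
     (ereal r \<le> - (ereal (real CARD('n)) * conj_exp \<sigma> / ereal pp) \<longrightarrow>
        morrey_space p r w \<subseteq> limited_domain pm pp p0 \<and>
        (\<exists>c2::real. \<forall>f\<in>morrey_space p r w.
           morrey_norm p r w (T f) \<le> ennreal c2 * morrey_norm p r w f)) \<and>
     (ereal r \<le> - (ereal (real CARD('n)) / (ereal p * \<sigma>)) - ereal (real CARD('n) / pp) \<longrightarrow>
        morrey_lambda_space p r w \<subseteq> limited_domain pm pp p0 \<and>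
        (\<exists>c3::real. \<forall>f\<in>morrey_lambda_space p r w.
           morrey_lambda_norm p r w (T f) \<le> ennreal c3 * morrey_lambda_norm p r w f))"
proof (intro allI impI, elim conjE)
  fix p :: real and \<sigma> :: ereal and w :: "real ^ 'n \<Rightarrow> real" and r :: real
  note pm = assms(1-3) and op = assms(4) and bound = assms(5)
  define n where "n = real CARD('n)"
  have n: "0 < n" by (simp add: n_def)
  assume p: "pm < p \<and> p < pp \<or> p = pm \<and> p0 = pm" and \<sigma>: "conj_exp (ereal (pp / p)) \<le> \<sigma>"
    and \<sigma>_inf: "\<sigma> = \<infinity> \<longrightarrow> p = pp" and w: "w \<in> muckenhoupt (p / pm) \<inter> reverse_Holder \<sigma>" and "- real CARD('n) / p \<le> r"
  then have r: "- n / p \<le> r" by (simp add: n_def)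
  have pos: "0 < p" "0 < pm" "0 < pp" using p pm by auto
  \<comment> \<open>The exponent of growth of the integrals of |f|^p over cubes;
    \<open>\<kappa> = 0\<close> corresponds to \<open>r = - n / p\<close>, the weighted Lebesgue
    space.\<close>
  define \<kappa> where "\<kappa> = 1 + p * r / n"
  have \<kappa>: "- (1 / p + r / n) = - (\<kappa> / p)" using pos n by (simp add: \<kappa>_def field_simps)
  have \<kappa>0: "0 \<le> \<kappa>" using r pos n by (simp add: \<kappa>_def field_simps)
  have weight: "weight w" and wpos: "AE x in lebesgue. 0 < w x" using w by (auto simp: muckenhoupt_def)
  have wm[measurable]: "w \<in> lmeas" by (rule weight_measurable) fact
  define \<nu> where "\<nu> Q = enn2real (wint w Q)" for Q
  have \<nu>pos: "0 < \<nu> Q" if "Q \<in> cubes" for Q unfolding \<nu>_def by (rule enn2real_wint_pos[OF weight wpos that])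
  have norm_w: "morrey_norm p r w f = (SUP Q\<in>cubes. ennreal (\<nu> Q powr - (\<kappa> / p)) * Lp_norm p w Q f)" for f
    unfolding morrey_norm_def n_def[symmetric] \<kappa> \<nu>_def
    by (intro SUP_cong refl) (simp add: set_lebesgue_integral_weight[OF weight])
  have norm_l: "morrey_lambda_norm p r w f = (SUP Q\<in>cubes. ennreal (vol Q powr - (\<kappa> / p)) * Lp_norm p w Q f)" for f
    unfolding morrey_lambda_norm_def n_def[symmetric] \<kappa> ..
  let ?main = "\<lambda>\<nu>. \<exists>C>0. \<forall>f B. f \<in> lmeas \<longrightarrow> 0 < B \<longrightarrow>
      (\<forall>Q\<in>cubes. pint_on Q p w f \<le> ennreal (B * \<nu> Q powr \<kappa>)) \<longrightarrow>
      f \<in> limited_domain pm pp p0 \<and> (\<forall>Q\<in>cubes. pint_on Q p w (T f) \<le> ennreal (C * B * \<nu> Q powr \<kappa>))"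
  have concl_w: "morrey_space p r w \<subseteq> limited_domain pm pp p0 \<and>
        (\<exists>c2::real. \<forall>f\<in>morrey_space p r w. morrey_norm p r w (T f) \<le> ennreal c2 * morrey_norm p r w f)" if m: "?main \<nu>"
  proof -
    obtain C where C: "0 < C" "\<And>f B. f \<in> lmeas \<Longrightarrow> 0 < B \<Longrightarrow>
      (\<forall>Q\<in>cubes. pint_on Q p w f \<le> ennreal (B * \<nu> Q powr \<kappa>)) \<Longrightarrow>
      f \<in> limited_domain pm pp p0 \<and> (\<forall>Q\<in>cubes. pint_on Q p w (T f) \<le> ennreal (C * B * \<nu> Q powr \<kappa>))"
      using m by blast
    show ?thesis unfolding morrey_space_def
      by (rule morrey_transfer[OF pos(1) \<nu>pos norm_w C(1) C(2)])
  qed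
  have concl_l: "morrey_lambda_space p r w \<subseteq> limited_domain pm pp p0 \<and>
        (\<exists>c3::real. \<forall>f\<in>morrey_lambda_space p r w. morrey_lambda_norm p r w (T f) \<le> ennreal c3 * morrey_lambda_norm p r w f)" if m: "?main (vol)"
  proof -
    obtain C where C: "0 < C" "\<And>f B. f \<in> lmeas \<Longrightarrow> 0 < B \<Longrightarrow>
      (\<forall>Q\<in>cubes. pint_on Q p w f \<le> ennreal (B * vol Q powr \<kappa>)) \<Longrightarrow>
      f \<in> limited_domain pm pp p0 \<and> (\<forall>Q\<in>cubes. pint_on Q p w (T f) \<le> ennreal (C * B * vol Q powr \<kappa>))"
      using m by blast
    show ?thesis unfolding morrey_lambda_space_def
      by (rule morrey_transfer[OF pos(1) cubes_measure_pos norm_l C(1) C(2)])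
  qed
  show "(ereal r \<le> - (ereal (real CARD('n)) * conj_exp \<sigma> / ereal pp) \<longrightarrow>
        morrey_space p r w \<subseteq> limited_domain pm pp p0 \<and>
        (\<exists>c2::real. \<forall>f\<in>morrey_space p r w.
           morrey_norm p r w (T f) \<le> ennreal c2 * morrey_norm p r w f)) \<and>
     (ereal r \<le> - (ereal (real CARD('n)) / (ereal p * \<sigma>)) - ereal (real CARD('n) / pp) \<longrightarrow>
        morrey_lambda_space p r w \<subseteq> limited_domain pm pp p0 \<and>
        (\<exists>c3::real. \<forall>f\<in>morrey_lambda_space p r w.
           morrey_lambda_norm p r w (T f) \<le> ennreal c3 * morrey_lambda_norm p r w f))"
  proof (cases "p < pp")
    case True
    \<comment> \<open>The value infinity of \<sigma> is confined to \<open>p = pp\<close>, so the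
      exponent is a real number here.\<close>
    then obtain \<sigma>' where \<sigma>': "\<sigma> = ereal \<sigma>'"
      using \<sigma> \<sigma>_inf conj_exp_ratio[of p pp] pos by (cases \<sigma>) auto
    define s where "s = pp / (pp - p)"
    have s: "1 / (1 - p / pp) = s" "1 / s = 1 - p / pp" "1 < s" using True pos by (auto simp: s_def field_simps)
    have "1 - p / pp \<noteq> 0" using True pos by simp
    then have s\<sigma>: "s \<le> \<sigma>'" using \<sigma> conj_exp_ratio[of p pp] True pos by (simp add: \<sigma>' s)
    then have \<sigma>1: "1 < \<sigma>'" using s by simp
    have main: "?main \<nu>'" if "\<nu>' = \<nu> \<and> (1 - 1 / s) / (1 - 1 / \<sigma>') \<le> 1 - \<kappa> \<or> \<nu>' = vol \<and> \<kappa> \<le> 1 / s - 1 / \<sigma>'" for \<nu>'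
    proof (rule morrey_bounds[OF pm _ True op bound])
      show "pp / (pp - p) \<le> \<sigma>'" using s\<sigma> by (simp add: s_def)
      show "\<nu>' = (\<lambda>Q. enn2real (wint w Q)) \<and> (1 - 1 / (pp / (pp - p))) / (1 - 1 / \<sigma>') \<le> 1 - \<kappa> \<or> \<nu>' = vol \<and> \<kappa> \<le> 1 / (pp / (pp - p)) - 1 / \<sigma>'"
        using that unfolding s_def \<nu>_def[abs_def] .
    qed (use p w \<kappa>0 \<sigma>' in auto)
    show ?thesis
    proof (intro conjI impI)
      assume "ereal r \<le> - (ereal (real CARD('n)) * conj_exp \<sigma> / ereal pp)"
      then have "r \<le> - (n * (\<sigma>' / (\<sigma>' - 1)) / pp)"
        using \<sigma>1 pos by (simp add: \<sigma>' conj_exp_real n_def)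
      moreover have "\<sigma>' / (\<sigma>' - 1) = 1 / (1 - 1 / \<sigma>')" using \<sigma>1 by (simp add: field_simps)
      ultimately have "p / n * r \<le> p / n * - (n * (1 / (1 - 1 / \<sigma>')) / pp)"
        using pos n by (intro mult_left_mono) auto
      also have "\<dots> = - ((1 - 1 / s) / (1 - 1 / \<sigma>'))" using n by (simp add: s(2))
      finally have "(1 - 1 / s) / (1 - 1 / \<sigma>') \<le> 1 - \<kappa>" by (simp add: \<kappa>_def)
      then show "morrey_space p r w \<subseteq> limited_domain pm pp p0"
        "\<exists>c2::real. \<forall>f\<in>morrey_space p r w. morrey_norm p r w (T f) \<le> ennreal c2 * morrey_norm p r w f"
        using concl_w[OF main[OF disjI1[OF conjI[OF refl]]]] by auto
    next
      assume "ereal r \<le> - (ereal (real CARD('n)) / (ereal p * \<sigma>)) - ereal (real CARD('n) / pp)"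
      then have "r \<le> - (n / (p * \<sigma>')) - n / pp" using pos \<sigma>1 by (simp add: \<sigma>' n_def)
      then have "p / n * r \<le> p / n * (- (n / (p * \<sigma>')) - n / pp)" using pos n by (intro mult_left_mono) auto
      also have "\<dots> = - (1 / \<sigma>') - p / pp" using pos n by (simp add: right_diff_distrib)
      finally have "\<kappa> \<le> 1 / s - 1 / \<sigma>'" by (simp add: \<kappa>_def s(2))
      then show "morrey_lambda_space p r w \<subseteq> limited_domain pm pp p0"
        "\<exists>c3::real. \<forall>f\<in>morrey_lambda_space p r w. morrey_lambda_norm p r w (T f) \<le> ennreal c3 * morrey_lambda_norm p r w f"
        using concl_l[OF main[OF disjI2[OF conjI[OF refl]]]] by auto
    qed
  next
    case False
    \<comment> \<open>Reaching \<open>p = pp\<close> forces all exponents to coincide and \<sigma>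
      to be infinite. Either upper bound on \<open>r\<close> then gives \<open>r = - n / p\<close>,
      so both Morrey spaces are L_(p,w) and the hypothesis on \<open>T\<close> applies to
      \<open>w\<close> itself.\<close>
    then have eq: "p = pp" "p0 = pp" "pm = pp" using p pm by auto
    then have \<sigma>': "\<sigma> = \<infinity>" using \<sigma> pos conj_exp_ratio[of p pp] by simp
    have mem: "w \<in> limited_weights pm pp p0"
      using w \<sigma>' eq conj_exp_ratio[of p pp] pos by (simp add: limited_weights_def)
    have main: "?main \<nu>'" if \<kappa>: "\<kappa> = 0" and \<nu>': "\<And>Q. Q \<in> cubes \<Longrightarrow> 0 < \<nu>' Q" for \<nu>' :: "(real ^ 'n) set \<Rightarrow> real"
    proof -
      define c where "c = max 1 (c1 (muckenhoupt_const p0 w))"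
      have "f \<in> limited_domain pm pp p0 \<and> (\<forall>Q\<in>cubes. pint_on Q p w (T f) \<le> ennreal (c powr p * B * \<nu>' Q powr \<kappa>))"
        if f[measurable]: "f \<in> lmeas" and B: "0 < B"
          and fB: "\<forall>Q\<in>cubes. pint_on Q p w f \<le> ennreal (B * \<nu>' Q powr \<kappa>)" for f B
      proof -
        have "pint p w f \<le> ennreal B"
        proof (rule nn_integral_UNIV_le_cubes)
          fix Q :: "(real ^ 'n) set" assume Q: "Q \<in> cubes"
          show "pint_on Q p w f \<le> ennreal B"
            using bspec[OF fB Q] \<nu>'[OF Q] by (simp add: \<kappa>)
        qed measurable
        then have "Lp_norm p w UNIV f \<le> enn_powr (ennreal B) (1 / p)"
          unfolding Lp_norm_def using pos by (intro enn_powr_mono) auto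
        then have fn: "Lp_norm p w UNIV f \<le> ennreal (B powr (1 / p))" using B by simp
        then have fLp: "f \<in> Lp_space p0 w" unfolding Lp_space_def using eq le_less_trans by fastforce
        have "Lp_norm p w UNIV (T f) \<le> ennreal (c1 (muckenhoupt_const p0 w)) * Lp_norm p w UNIV f"
          using bound[OF mem fLp] eq by simp
        also have "\<dots> \<le> ennreal c * ennreal (B powr (1 / p))"
          using fn by (intro mult_mono ennreal_leI) (auto simp: c_def)
        finally have "enn_powr (Lp_norm p w UNIV (T f)) p \<le> enn_powr (ennreal c * ennreal (B powr (1 / p))) p"
          using pos by (intro enn_powr_mono) auto
        then have Tf: "pint p w (T f) \<le> ennreal (c powr p * B)"
          using pos B by (simp add: Lp_norm_def enn_powr_mult enn_powr_powr powr_powr c_def ennreal_mult)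
        have "pint_on Q p w (T f) \<le> ennreal (c powr p * B * \<nu>' Q powr \<kappa>)" if Q: "Q \<in> cubes" for Q
        proof -
          have "pint_on Q p w (T f) \<le> pint p w (T f)"
            by (intro nn_integral_mono) (auto simp: indicator_def)
          then show ?thesis using Tf \<nu>'[OF Q] by (simp add: \<kappa>)
        qed
        then show ?thesis using fLp mem by (auto simp: limited_domain_def)
      qed
      moreover have "0 < c powr p" by (simp add: c_def max_def)
      ultimately show ?thesis by blast
    qed
    have \<kappa>1: "\<kappa> = 0" if "r \<le> - (n / pp)"
    proof -
      have "r = - (n / p)" using that r eq by simp
      then show ?thesis using pos n by (simp add: \<kappa>_def)
    qed
    show ?thesis
    proof (intro conjI impI)
      assume "ereal r \<le> - (ereal (real CARD('n)) * conj_exp \<sigma> / ereal pp)"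
      then have "r \<le> - (n / pp)" using pos by (simp add: \<sigma>' conj_exp_def n_def)
      then show "morrey_space p r w \<subseteq> limited_domain pm pp p0"
        "\<exists>c2::real. \<forall>f\<in>morrey_space p r w. morrey_norm p r w (T f) \<le> ennreal c2 * morrey_norm p r w f"
        using concl_w[OF main[OF \<kappa>1 \<nu>pos]] by auto
    next
      assume "ereal r \<le> - (ereal (real CARD('n)) / (ereal p * \<sigma>)) - ereal (real CARD('n) / pp)"
      then have "r \<le> - (n / pp)" using pos by (simp add: \<sigma>' n_def)
      then show "morrey_lambda_space p r w \<subseteq> limited_domain pm pp p0"
        "\<exists>c3::real. \<forall>f\<in>morrey_lambda_space p r w. morrey_lambda_norm p r w (T f) \<le> ennreal c3 * morrey_lambda_norm p r w f"
        using concl_l[OF main[OF \<kappa>1 cubes_measure_pos]] by auto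
    qed
  qed
qed

end
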